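(* Let $H$ be a complex Hilbert space, let $T$ be a Fredholm operator on $H$ of index zero, and let $d=\dim\operatorname{Ker}(T)$. Let $f\in\mathcal{D}_T$ and fix $A\in\mathcal{A}_T$. For a linear map $L:\operatorname{Ker}(T)\to H$ such that $\rho_T\circ L:\operatorname{Ker}(T)\to\operatorname{Coker}(T)$ is an isomorphism, and a basis $\{e_i\}_{i=1}^d$ of $\operatorname{Ker}(T)$ with dual basis $\{e_i^*\}_{i=1}^d$, consider $$\phi_T(f)=f(A)\cdot{\det}_F\left\{(T+A)(T+L\circ\pi_T)^{-1}\right\}\; e_1^*\wedge\cdots\wedge e_d^*\otimes\rho_T(L(e_1))\wedge\cdots\wedge\rho_T(L(e_d))$$ as an element of $\bigwedge^{\dim\operatorname{Ker}(T)}\operatorname{Ker}(T)^*\otimes\bigwedge^{\dim\operatorname{Coker}(T)}\operatorname{Coker}(T)$. Then $\phi_T(f)$ depends neither on the choice of the linear map $L$ satisfying the condition that $\rho_T\circ L$ is an isomorphism, nor on the choice of the basis $\{e_i\}$ of $\operatorname{Ker}(T)$.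
   Context: $\mathcal{I}_1$ denotes the space of trace class operators on $H$. For $K\in\mathcal{I}_1$, ${\det}_F(Id+K)=\prod(1+\lambda_i)$ is the Fredholm determinant, where $\lambda_i$ are the eigenvalues of $K$ (with algebraic multiplicity). For a Fredholm operator $T$ of index zero: $\mathcal{A}_T=\{A\in\mathcal{I}_1 \mid T+A \text{ is invertible}\}$. $\mathcal{D}_T$ is the one-dimensional complex vector space of functions $f:\mathcal{A}_T\to\mathbb{C}$ satisfying $f(B)={\det}_F\{(T+A)(T+B)^{-1}\}\,f(A)$ for all $A,B\in\mathcal{A}_T$ (note $(T+A)(T+B)^{-1}=Id+(A-B)(T+B)^{-1}$). $\pi_T:H\to H$ is the orthogonal projection onto $\operatorname{Ker}(T)$ and $\rho_T:H\to\operatorname{Coker}(T)=H/\operatorname{Im}(T)$ is the natural projection. When $\rho_T\circ L$ is an isomorphism, $T+L\circ\pi_T$ is an isomorphism of $H$, and $L\circ\pi_T$ has finite rank. *)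

theory Defs
  imports "HOL-Analysis.Analysis" "HOL-Algebra.Module" "HOL-Library.Poly_Mapping"
begin

class scaleC =
  fixes scaleC :: "complex \<Rightarrow> 'a \<Rightarrow> 'a" (infixr \<open>*\<^sub>C\<close> 75)

class complex_vector = scaleC + ab_group_add +
  assumes scaleC_add_right: "a *\<^sub>C (x + y) = a *\<^sub>C x + a *\<^sub>C y"
    and scaleC_add_left: "(a + b) *\<^sub>C x = a *\<^sub>C x + b *\<^sub>C x"
    and scaleC_scaleC: "a *\<^sub>C (b *\<^sub>C x) = (a * b) *\<^sub>C x"
    and scaleC_one: "1 *\<^sub>C x = x"

global_interpretation complex_vector: vector_space "scaleC :: complex \<Rightarrow> 'a \<Rightarrow> 'a::complex_vector"
  by unfold_locales
    (simp_all add: scaleC_add_right scaleC_add_left scaleC_scaleC scaleC_one)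

text \<open>The inner product is conjugate-linear in its first argument. No separability is assumed.\<close>

class complex_hilbert = complex_vector + banach +
  fixes cinner :: "'a \<Rightarrow> 'a \<Rightarrow> complex"
  assumes scaleR_scaleC: "scaleR r x = complex_of_real r *\<^sub>C x"
    and cinner_commute: "cinner x y = cnj (cinner y x)"
    and cinner_add_right: "cinner x (y + z) = cinner x y + cinner x z"
    and cinner_scaleC_right: "cinner x (c *\<^sub>C y) = c * cinner x y"
    and cinner_ge_zero: "0 \<le> Re (cinner x x)"
    and norm_eq_sqrt_cinner: "norm x = sqrt (Re (cinner x x))"

instantiation complex :: complex_hilbert
begin

definition scaleC_complex :: "complex \<Rightarrow> complex \<Rightarrow> complex"
  where "scaleC_complex = (*)"

definition cinner_complex :: "complex \<Rightarrow> complex \<Rightarrow> complex"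
  where "cinner_complex x y = cnj x * y"

instance
  by standard
    (simp_all add: scaleC_complex_def cinner_complex_def algebra_simps scaleR_conv_of_real cmod_def
      power2_eq_square)

end

text \<open>
  \<^typ>\<open>'x \<Rightarrow>\<^sub>0 complex\<close>, the finitely supported functions, is the free complex vector space on
  \<^typ>\<open>'x\<close>; the generator given by \<open>x\<close> is \<open>Poly_Mapping.single x 1\<close>.
\<close>

instantiation poly_mapping :: (type, complex_vector) complex_vector
begin

definition scaleC_poly_mapping :: "complex \<Rightarrow> ('a \<Rightarrow>\<^sub>0 'b) \<Rightarrow> ('a \<Rightarrow>\<^sub>0 'b)"
  where "scaleC_poly_mapping c = Poly_Mapping.map (\<lambda>v. c *\<^sub>C v)"

lemma lookup_scaleC: "Poly_Mapping.lookup (c *\<^sub>C p) k = c *\<^sub>C Poly_Mapping.lookup p k"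
  by (simp add: scaleC_poly_mapping_def Poly_Mapping.map.rep_eq when_def
      complex_vector.scale_zero_right)

instance
  by standard
    (auto intro!: poly_mapping_eqI
      simp: lookup_scaleC lookup_add scaleC_add_right scaleC_add_left scaleC_scaleC scaleC_one)

end

definition clinear_on :: "'a::complex_vector set \<Rightarrow> ('a \<Rightarrow> 'b::complex_vector) \<Rightarrow> bool"
  where "clinear_on S f \<longleftrightarrow>
    (\<forall>x\<in>S. \<forall>y\<in>S. f (x + y) = f x + f y) \<and> (\<forall>c. \<forall>x\<in>S. f (c *\<^sub>C x) = c *\<^sub>C f x)"

text \<open>
  Dual spaces, quotients, exterior powers and tensor products depend on terms, so they are not
  types. They are given as module records over the complex numbers. The fields \<^const>\<open>mult\<close> and
  \<^const>\<open>one\<close>, which the record inherits from rings, play no role for modules.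
\<close>

definition vs_basis :: "(complex, 'v) module \<Rightarrow> 'v list \<Rightarrow> bool"
  where "vs_basis V bs \<longleftrightarrow> set bs \<subseteq> carrier V \<and>
    (\<forall>v\<in>carrier V. \<exists>!c. c \<in> {..<length bs} \<rightarrow>\<^sub>E UNIV \<and>
       v = (\<Oplus>\<^bsub>V\<^esub>i\<in>{..<length bs}. c i \<odot>\<^bsub>V\<^esub> bs ! i))"

definition vs_finite_dim :: "(complex, 'v) module \<Rightarrow> bool"
  where "vs_finite_dim V \<longleftrightarrow> (\<exists>bs. vs_basis V bs)"

definition vs_dim :: "(complex, 'v) module \<Rightarrow> nat"
  where "vs_dim V = length (SOME bs. vs_basis V bs)"

definition dual_space :: "'a::complex_vector set \<Rightarrow> (complex, 'a \<Rightarrow> complex) module"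
  where "dual_space K =
    \<lparr>carrier = {g \<in> extensional K. clinear_on K g}, mult = undefined, one = undefined,
     zero = (\<lambda>x\<in>K. 0), add = (\<lambda>g h. \<lambda>x\<in>K. g x + h x), smult = (\<lambda>c g. \<lambda>x\<in>K. c * g x)\<rparr>"

definition coset :: "'a::complex_vector set \<Rightarrow> 'a \<Rightarrow> 'a set"
  where "coset U x = {x + u |u. u \<in> U}"

text \<open>The quotient of the subspace \<open>W\<close> by the subspace \<open>U\<close> of \<open>W\<close>. The summand \<open>u\<close> in the scalar
  multiplication only matters for the scalar 0.\<close>

definition quotient_space ::
    "'a::complex_vector set \<Rightarrow> 'a set \<Rightarrow> (complex, 'a set) module"
  where "quotient_space W U =
    \<lparr>carrier = coset U ` W, mult = undefined, one = undefined,
     zero = coset U 0,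
     add = (\<lambda>X Y. {x + y |x y. x \<in> X \<and> y \<in> Y}),
     smult = (\<lambda>c X. {c *\<^sub>C x + u |x u. x \<in> X \<and> u \<in> U})\<rparr>"

definition ext_relations :: "(complex, 'v) module \<Rightarrow> nat \<Rightarrow> ('v list \<Rightarrow>\<^sub>0 complex) set"
  where "ext_relations V n =
    {Poly_Mapping.single (us @ [x \<oplus>\<^bsub>V\<^esub> y] @ vs) 1
       - Poly_Mapping.single (us @ [x] @ vs) 1 - Poly_Mapping.single (us @ [y] @ vs) 1 |us x y vs.
       set us \<union> {x, y} \<union> set vs \<subseteq> carrier V \<and> length us + 1 + length vs = n}
    \<union> {Poly_Mapping.single (us @ [c \<odot>\<^bsub>V\<^esub> x] @ vs) 1
       - c *\<^sub>C Poly_Mapping.single (us @ [x] @ vs) 1 |us c x vs.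
       set us \<union> {x} \<union> set vs \<subseteq> carrier V \<and> length us + 1 + length vs = n}
    \<union> {Poly_Mapping.single vs 1 |vs. set vs \<subseteq> carrier V \<and> length vs = n \<and> \<not> distinct vs}"

text \<open>The \<open>n\<close>-th exterior power: the free vector space on the \<open>n\<close>-tuples in \<open>V\<close>, modulo
  multilinearity and the vanishing of tuples with a repeated entry.\<close>

definition ext_power ::
    "(complex, 'v) module \<Rightarrow> nat \<Rightarrow> (complex, ('v list \<Rightarrow>\<^sub>0 complex) set) module"
  where "ext_power V n =
    quotient_space {p. Poly_Mapping.keys p \<subseteq> {vs. set vs \<subseteq> carrier V \<and> length vs = n}}
      (complex_vector.span (ext_relations V n))"

definition wedge :: "(complex, 'v) module \<Rightarrow> 'v list \<Rightarrow> ('v list \<Rightarrow>\<^sub>0 complex) set"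
  where "wedge V vs =
    coset (complex_vector.span (ext_relations V (length vs))) (Poly_Mapping.single vs 1)"

definition tensor_relations ::
    "(complex, 'v) module \<Rightarrow> (complex, 'w) module \<Rightarrow> ('v \<times> 'w \<Rightarrow>\<^sub>0 complex) set"
  where "tensor_relations V W =
    {Poly_Mapping.single (x \<oplus>\<^bsub>V\<^esub> y, w) 1
       - Poly_Mapping.single (x, w) 1 - Poly_Mapping.single (y, w) 1 |x y w.
       x \<in> carrier V \<and> y \<in> carrier V \<and> w \<in> carrier W}
    \<union> {Poly_Mapping.single (v, x \<oplus>\<^bsub>W\<^esub> y) 1
       - Poly_Mapping.single (v, x) 1 - Poly_Mapping.single (v, y) 1 |v x y.
       v \<in> carrier V \<and> x \<in> carrier W \<and> y \<in> carrier W}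
    \<union> {Poly_Mapping.single (c \<odot>\<^bsub>V\<^esub> v, w) 1 - c *\<^sub>C Poly_Mapping.single (v, w) 1 |c v w.
       v \<in> carrier V \<and> w \<in> carrier W}
    \<union> {Poly_Mapping.single (v, c \<odot>\<^bsub>W\<^esub> w) 1 - c *\<^sub>C Poly_Mapping.single (v, w) 1 |c v w.
       v \<in> carrier V \<and> w \<in> carrier W}"

definition tensor_space ::
    "(complex, 'v) module \<Rightarrow> (complex, 'w) module
      \<Rightarrow> (complex, ('v \<times> 'w \<Rightarrow>\<^sub>0 complex) set) module"
  where "tensor_space V W =
    quotient_space {p. Poly_Mapping.keys p \<subseteq> carrier V \<times> carrier W}
      (complex_vector.span (tensor_relations V W))"

definition pure_tensor ::
    "(complex, 'v) module \<Rightarrow> (complex, 'w) module \<Rightarrow> 'v \<Rightarrow> 'w \<Rightarrow> ('v \<times> 'w \<Rightarrow>\<^sub>0 complex) set"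
  where "pure_tensor V W v w =
    coset (complex_vector.span (tensor_relations V W)) (Poly_Mapping.single (v, w) 1)"

definition bounded_clinear :: "('h::complex_hilbert \<Rightarrow> 'h) \<Rightarrow> bool"
  where "bounded_clinear S \<longleftrightarrow> bounded_linear S \<and> clinear_on UNIV S"

definition invertible_op :: "('h::complex_hilbert \<Rightarrow> 'h) \<Rightarrow> bool"
  where "invertible_op S \<longleftrightarrow>
    bounded_clinear S \<and> (\<exists>R. bounded_clinear R \<and> R \<circ> S = id \<and> S \<circ> R = id)"

definition orthonormal_basis :: "'h::complex_hilbert set \<Rightarrow> bool"
  where "orthonormal_basis E \<longleftrightarrow>
    (\<forall>x\<in>E. \<forall>y\<in>E. cinner x y = (if x = y then 1 else 0)) \<and>
    closure (complex_vector.span E) = UNIV"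

text \<open>\<open>P\<close> is the absolute value of \<open>K\<close>, that is, the positive square root of \<open>K\<^sup>* K\<close>.\<close>

definition is_abs_op :: "('h::complex_hilbert \<Rightarrow> 'h) \<Rightarrow> ('h \<Rightarrow> 'h) \<Rightarrow> bool"
  where "is_abs_op K P \<longleftrightarrow> bounded_clinear P \<and>
    (\<forall>x. cinner (P x) x \<in> \<real>\<^sub>\<ge>\<^sub>0) \<and>
    (\<forall>x y. cinner (P (P x)) y = cinner (K x) (K y))"

definition trace_class :: "('h::complex_hilbert \<Rightarrow> 'h) \<Rightarrow> bool"
  where "trace_class K \<longleftrightarrow> bounded_clinear K \<and>
    (\<exists>P E. is_abs_op K P \<and> orthonormal_basis E \<and> (\<lambda>e. cinner (P e) e) summable_on E)"

definition eigenvalue :: "('h::complex_hilbert \<Rightarrow> 'h) \<Rightarrow> complex \<Rightarrow> bool"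
  where "eigenvalue K \<mu> \<longleftrightarrow> (\<exists>x. x \<noteq> 0 \<and> K x = \<mu> *\<^sub>C x)"

definition alg_mult :: "('h::complex_hilbert \<Rightarrow> 'h) \<Rightarrow> complex \<Rightarrow> nat"
  where "alg_mult K \<mu> = complex_vector.dim {x. \<exists>n. ((\<lambda>y. K y - \<mu> *\<^sub>C y) ^^ n) x = 0}"

text \<open>
  The Fredholm determinant of \<open>S = Id + K\<close> with \<open>K\<close> of trace class: the unordered (absolutely
  convergent) product of \<open>1 + \<mu>\<close> over the eigenvalues of \<open>K\<close>, counted with algebraic multiplicity.
  The eigenvalue 0 contributes only factors 1 and may have infinite multiplicity, so it is left out.
\<close>

definition fredholm_det :: "('h::complex_hilbert \<Rightarrow> 'h) \<Rightarrow> complex"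
  where "fredholm_det S = (let K = (\<lambda>x. S x - x) in
    Lim (finite_subsets_at_top {\<mu>. \<mu> \<noteq> 0 \<and> eigenvalue K \<mu>})
      (\<lambda>F. \<Prod>\<mu>\<in>F. (1 + \<mu>) ^ alg_mult K \<mu>))"

definition ker_op :: "('h::complex_hilbert \<Rightarrow> 'h) \<Rightarrow> 'h set"
  where "ker_op T = {x. T x = 0}"

definition coker_op :: "('h::complex_hilbert \<Rightarrow> 'h) \<Rightarrow> (complex, 'h set) module"
  where "coker_op T = quotient_space UNIV (range T)"

definition coker_proj :: "('h::complex_hilbert \<Rightarrow> 'h) \<Rightarrow> 'h \<Rightarrow> 'h set"
  where "coker_proj T = coset (range T)"

definition orth_proj :: "'h::complex_hilbert set \<Rightarrow> 'h \<Rightarrow> 'h"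
  where "orth_proj M x = (THE y. y \<in> M \<and> (\<forall>z\<in>M. cinner z (x - y) = 0))"

text \<open>Closedness of the range follows from boundedness and finite codimension of the range.\<close>

definition fredholm :: "('h::complex_hilbert \<Rightarrow> 'h) \<Rightarrow> bool"
  where "fredholm T \<longleftrightarrow> bounded_clinear T \<and>
    (\<exists>B. finite B \<and> complex_vector.span B = ker_op T) \<and> vs_finite_dim (coker_op T)"

definition fredholm_index :: "('h::complex_hilbert \<Rightarrow> 'h) \<Rightarrow> int"
  where "fredholm_index T = int (complex_vector.dim (ker_op T)) - int (vs_dim (coker_op T))"

definition trace_perturbations :: "('h::complex_hilbert \<Rightarrow> 'h) \<Rightarrow> ('h \<Rightarrow> 'h) set"
  where "trace_perturbations T = {A. trace_class A \<and> invertible_op (\<lambda>x. T x + A x)}"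

definition det_functions :: "('h::complex_hilbert \<Rightarrow> 'h) \<Rightarrow> (('h \<Rightarrow> 'h) \<Rightarrow> complex) set"
  where "det_functions T = {f \<in> extensional (trace_perturbations T).
    \<forall>A\<in>trace_perturbations T. \<forall>B\<in>trace_perturbations T.
      f B = fredholm_det ((\<lambda>x. T x + A x) \<circ> the_inv (\<lambda>x. T x + B x)) * f A}"

text \<open>
  A linear map from the kernel of \<open>T\<close> to the Hilbert space is represented by a function on the whole
  space, whose values outside of the kernel are irrelevant. The composition with the projection onto
  the cokernel is automatically linear, so it is an isomorphism iff it is bijective.
\<close>

definition admissible :: "('h::complex_hilbert \<Rightarrow> 'h) \<Rightarrow> ('h \<Rightarrow> 'h) \<Rightarrow> bool"
  where "admissible T L \<longleftrightarrow> clinear_on (ker_op T) L \<and>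
    bij_betw (coker_proj T \<circ> L) (ker_op T) (carrier (coker_op T))"

definition ordered_basis :: "'h::complex_vector set \<Rightarrow> 'h list \<Rightarrow> bool"
  where "ordered_basis K es \<longleftrightarrow> distinct es \<and> \<not> complex_vector.dependent (set es) \<and>
    complex_vector.span (set es) = K"

definition is_dual_basis ::
    "'h::complex_vector set \<Rightarrow> 'h list \<Rightarrow> ('h \<Rightarrow> complex) list \<Rightarrow> bool"
  where "is_dual_basis K es es' \<longleftrightarrow> length es' = length es \<and> set es' \<subseteq> carrier (dual_space K) \<and>
    (\<forall>i<length es. \<forall>j<length es. (es' ! i) (es ! j) = (if i = j then 1 else 0))"

definition ker_dual_top ::
    "('h::complex_hilbert \<Rightarrow> 'h) \<Rightarrow> (complex, (('h \<Rightarrow> complex) list \<Rightarrow>\<^sub>0 complex) set) module"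
  where "ker_dual_top T = ext_power (dual_space (ker_op T)) (complex_vector.dim (ker_op T))"

definition coker_top ::
    "('h::complex_hilbert \<Rightarrow> 'h) \<Rightarrow> (complex, ('h set list \<Rightarrow>\<^sub>0 complex) set) module"
  where "coker_top T = ext_power (coker_op T) (vs_dim (coker_op T))"

definition det_line :: "('h::complex_hilbert \<Rightarrow> 'h) \<Rightarrow>
    (complex, ((('h \<Rightarrow> complex) list \<Rightarrow>\<^sub>0 complex) set \<times> ('h set list \<Rightarrow>\<^sub>0 complex) set
      \<Rightarrow>\<^sub>0 complex) set) module"
  where "det_line T = tensor_space (ker_dual_top T) (coker_top T)"

definition phi :: "('h::complex_hilbert \<Rightarrow> 'h) \<Rightarrow> (('h \<Rightarrow> 'h) \<Rightarrow> complex) \<Rightarrow> ('h \<Rightarrow> 'h)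
    \<Rightarrow> ('h \<Rightarrow> 'h) \<Rightarrow> 'h list \<Rightarrow> ('h \<Rightarrow> complex) list
    \<Rightarrow> ((('h \<Rightarrow> complex) list \<Rightarrow>\<^sub>0 complex) set \<times> ('h set list \<Rightarrow>\<^sub>0 complex) set
      \<Rightarrow>\<^sub>0 complex) set"
  where "phi T f A L es es' =
    (f A * fredholm_det
       ((\<lambda>x. T x + A x) \<circ> the_inv (\<lambda>x. T x + L (orth_proj (ker_op T) x))))
    \<odot>\<^bsub>det_line T\<^esub>
    pure_tensor (ker_dual_top T) (coker_top T)
      (wedge (dual_space (ker_op T)) es')
      (wedge (coker_op T) (map (\<lambda>e. coker_proj T (L e)) es))"

end

theory Submission
  imports Defs "Jordan_Normal_Form.Determinant" "HOL-Complex_Analysis.Complex_Analysis"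
    "HOL-Computational_Algebra.Fundamental_Theorem_Algebra"
begin

text \<open>
  A change of \<open>L\<close> by elementary column operations perturbs \<open>T + L \<circ> \<pi>\<^sub>T\<close> by an operator of rank one, and
  such operations connect any two admissible maps. So everything follows from the behaviour of the
  Fredholm determinant, defined as a product over eigenvalues, under perturbations of rank one.

  For \<open>K x = (\<Sum>k. \<langle>c\<^sub>k, x\<rangle> a\<^sub>k)\<close> with square summable \<open>a\<close> and \<open>c\<close> the finite determinants
  \<open>det(\<delta>\<^sub>i\<^sub>j + z \<langle>c\<^sub>i, a\<^sub>j\<rangle>)\<close> converge to an entire function \<open>D(z)\<close> of minimal exponential type, for which the
  rank one formula is a matter of column operations. It remains to show that \<open>D(1)\<close> is the product of
  the \<open>1 + \<mu>\<close> (Lidskii). Splitting off an eigenvector of norm 1 replaces \<open>a\<close> and \<open>c\<close> by their projections onto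
  its orthogonal complement and divides \<open>D(z)\<close> by \<open>1 + z\<mu>\<close>. When all \<open>\<mu>\<close> with \<open>\<bar>\<mu>\<bar> \<ge> 1/R\<close> are split off, the
  remaining factor has no zero in the disc of radius \<open>R\<close> and satisfies the same growth bound, so by the
  Borel--Caratheodory inequality its value at 1 tends to 1 as \<open>R\<close> tends to infinity.
\<close>

subsection \<open>Complex Hilbert spaces\<close>

text \<open>In \<open>(T + A)(T + L \<circ> \<pi>)^-1\<close> the map \<open>L\<close> stands inside
  an inverse. Put \<open>V = T + A\<close> and \<open>Q = T + L \<circ> \<pi>\<close>. Then
  \<open>Q = V (Id + J)\<close> with \<open>J = V^-1 (L \<circ> \<pi> - A)\<close>, and
  \<open>V Q^-1\<close> is conjugate by \<open>V\<close> to \<open>(Id + J)^-1\<close>. Matching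
  generalized eigenspaces shows that its determinant is the reciprocal of that of
  \<open>Id + J\<close>. So \<open>L\<close> enters linearly, and changing one vector
  \<open>L e\<close> perturbs \<open>J\<close> by rank one.

  The obstacle is that a product over eigenvalues does not show how it reacts to a perturbation.
  Deflation by \<open>perp\<close> links it to finite determinants: it removes a factor from the
  determinant, lowers one multiplicity by one and lowers the quantity \<open>hs\<close> by at least
  the modulus of the eigenvalue. Since it only shortens vectors, one growth constant serves all
  deflated operators, however many eigenvalues have been split off.

  Trace class is defined through the absolute value and a possibly uncountable basis; Cholesky
  elimination of the absolute value yields the sequences \<open>a\<close> and
  \<open>c\<close>.\<close>

lemmas span_intros = complex_vector.span_sum complex_vector.span_scale complex_vector.span_base

lemmas subspace_intros = complex_vector.subspace_sum complex_vector.subspace_scale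

lemma cinner_add_left: "cinner (x + y) z = cinner x z + cinner y z"
  by (metis cinner_add_right cinner_commute complex_cnj_add)

lemma cinner_scaleC_left: "cinner (c *\<^sub>C x) y = cnj c * cinner x y"
  by (metis cinner_commute cinner_scaleC_right complex_cnj_mult)

lemma cinner_zero_right [simp]: "cinner x 0 = 0"
  using cinner_scaleC_right[of x 0 0] by simp

lemma cinner_zero_left [simp]: "cinner 0 x = 0"
  by (metis cinner_commute cinner_zero_right complex_cnj_zero)

lemma cinner_minus_right: "cinner x (- y) = - cinner x y"
  using cinner_add_right[of x y "- y"] by (simp add: eq_neg_iff_add_eq_0 add.commute)

lemma cinner_minus_left: "cinner (- x) y = - cinner x y"
  by (metis cinner_commute cinner_minus_right complex_cnj_minus)

lemma cinner_diff_right: "cinner x (y - z) = cinner x y - cinner x z"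
  using cinner_add_right[of x y "- z"] by (simp add: cinner_minus_right)

lemma cinner_diff_left: "cinner (x - y) z = cinner x z - cinner y z"
  using cinner_add_left[of x "- y" z] by (simp add: cinner_minus_left)

lemma cinner_sum_right: "cinner x (sum f I) = (\<Sum>i\<in>I. cinner x (f i))"
  by (induction I rule: infinite_finite_induct) (simp_all add: cinner_add_right)

lemma cinner_sum_left: "cinner (sum f I) x = (\<Sum>i\<in>I. cinner (f i) x)"
  by (induction I rule: infinite_finite_induct) (simp_all add: cinner_add_left)

lemmas cinner_algebra =
  cinner_add_left cinner_add_right cinner_diff_left cinner_diff_right cinner_scaleC_left
  cinner_scaleC_right cinner_minus_left cinner_minus_right

lemmas scaleC_algebra =
  complex_vector.scale_right_diff_distrib complex_vector.scale_left_diff_distrib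
  scaleC_add_left scaleC_add_right scaleC_scaleC

lemmas scaleC_simps [simp] =
  complex_vector.scale_zero_left complex_vector.scale_zero_right scaleC_one
  complex_vector.scale_minus_left complex_vector.scale_minus_right

lemma cinner_self: "cinner x x = of_real ((norm x)\<^sup>2)"
proof -
  have "Im (cinner x x) = 0"
    using cinner_commute[of x x] by (simp add: complex_eq_iff)
  moreover have "Re (cinner x x) = (norm x)\<^sup>2"
    using cinner_ge_zero[of x] by (simp add: norm_eq_sqrt_cinner)
  ultimately show ?thesis
    by (simp add: complex_eq_iff)
qed

lemma norm_scaleC: "norm (c *\<^sub>C x) = norm c * norm (x :: 'h::complex_hilbert)"
proof -
  have "of_real ((norm (c *\<^sub>C x))\<^sup>2) = cnj c * c * (of_real ((norm x)\<^sup>2) :: complex)"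
    by (metis cinner_scaleC_left cinner_scaleC_right cinner_self mult.assoc)
  also have "\<dots> = of_real ((norm c * norm x)\<^sup>2)"
    by (simp add: complex_norm_square power_mult_distrib mult.commute del: of_real_power)
  finally have "(norm (c *\<^sub>C x))\<^sup>2 = (norm c * norm x)\<^sup>2"
    using of_real_eq_iff by blast
  then show ?thesis
    by (simp add: power2_eq_iff_nonneg)
qed

lemma norm_sub_proj:
  assumes "norm x = 1"
  shows "(norm (y - cinner x y *\<^sub>C x))\<^sup>2 = (norm y)\<^sup>2 - (cmod (cinner x y))\<^sup>2"
proof -
  have "of_real ((norm (y - cinner x y *\<^sub>C x))\<^sup>2)
      = (of_real ((norm y)\<^sup>2 - (cmod (cinner x y))\<^sup>2) :: complex)"
    using assms cinner_commute[of y x]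
    by (simp add: cinner_self[symmetric] cinner_algebra complex_norm_square algebra_simps
        del: of_real_power) (simp add: cinner_self complex_norm_square[symmetric])
  then show ?thesis
    using of_real_eq_iff by blast
qed

lemma cinner_Cauchy_Schwarz: "cmod (cinner x y) \<le> norm x * norm y"
proof (cases "x = 0")
  case False
  define u where "u = complex_of_real (inverse (norm x)) *\<^sub>C x"
  have u: "norm u = 1"
    using False by (simp add: u_def norm_scaleC norm_inverse)
  have "0 \<le> (norm y)\<^sup>2 - (cmod (cinner u y))\<^sup>2"
    using norm_sub_proj[OF u, of y] by (metis zero_le_power2)
  then have "cmod (cinner u y) \<le> norm y"
    by (simp add: power2_le_iff_abs_le)
  moreover have "cinner x y = of_real (norm x) * cinner u y"
    using False by (simp add: u_def cinner_scaleC_left)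
  ultimately show ?thesis
    by (simp add: norm_mult mult_left_mono)
qed simp

lemma bounded_linear_scaleC: "bounded_linear (\<lambda>x :: 'h::complex_hilbert. c *\<^sub>C x)"
  by (rule bounded_linear_intro[where K = "norm c"])
    (simp_all add: scaleC_add_right norm_scaleC scaleR_scaleC scaleC_scaleC mult.commute)

lemma bounded_linear_scaleC_left: "bounded_linear (\<lambda>c. c *\<^sub>C (x :: 'h::complex_hilbert))"
  by (rule bounded_linear_intro[where K = "norm x"])
    (simp_all add: scaleC_add_left norm_scaleC scaleR_scaleC scaleC_scaleC scaleC_complex_def)

lemma bounded_linear_cinner_right: "bounded_linear (cinner x)"
  by (rule bounded_linear_intro[where K = "norm x"])
    (simp_all add: cinner_add_right scaleR_scaleC cinner_scaleC_right scaleC_complex_def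
      cinner_Cauchy_Schwarz mult.commute[of _ "norm x"])

lemma bounded_linear_cinner_left: "bounded_linear (\<lambda>x. cinner x y)"
  by (rule bounded_linear_intro[where K = "norm y"])
    (simp_all add: cinner_add_left scaleR_scaleC cinner_scaleC_left scaleC_complex_def
      cinner_Cauchy_Schwarz)

subsection \<open>Finite determinants\<close>

text \<open>By Sylvester's identity this is the determinant of \<open>Id + z K\<close> for the
  finite rank operator \<open>K\<close> sending \<open>x\<close> to the sum of the
  \<open>cinner (c k) x *\<^sub>C a k\<close> with \<open>k < n\<close>.\<close>

definition pdet :: "nat \<Rightarrow> (nat \<Rightarrow> 'h::complex_hilbert) \<Rightarrow> (nat \<Rightarrow> 'h) \<Rightarrow> complex \<Rightarrow> complex"
  where "pdet n a c z =
    Determinant.det (mat n n (\<lambda>(i, j). (if i = j then 1 else 0) + z * cinner (c i) (a j)))"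

lemma pdet_cong:
  "(\<And>i j. i < n \<Longrightarrow> j < n \<Longrightarrow> cinner (c i) (a j) = cinner (c' i) (a' j)) \<Longrightarrow>
    pdet n a c z = pdet n a' c' z"
  unfolding pdet_def by (intro arg_cong[where f = Determinant.det] cong_mat) auto

text \<open>Take a column \<open>j < N\<close> and subtract from it the last \<open>n\<close>
  columns with coefficients \<open>z * cinner (c (N + k)) (Y j)\<close>. This replaces
  \<open>a j\<close> by \<open>Y j\<close> in the upper block and, by the equation for
  \<open>Y j\<close>, makes the lower block zero. What remains is block triangular.\<close>

lemma pdet_block:
  assumes Y: "\<And>j. j < N \<Longrightarrow> Y j + z *\<^sub>C (\<Sum>k<n. cinner (c (N + k)) (Y j) *\<^sub>C a (N + k)) = a j"
  shows "pdet (N + n) a c z = pdet N Y c z * pdet n (\<lambda>k. a (N + k)) (\<lambda>k. c (N + k)) z"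
proof -
  define A where "A = mat N N (\<lambda>(i, j). (if i = j then 1 else 0) + z * cinner (c i) (Y j))"
  define B where "B = mat N n (\<lambda>(i, j). z * cinner (c i) (a (N + j)))"
  define D where "D = mat n n
    (\<lambda>(i, j). (if i = j then 1 else 0) + z * cinner (c (N + i)) (a (N + j)))"
  define C where "C = mat n N (\<lambda>(i, j). z * cinner (c (N + i)) (Y j))"
  have car: "A \<in> carrier_mat N N" "B \<in> carrier_mat N n" "C \<in> carrier_mat n N" "D \<in> carrier_mat n n"
    by (simp_all add: A_def B_def C_def D_def)
  have a: "cinner w (a j) = cinner w (Y j) + z * (\<Sum>k<n. cinner (c (N + k)) (Y j) * cinner w (a (N + k)))"
    if "j < N" for j w
    using that by (simp add: Y[symmetric] cinner_add_right cinner_scaleC_right cinner_sum_right)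
  define M where "M = mat (N + n) (N + n)
    (\<lambda>(i, j). (if i = j then 1 else 0) + z * cinner (c i) (a j))"
  have "M = four_block_mat A B (0\<^sub>m n N) D * four_block_mat (1\<^sub>m N) (0\<^sub>m N n) C (1\<^sub>m n)"
  proof -
    have "four_block_mat A B (0\<^sub>m n N) D * four_block_mat (1\<^sub>m N) (0\<^sub>m N n) C (1\<^sub>m n)
        = four_block_mat (A + B * C) B (D * C) D"
      using car mult_four_block_mat[OF car(1,2) zero_carrier_mat car(4) one_carrier_mat
          zero_carrier_mat car(3) one_carrier_mat] by simp
    also have "\<dots> = M"
    proof (rule eq_matI)
      fix i j assume "i < dim_row M" "j < dim_col M"
      then have ij: "i < N + n" "j < N + n"
        by (simp_all add: M_def)
      have BC: "(B * C) $$ (i, j) = z * (z * (\<Sum>k<n. cinner (c (N + k)) (Y j) * cinner (c i) (a (N + k))))"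
        if "i < N" "j < N"
        using that by (simp add: B_def C_def scalar_prod_def sum_distrib_left mult_ac
            lessThan_atLeast0)
      have DC: "(D * C) $$ (i', j) = z * cinner (c (N + i')) (a j)" if "i' < n" "j < N" for i'
      proof -
        have "(D * C) $$ (i', j)
          = (\<Sum>k<n. ((if i' = k then 1 else 0) + z * cinner (c (N + i')) (a (N + k)))
              * (z * cinner (c (N + k)) (Y j)))"
          using that by (simp add: D_def C_def scalar_prod_def lessThan_atLeast0)
        also have "\<dots> = z * cinner (c (N + i')) (Y j)
           + z * (z * (\<Sum>k<n. cinner (c (N + k)) (Y j) * cinner (c (N + i')) (a (N + k))))"
          using that by (simp only: distrib_right sum.distrib)
            (simp add: sum_distrib_left mult_ac if_distrib[of "\<lambda>x. x * _"] if_distrib[of "\<lambda>x. _ * x"] cong: if_cong)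
        finally show ?thesis
          using that by (simp add: a distrib_left)
      qed
      show "four_block_mat (A + B * C) B (D * C) D $$ (i, j) = M $$ (i, j)"
      proof (cases "i < N"; cases "j < N")
        assume "i < N" "j < N"
        then show ?thesis
          using ij BC car by (simp add: M_def) (simp add: A_def a distrib_left)
      next
        assume "i < N" "\<not> j < N"
        then show ?thesis
          using ij car by (simp add: M_def) (simp add: B_def)
      next
        assume "\<not> i < N" "j < N"
        then show ?thesis
          using ij car DC[of "i - N"] by (simp add: M_def)
      next
        assume "\<not> i < N" "\<not> j < N"
        then show ?thesis
          using ij car by (simp add: M_def) (auto simp: D_def)
      qed
    qed (use car in \<open>auto simp: M_def\<close>)
    finally show ?thesis by simp
  qed
  then have "Determinant.det M = Determinant.det (four_block_mat A B (0\<^sub>m n N) D)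
      * Determinant.det (four_block_mat (1\<^sub>m N) (0\<^sub>m N n) C (1\<^sub>m n))"
    using car by (simp add: det_mult[of _ "N + n"])
  also have "\<dots> = Determinant.det A * Determinant.det D"
    using car by (simp add: det_four_block_mat_lower_left_zero[of _ N _ n]
        det_four_block_mat_upper_right_zero[of _ N _ n])
  finally show ?thesis
    by (simp add: pdet_def M_def A_def D_def)
qed

lemma pdet_0 [simp]: "pdet 0 a c z = 1"
  by (simp add: pdet_def)

lemma pdet_1: "pdet (Suc 0) a c z = 1 + z * cinner (c 0) (a 0)"
  by (simp add: pdet_def det_single)

lemma pdet_poly: "\<exists>p. \<forall>z. pdet n a c z = poly p z"
proof -
  have "pdet n a c z = poly (\<Sum>p | p permutes {0..<n}. [:signof p:]
     * (\<Prod>i = 0..<n. [:if i = p i then 1 else 0, cinner (c i) (a (p i)):])) z" for z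
    unfolding pdet_def
    by (subst Determinant.det_def')
      (auto simp: poly_sum poly_prod permutes_in_image intro!: sum.cong prod.cong)
  then show ?thesis by blast
qed

lemma pdet_at_0 [simp]: "pdet n a c 0 = 1"
proof -
  have "mat n n (\<lambda>(i, j). (if i = j then 1 else 0) + 0 * cinner (c i) (a j)) = 1\<^sub>m n"
    by (intro eq_matI) auto
  then show ?thesis
    by (simp add: pdet_def)
qed

text \<open>The conjugate transpose of the matrix exchanges the two families, so facts about columns
  (changes of \<open>a\<close>) become facts about rows (changes of \<open>c\<close>).\<close>

lemma cnj_pdet: "pdet n a c z = cnj (pdet n c a (cnj z))"
proof -
  have h: "comm_ring_hom cnj"
    by unfold_locales auto
  have "cnj (pdet n c a (cnj z)) = Determinant.det (map_mat cnj
      (mat n n (\<lambda>(i, j). (if i = j then 1 else 0) + cnj z * cinner (a i) (c j))))"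
    unfolding pdet_def by (simp add: comm_ring_hom.hom_det[OF h])
  also have "map_mat cnj (mat n n (\<lambda>(i, j). (if i = j then 1 else 0) + cnj z * cinner (a i) (c j)))
      = (mat n n (\<lambda>(i, j). (if i = j then 1 else 0) + z * cinner (c i) (a j)))\<^sup>T"
    by (intro eq_matI) (auto simp: cinner_commute[symmetric])
  also have "Determinant.det \<dots> = pdet n a c z"
    unfolding pdet_def by (subst Determinant.det_transpose[where n = n]) auto
  finally show ?thesis by simp
qed

text \<open>Laplace expansion along column \<open>k\<close>: the vector \<open>u\<close> occurs only
  there, and the cofactors of that column do not see it.\<close>

lemma pdet_affine:
  assumes "k < n"
  obtains \<beta> where "\<And>u. pdet n (a(k := u)) c z = pdet n (a(k := 0)) c z + (\<Sum>i<n. \<beta> i * cinner (c i) u)"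
proof -
  define M where "M u = mat n n (\<lambda>(i, j). (if i = j then 1 else 0) + z * cinner (c i) ((a(k := u)) j))" for u
  have cof: "cofactor (M u) i k = cofactor (M 0) i k" for u i
  proof -
    have "mat_delete (M u) i k = mat_delete (M 0) i k"
      unfolding mat_delete_def by (intro eq_matI) (auto simp: M_def)
    then show ?thesis
      by (simp add: cofactor_def)
  qed
  have pd: "pdet n (a(k := u)) c z = (\<Sum>i<n. M u $$ (i, k) * cofactor (M 0) i k)" for u
  proof -
    have "pdet n (a(k := u)) c z = Determinant.det (M u)"
      by (simp add: pdet_def M_def)
    also have "\<dots> = (\<Sum>i<n. M u $$ (i, k) * cofactor (M u) i k)"
      using assms by (intro laplace_expansion_column) (simp_all add: M_def)
    finally show ?thesis
      by (simp only: cof[of u])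
  qed
  have M: "M u $$ (i, k) = M 0 $$ (i, k) + z * cinner (c i) u" if "i < n" for u i
    using that assms by (simp add: M_def)
  have "pdet n (a(k := u)) c z = (\<Sum>i<n. (M 0 $$ (i, k) + z * cinner (c i) u) * cofactor (M 0) i k)" for u
    unfolding pd by (intro sum.cong refl) (simp only: lessThan_iff M[of _ u])
  then have "pdet n (a(k := u)) c z = pdet n (a(k := 0)) c z
      + (\<Sum>i<n. z * cofactor (M 0) i k * cinner (c i) u)" for u
    by (simp add: algebra_simps sum.distrib)
  then show thesis
    by (rule that)
qed

text \<open>The matrix determinant lemma: prepending the pair \<open>b\<close>, \<open>w\<close> is
  a perturbation of rank one, and \<open>y\<close> is the solution of
  \<open>(Id + z K) y = b\<close> for the operator \<open>K\<close> of the other pairs.\<close>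

lemma pdet_case_nat:
  assumes "y + z *\<^sub>C (\<Sum>k<n. cinner (c k) y *\<^sub>C a k) = b"
  shows "pdet (Suc n) (case_nat b a) (case_nat w c) z = (1 + z * cinner w y) * pdet n a c z"
  using pdet_block[where N = 1 and Y = "\<lambda>_. y" and n = n and z = z and c = "case_nat w c" and a = "case_nat b a"]
    assms by (simp add: pdet_1)

lemma pdet_last_zero: "a n = 0 \<Longrightarrow> pdet (Suc n) a c z = pdet n a c z"
  using pdet_block[where N = n and Y = a and n = 1 and z = z and a = a and c = c] by (simp add: pdet_1)

text \<open>Both sides represent the same operator: the multiples of \<open>x\<close> taken away
  from the \<open>a k\<close> are collected in the additional pair. On matrices this is a
  similarity.\<close>

lemma pdet_shear:
  "pdet (Suc n) (case_nat x (\<lambda>k. a k - t k *\<^sub>C x)) (case_nat (\<Sum>k<n. cnj (t k) *\<^sub>C c k) c) z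
    = pdet n a c z"
proof -
  define w where "w = (\<Sum>k<n. cnj (t k) *\<^sub>C c k)"
  define A where "A = mat 1 1 (\<lambda>_. 1 + z * cinner w x)"
  define B where "B = mat 1 n (\<lambda>(i, j). z * cinner w (a j - t j *\<^sub>C x))"
  define C where "C = mat n 1 (\<lambda>(i, j). z * cinner (c i) x)"
  define D where "D = mat n n (\<lambda>(i, j). (if i = j then 1 else 0) + z * cinner (c i) (a j))"
  define D' where "D' = mat n n (\<lambda>(i, j). (if i = j then 1 else 0) + z * cinner (c i) (a j - t j *\<^sub>C x))"
  define T where "T = mat 1 n (\<lambda>(i, j). t j)"
  have car: "A \<in> carrier_mat 1 1" "B \<in> carrier_mat 1 n" "C \<in> carrier_mat n 1" "D' \<in> carrier_mat n n"
    "T \<in> carrier_mat 1 n" "D \<in> carrier_mat n n"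
    by (simp_all add: A_def B_def C_def D_def D'_def T_def)
  have w: "cinner w v = (\<Sum>k<n. t k * cinner (c k) v)" for v
    by (simp add: w_def cinner_sum_left cinner_scaleC_left)
  \<comment> \<open>\<open>?N\<close> is the matrix of the right-hand side bordered by a trivial
    first row, which does not change its determinant. The unipotent \<open>?U\<close> conjugates
    \<open>?M\<close> into it.\<close>
  let ?M = "four_block_mat A B C D'"
  let ?U = "four_block_mat (1\<^sub>m 1) T (0\<^sub>m n 1) (1\<^sub>m n)"
  let ?N = "four_block_mat (1\<^sub>m 1) (0\<^sub>m 1 n) C D"
  have "?M * ?U = four_block_mat A (A * T + B) C (C * T + D')"
    using mult_four_block_mat[OF car(1-4) one_carrier_mat car(5) zero_carrier_mat one_carrier_mat] car
    by simp
  moreover have "?U * ?N = four_block_mat (1\<^sub>m 1 + T * C) (T * D) C D"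
    using mult_four_block_mat[OF one_carrier_mat car(5) zero_carrier_mat one_carrier_mat
        one_carrier_mat zero_carrier_mat car(3,6)] car
    by simp
  moreover have "A = 1\<^sub>m 1 + T * C"
    by (rule eq_matI) (auto simp: A_def T_def C_def scalar_prod_def w sum_distrib_left
        lessThan_atLeast0 mult_ac)
  moreover have "A * T + B = T * D"
  proof (rule eq_matI)
    fix i j assume "i < dim_row (T * D)" "j < dim_col (T * D)"
    then have ij: "i = 0" "j < n"
      using car by auto
    have "(T * D) $$ (i, j) = (\<Sum>k<n. t k * ((if k = j then 1 else 0) + z * cinner (c k) (a j)))"
      using ij by (simp add: T_def D_def scalar_prod_def lessThan_atLeast0)
    also have "\<dots> = t j + z * cinner w (a j)"
      using ij by (simp only: distrib_left sum.distrib)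
        (simp add: w sum_distrib_left mult_ac if_distrib[of "\<lambda>x. _ * x"] cong: if_cong)
    also have "\<dots> = (A * T + B) $$ (i, j)"
      using ij by (simp add: A_def T_def B_def scalar_prod_def cinner_algebra algebra_simps)
    finally show "(A * T + B) $$ (i, j) = (T * D) $$ (i, j)" by simp
  qed (use car in auto)
  moreover have "C * T + D' = D"
    by (rule eq_matI)
      (auto simp: C_def T_def D_def D'_def scalar_prod_def cinner_algebra algebra_simps)
  ultimately have "?M * ?U = ?U * ?N"
    by simp
  then have "Determinant.det ?M * Determinant.det ?U = Determinant.det ?U * Determinant.det ?N"
    using car by (metis (no_types, lifting) det_mult four_block_carrier_mat one_carrier_mat)
  moreover have "Determinant.det ?U = 1"
    using car by (simp add: det_four_block_mat_lower_left_zero[of _ 1 _ n])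
  moreover have "Determinant.det ?N = Determinant.det D"
    using car by (simp add: det_four_block_mat_upper_right_zero[of _ 1 _ n])
  ultimately have "Determinant.det ?M = Determinant.det D"
    by simp
  moreover have "?M = mat (Suc n) (Suc n) (\<lambda>(i, j). (if i = j then 1 else 0)
      + z * cinner (case_nat w c i) (case_nat x (\<lambda>k. a k - t k *\<^sub>C x) j))"
    using car by (intro eq_matI)
      (auto simp: A_def B_def C_def D'_def split: nat.split)
  ultimately show ?thesis
    unfolding w_def by (simp add: pdet_def D_def)
qed

section \<open>Deflation: splitting off an eigenvector of a finite determinant\<close>

definition perp :: "'h::complex_hilbert \<Rightarrow> 'h \<Rightarrow> 'h"
  where "perp x y = y - cinner x y *\<^sub>C x"

lemma perp_add: "perp x (y + z) = perp x y + perp x z"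
  by (simp add: perp_def cinner_algebra scaleC_algebra)

lemma perp_scaleC: "perp x (t *\<^sub>C y) = t *\<^sub>C perp x y"
  by (simp add: perp_def cinner_algebra scaleC_algebra)

lemma perp_zero [simp]: "perp x 0 = 0"
  by (simp add: perp_def)

lemma perp_sum: "perp x (sum f I) = (\<Sum>i\<in>I. perp x (f i))"
  by (induction I rule: infinite_finite_induct) (simp_all add: perp_add)

lemma perp_self: "norm x = 1 \<Longrightarrow> perp x x = 0"
  by (simp add: perp_def cinner_self)

lemma cinner_perp_perp: "norm x = 1 \<Longrightarrow> cinner (perp x y) (perp x z) = cinner y (perp x z)"
  by (simp add: perp_def cinner_algebra cinner_self cinner_commute[of x y] mult_ac)

lemma norm_perp: "norm x = 1 \<Longrightarrow> (norm (perp x y))\<^sup>2 = (norm y)\<^sup>2 - (cmod (cinner x y))\<^sup>2"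
  by (simp add: perp_def norm_sub_proj)

lemma norm_perp_le: "norm x = 1 \<Longrightarrow> norm (perp x y) \<le> norm y"
  using norm_perp[of x y] by (simp add: power2_le_imp_le)

text \<open>By Pythagoras the right side is half the sum of the squares of
  \<open>cmod (cinner x a)\<close> and \<open>cmod (cinner x c)\<close>, so this is the inequality
  of arithmetic and geometric means.\<close>

lemma cinner_mult_le_perp:
  assumes "norm x = 1"
  shows "cmod (cinner c x * cinner x a)
    \<le> ((norm a)\<^sup>2 + (norm c)\<^sup>2) / 2 - ((norm (perp x a))\<^sup>2 + (norm (perp x c))\<^sup>2) / 2"
proof -
  have "cmod (cinner c x) = cmod (cinner x c)"
    by (metis cinner_commute complex_mod_cnj)
  then show ?thesis
    using assms sum_squares_bound[of "cmod (cinner x c)" "cmod (cinner x a)"]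
    by (simp add: norm_perp norm_mult field_simps)
qed

text \<open>A shear moves the components of all \<open>a k\<close> along \<open>x\<close> into one
  pair \<open>x\<close>, \<open>w\<close>, where \<open>w\<close> is the adjoint operator applied to
  \<open>x\<close>. The sheared operator maps \<open>x\<close> to zero, so the rank one formula
  applies with \<open>y = x\<close> and yields the factor. Projecting the \<open>c k\<close> as well
  changes no inner product with the projected \<open>a k\<close>.\<close>

lemma pdet_deflate:
  assumes x: "norm x = 1" and eig: "(\<Sum>k<n. cinner (c k) x *\<^sub>C a k) = \<mu> *\<^sub>C x"
  shows "pdet n a c z = (1 + z * \<mu>) * pdet n (\<lambda>k. perp x (a k)) (\<lambda>k. perp x (c k)) z"
proof -
  define w where "w = (\<Sum>k<n. cnj (cinner x (a k)) *\<^sub>C c k)"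
  have "cinner w x = cinner x (\<Sum>k<n. cinner (c k) x *\<^sub>C a k)"
    by (simp add: w_def cinner_sum_left cinner_sum_right cinner_algebra mult.commute)
  then have w: "cinner w x = \<mu>"
    using x by (simp add: eig cinner_algebra cinner_self)
  have "(\<Sum>k<n. cinner (c k) x *\<^sub>C perp x (a k)) = perp x (\<mu> *\<^sub>C x)"
    by (simp add: eig[symmetric] perp_sum perp_scaleC)
  then have y: "x + z *\<^sub>C (\<Sum>k<n. cinner (c k) x *\<^sub>C perp x (a k)) = x"
    using x by (simp add: perp_scaleC perp_self)
  have "pdet n a c z = pdet (Suc n) (case_nat x (\<lambda>k. perp x (a k))) (case_nat w c) z"
    unfolding w_def perp_def by (simp only: pdet_shear)
  also have "\<dots> = (1 + z * \<mu>) * pdet n (\<lambda>k. perp x (a k)) c z"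
    using pdet_case_nat[OF y, of w] w by simp
  also have "pdet n (\<lambda>k. perp x (a k)) c z = pdet n (\<lambda>k. perp x (a k)) (\<lambda>k. perp x (c k)) z"
    by (rule pdet_cong) (simp add: cinner_perp_perp x)
  finally show ?thesis .
qed

text \<open>A null vector \<open>s\<close> of the matrix is turned into the combination
  \<open>v\<close> of the \<open>a j\<close>. Its entries can be read off as
  \<open>- z * cinner (c i) v\<close>, and therefore \<open>v\<close> cannot vanish.\<close>

lemma pdet_root_eigenvector:
  assumes "pdet n a c z = 0"
  obtains v where "v \<noteq> 0" and "v + z *\<^sub>C (\<Sum>k<n. cinner (c k) v *\<^sub>C a k) = 0"
proof -
  define M where "M = mat n n (\<lambda>(i, j). (if i = j then 1 else 0) + z * cinner (c i) (a j))"
  have M: "M \<in> carrier_mat n n"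
    by (simp add: M_def)
  obtain s where s: "s \<in> carrier_vec n" "s \<noteq> 0\<^sub>v n" "M *\<^sub>v s = 0\<^sub>v n"
    using assms det_0_iff_vec_prod_zero[OF M] by (auto simp: pdet_def M_def)
  define v where "v = (\<Sum>j<n. vec_index s j *\<^sub>C a j)"
  have sv: "vec_index s i = - z * cinner (c i) v" if "i < n" for i
  proof -
    have "0 = vec_index (M *\<^sub>v s) i"
      using that s by simp
    also have "\<dots> = (\<Sum>j<n. ((if i = j then 1 else 0) + z * cinner (c i) (a j)) * vec_index s j)"
      using that s(1) by (simp add: M_def scalar_prod_def lessThan_atLeast0)
    also have "\<dots> = vec_index s i + z * cinner (c i) v"
      using that by (simp only: distrib_right sum.distrib)
        (simp add: v_def cinner_sum_right cinner_scaleC_right sum_distrib_left mult_ac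
          if_distrib[of "\<lambda>x. _ * x"] cong: if_cong)
    finally show ?thesis
      by (simp add: eq_neg_iff_add_eq_0)
  qed
  have "v \<noteq> 0"
  proof
    assume "v = 0"
    then have "s = 0\<^sub>v n"
      using s sv by (intro eq_vecI) auto
    then show False
      using s by simp
  qed
  moreover have "v = (\<Sum>j<n. (- z * cinner (c j) v) *\<^sub>C a j)"
    by (subst v_def, intro sum.cong) (simp_all add: sv)
  then have "v = - (z *\<^sub>C (\<Sum>k<n. cinner (c k) v *\<^sub>C a k))"
    by (simp add: complex_vector.scale_sum_right sum_negf[symmetric] scaleC_scaleC)
  then have "v + z *\<^sub>C (\<Sum>k<n. cinner (c k) v *\<^sub>C a k) = 0"
    by (simp add: eq_neg_iff_add_eq_0)
  ultimately show thesis
    by (rule that)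
qed

text \<open>An upper bound for the trace norm of the operator of the pairs: half the sum of the
  squared Hilbert-Schmidt norms of the two factors through which it is written.\<close>

definition hs :: "nat \<Rightarrow> (nat \<Rightarrow> 'h::real_normed_vector) \<Rightarrow> (nat \<Rightarrow> 'h) \<Rightarrow> real"
  where "hs n a c = (\<Sum>k<n. ((norm (a k))\<^sup>2 + (norm (c k))\<^sup>2) / 2)"

lemma hs_nonneg [simp]: "0 \<le> hs n a c"
  by (simp add: hs_def sum_nonneg)

text \<open>Weyl's inequality: deflation of an eigenvalue \<open>\<mu>\<close> lowers \<^const>\<open>hs\<close> by at least \<open>\<bar>\<mu>\<bar>\<close>.\<close>

lemma pdet_prod_list:
  fixes a c :: "nat \<Rightarrow> 'h::complex_hilbert"
  shows "\<exists>ms. (\<forall>z. pdet n a c z = (\<Prod>\<mu>\<leftarrow>ms. 1 + z * \<mu>)) \<and> (\<Sum>\<mu>\<leftarrow>ms. cmod \<mu>) \<le> hs n a c"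
proof -
  \<comment> \<open>The determinant is a polynomial in \<open>z\<close>, and deflation at a zero
    lowers its degree by one.\<close>
  have "\<forall>a c :: nat \<Rightarrow> 'h. (\<forall>z. pdet n a c z = poly p z) \<longrightarrow>
    (\<exists>ms. (\<forall>z. pdet n a c z = (\<Prod>\<mu>\<leftarrow>ms. 1 + z * \<mu>)) \<and> (\<Sum>\<mu>\<leftarrow>ms. cmod \<mu>) \<le> hs n a c)" for p
  proof (induction "degree p" arbitrary: p)
    case 0
    then obtain q where "p = [:q:]"
      by (metis degree_eq_zeroE)
    then have one: "pdet n a c z = 1" if "\<forall>z. pdet n a c z = poly p z" for a c :: "nat \<Rightarrow> 'h" and z
      using that pdet_at_0[of n a c] by (metis poly_pCons mult_zero_right poly_0 add_0_right)
    show ?case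
    proof (intro allI impI)
      fix a c :: "nat \<Rightarrow> 'h"
      assume "\<forall>z. pdet n a c z = poly p z"
      then have "\<forall>z. pdet n a c z = 1"
        using one by blast
      then show "\<exists>ms. (\<forall>z. pdet n a c z = (\<Prod>\<mu>\<leftarrow>ms. 1 + z * \<mu>)) \<and> (\<Sum>\<mu>\<leftarrow>ms. cmod \<mu>) \<le> hs n a c"
        by (intro exI[of _ "[]"]) simp
    qed
  next
    case (Suc m)
    show ?case
    proof (intro allI impI)
      fix a c :: "nat \<Rightarrow> 'h"
      assume p: "\<forall>z. pdet n a c z = poly p z"
      have "\<not> constant (poly p)"
        using Suc.hyps(2) by (simp add: constant_degree)
      then obtain z0 where z0: "poly p z0 = 0"
        using fundamental_theorem_of_algebra by blast
      moreover have "poly p 0 = 1"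
        using p[rule_format, of 0] by simp
      ultimately have "z0 \<noteq> 0"
        by auto
      obtain v where v: "v \<noteq> 0" "v + z0 *\<^sub>C (\<Sum>k<n. cinner (c k) v *\<^sub>C a k) = 0"
        using pdet_root_eigenvector[of n a c z0] z0 p[rule_format, of z0] by metis
      \<comment> \<open>A zero \<open>z0\<close> of the determinant of \<open>Id + z K\<close>
        belongs to the eigenvalue \<open>- 1 / z0\<close> of \<open>K\<close>.\<close>
      define \<mu> where "\<mu> = - inverse z0"
      define x where "x = complex_of_real (inverse (norm v)) *\<^sub>C v"
      have x: "norm x = 1"
        using v by (simp add: x_def norm_scaleC norm_inverse)
      have "z0 *\<^sub>C (\<Sum>k<n. cinner (c k) v *\<^sub>C a k) = - v"
        using v(2) by (simp add: eq_neg_iff_add_eq_0 add.commute)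
      then have "inverse z0 *\<^sub>C (z0 *\<^sub>C (\<Sum>k<n. cinner (c k) v *\<^sub>C a k)) = \<mu> *\<^sub>C v"
        by (simp add: \<mu>_def)
      then have "(\<Sum>k<n. cinner (c k) v *\<^sub>C a k) = \<mu> *\<^sub>C v"
        using \<open>z0 \<noteq> 0\<close> by (simp add: scaleC_scaleC)
      moreover have "(\<Sum>k<n. cinner (c k) x *\<^sub>C a k)
          = complex_of_real (inverse (norm v)) *\<^sub>C (\<Sum>k<n. cinner (c k) v *\<^sub>C a k)"
        by (simp add: x_def cinner_scaleC_right complex_vector.scale_sum_right scaleC_scaleC)
      ultimately have eig: "(\<Sum>k<n. cinner (c k) x *\<^sub>C a k) = \<mu> *\<^sub>C x"
        by (simp add: x_def scaleC_scaleC mult.commute)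
      define a' c' where "a' = (\<lambda>k. perp x (a k))" and "c' = (\<lambda>k. perp x (c k))"
      have defl: "pdet n a c z = (1 + z * \<mu>) * pdet n a' c' z" for z
        unfolding a'_def c'_def by (rule pdet_deflate[OF x eig])
      obtain q where q: "\<forall>z. pdet n a' c' z = poly q z"
        using pdet_poly by blast
      have pq: "p = [:1, \<mu>:] * q"
        using p q defl by (simp add: poly_eq_poly_eq_iff[symmetric] fun_eq_iff algebra_simps)
      have "q \<noteq> 0"
        using pq Suc.hyps(2) by auto
      then have "degree p = Suc (degree q)"
        unfolding pq by (subst degree_mult_eq) (auto simp: \<mu>_def \<open>z0 \<noteq> 0\<close>)
      then obtain ms where ms: "\<forall>z. pdet n a' c' z = (\<Prod>\<mu>\<leftarrow>ms. 1 + z * \<mu>)"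
        "(\<Sum>\<mu>\<leftarrow>ms. cmod \<mu>) \<le> hs n a' c'"
        using Suc.hyps(1)[of q, rule_format, of a' c'] Suc.hyps(2) q[rule_format] by auto
      have "\<mu> = cinner x (\<mu> *\<^sub>C x)"
        using x by (simp add: cinner_algebra cinner_self)
      also have "\<dots> = (\<Sum>k<n. cinner (c k) x * cinner x (a k))"
        by (simp add: eig[symmetric] cinner_sum_right cinner_algebra)
      also have "cmod \<dots> \<le> (\<Sum>k<n. cmod (cinner (c k) x * cinner x (a k)))"
        by (rule norm_sum)
      also have "\<dots> \<le> hs n a c - hs n a' c'"
        unfolding hs_def sum_subtractf[symmetric] a'_def c'_def
        by (intro sum_mono cinner_mult_le_perp x)
      finally show "\<exists>ms. (\<forall>z. pdet n a c z = (\<Prod>\<mu>\<leftarrow>ms. 1 + z * \<mu>)) \<and> (\<Sum>\<mu>\<leftarrow>ms. cmod \<mu>) \<le> hs n a c"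
        using ms defl by (intro exI[of _ "\<mu> # ms"]) auto
    qed
  qed
  then show ?thesis
    using pdet_poly by blast
qed

lemma norm_prod_list_minus_1_le:
  "cmod ((\<Prod>\<mu>\<leftarrow>ms. 1 + z * \<mu>) - 1) \<le> exp (cmod z * (\<Sum>\<mu>\<leftarrow>ms. cmod \<mu>)) - 1"
proof (induction ms)
  case (Cons m ms)
  let ?P = "\<Prod>\<mu>\<leftarrow>ms. 1 + z * \<mu>" and ?e = "exp (cmod z * (\<Sum>\<mu>\<leftarrow>ms. cmod \<mu>))"
  have "cmod ((1 + z * m) * ?P - 1) = cmod ((1 + z * m) * (?P - 1) + z * m)"
    by (simp add: algebra_simps)
  also have "\<dots> \<le> (1 + cmod z * cmod m) * (?e - 1) + cmod z * cmod m"
    using norm_triangle_ineq[of 1 "z * m"]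
    by (intro norm_triangle_le add_mono) (auto simp: norm_mult intro!: mult_mono Cons.IH)
  also have "\<dots> = (1 + cmod z * cmod m) * ?e - 1"
    by (simp add: algebra_simps)
  also have "\<dots> \<le> exp (cmod z * cmod m) * ?e - 1"
    by (simp add: mult_right_mono)
  finally show ?case
    by (simp add: exp_add distrib_left)
qed simp

lemma norm_pdet_minus_1_le: "cmod (pdet n a c z - 1) \<le> exp (cmod z * hs n a c) - 1"
proof -
  obtain ms where ms: "pdet n a c z = (\<Prod>\<mu>\<leftarrow>ms. 1 + z * \<mu>)" "(\<Sum>\<mu>\<leftarrow>ms. cmod \<mu>) \<le> hs n a c"
    using pdet_prod_list[of n a c] by blast
  then have "cmod (pdet n a c z - 1) \<le> exp (cmod z * (\<Sum>\<mu>\<leftarrow>ms. cmod \<mu>)) - 1"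
    by (simp add: norm_prod_list_minus_1_le)
  also have "\<dots> \<le> exp (cmod z * hs n a c) - 1"
    using ms by (simp add: mult_left_mono)
  finally show ?thesis .
qed

lemma norm_pdet_le: "cmod (pdet n a c z) \<le> exp (cmod z * hs n a c)"
  using norm_pdet_minus_1_le[of n a c z] norm_triangle_sub[of "pdet n a c z" 1] by simp

section \<open>Dependence on a single column or row, and growth in \<open>z\<close>\<close>

text \<open>Column \<open>k\<close> is a unit vector, so only the minor without row \<open>k\<close>
  survives, and \<open>c k\<close> occurs only in that row.\<close>

lemma pdet_fun_upd_0:
  assumes "k < n" "a k = 0"
  shows "pdet n a (c(k := w)) z = pdet n a c z"
proof -
  define M where "M c = mat n n (\<lambda>(i, j). (if i = j then 1 else 0) + z * cinner (c i) (a j))" for c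
  have *: "pdet n a c z = cofactor (M c) k k" for c
  proof -
    have "pdet n a c z = (\<Sum>i<n. M c $$ (i, k) * cofactor (M c) i k)"
      unfolding pdet_def M_def[symmetric]
      using assms by (intro laplace_expansion_column) (simp_all add: M_def)
    also have "\<dots> = (\<Sum>i<n. if i = k then cofactor (M c) k k else 0)"
      using assms by (intro sum.cong) (auto simp: M_def)
    finally show ?thesis
      using assms by simp
  qed
  have "mat_delete (M (c(k := w))) k k = mat_delete (M c) k k"
    unfolding mat_delete_def by (intro eq_matI) (auto simp: M_def)
  then show ?thesis
    unfolding * by (simp add: cofactor_def)
qed

lemma pdet_fun_upd_add:
  assumes "k < n"
  shows "pdet n (a(k := u + v)) c z - pdet n (a(k := 0)) c z =
    (pdet n (a(k := u)) c z - pdet n (a(k := 0)) c z) + (pdet n (a(k := v)) c z - pdet n (a(k := 0)) c z)"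
proof -
  obtain \<beta> where \<beta>: "\<And>u. pdet n (a(k := u)) c z = pdet n (a(k := 0)) c z + (\<Sum>i<n. \<beta> i * cinner (c i) u)"
    using pdet_affine[OF assms] by blast
  show ?thesis
    unfolding \<beta>[of u] \<beta>[of v] \<beta>[of "u + v"] by (simp add: cinner_add_right algebra_simps sum.distrib)
qed

lemma pdet_fun_upd_scaleC:
  assumes "k < n"
  shows "pdet n (a(k := t *\<^sub>C u)) c z - pdet n (a(k := 0)) c z =
    t * (pdet n (a(k := u)) c z - pdet n (a(k := 0)) c z)"
proof -
  obtain \<beta> where \<beta>: "\<And>u. pdet n (a(k := u)) c z = pdet n (a(k := 0)) c z + (\<Sum>i<n. \<beta> i * cinner (c i) u)"
    using pdet_affine[OF assms] by blast
  show ?thesis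
    unfolding \<beta>[of u] \<beta>[of "t *\<^sub>C u"] by (simp add: cinner_scaleC_right algebra_simps sum_distrib_left)
qed

lemma pdet_fun_upd_scaleC':
  assumes "k < n"
  shows "pdet n a (c(k := t *\<^sub>C u)) z - pdet n a (c(k := 0)) z =
    cnj t * (pdet n a (c(k := u)) z - pdet n a (c(k := 0)) z)"
  unfolding cnj_pdet[of n a _ z] complex_cnj_diff[symmetric] pdet_fun_upd_scaleC[OF assms] by simp

lemma pdet_fun_upd_add':
  assumes "k < n"
  shows "pdet n a (c(k := u + v)) z - pdet n a (c(k := 0)) z =
    (pdet n a (c(k := u)) z - pdet n a (c(k := 0)) z) + (pdet n a (c(k := v)) z - pdet n a (c(k := 0)) z)"
  unfolding cnj_pdet[of n a _ z] complex_cnj_diff[symmetric] complex_cnj_add[symmetric]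
    pdet_fun_upd_add[OF assms] by simp

text \<open>The determinant is affine in each column, so its value at a column is controlled by the values
  at much shorter columns. Shortening finitely many columns turns exponential growth into growth of
  minimal exponential type, without any use of Hadamard's inequality.\<close>

lemma pdet_shorten:
  assumes r: "0 < r" "r \<le> 1"
    and B: "\<And>u. norm u \<le> r * norm (a k) \<Longrightarrow> cmod (pdet n (a(k := u)) c z) \<le> B"
  shows "cmod (pdet n a c z) \<le> 2 / r * B"
proof (cases "k < n")
  case True
  have B0: "cmod (pdet n (a(k := 0)) c z) \<le> B"
    using r by (intro B) simp
  have Br: "cmod (pdet n (a(k := complex_of_real r *\<^sub>C a k)) c z) \<le> B"
    using r by (intro B) (simp add: norm_scaleC)
  \<comment> \<open>An affine function is extrapolated from its values at the two short columns
    \<open>r a k\<close> and 0. Each of the two terms is at most \<open>B\<close>, whence the factor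
    \<open>2 / r\<close>.\<close>
  have "complex_of_real r * pdet n a c z
      = pdet n (a(k := complex_of_real r *\<^sub>C a k)) c z - (1 - complex_of_real r) * pdet n (a(k := 0)) c z"
    using pdet_fun_upd_scaleC[OF True, of a "complex_of_real r" "a k" c z] by (simp add: algebra_simps)
  then have "r * cmod (pdet n a c z)
      = cmod (pdet n (a(k := complex_of_real r *\<^sub>C a k)) c z - (1 - complex_of_real r) * pdet n (a(k := 0)) c z)"
    using r by (metis abs_of_pos norm_mult norm_of_real)
  also have "\<dots> \<le> B + B"
  proof (intro norm_triangle_le_diff add_mono Br)
    have "cmod (1 - complex_of_real r) = 1 - r"
      using r by (metis abs_of_nonneg diff_ge_0_iff_ge norm_of_real of_real_1 of_real_diff)
    then have "cmod ((1 - complex_of_real r) * pdet n (a(k := 0)) c z) \<le> 1 * B"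
      unfolding norm_mult using r B0 by (intro mult_mono) auto
    then show "cmod ((1 - complex_of_real r) * pdet n (a(k := 0)) c z) \<le> B"
      by simp
  qed
  finally show ?thesis
    using r by (simp add: field_simps)
next
  case False
  have "pdet n a c z = pdet n (a(k := 0)) c z"
    using False by (intro pdet_cong) auto
  then have "cmod (pdet n a c z) \<le> B"
    using B[of 0] r by simp
  moreover from this have "B \<ge> 0"
    by (rule order.trans[OF norm_ge_zero])
  then have "1 * B \<le> 2 / r * B"
    using r by (intro mult_right_mono) (auto simp: field_simps)
  ultimately show ?thesis by simp
qed

lemma pdet_shorten':
  assumes r: "0 < r" "r \<le> 1"
    and B: "\<And>u. norm u \<le> r * norm (c k) \<Longrightarrow> cmod (pdet n a (c(k := u)) z) \<le> B"
  shows "cmod (pdet n a c z) \<le> 2 / r * B"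
  using pdet_shorten[OF r, of c k n a "cnj z" B] B by (simp add: cnj_pdet[of n a _ z])

text \<open>The value that \<open>hs\<close> takes after the first \<open>N\<close> vectors of both
  families have been multiplied by \<open>r\<close>.\<close>

definition hs_head :: "real \<Rightarrow> nat \<Rightarrow> nat \<Rightarrow> (nat \<Rightarrow> 'h::real_normed_vector) \<Rightarrow> (nat \<Rightarrow> 'h) \<Rightarrow> real"
  where "hs_head r N n a c =
    (\<Sum>k<n. (if k < N then r\<^sup>2 else 1) * (((norm (a k))\<^sup>2 + (norm (c k))\<^sup>2) / 2))"

text \<open>Shortening the first \<open>N\<close> columns and the first \<open>N\<close> rows costs
  a factor \<open>2 / r\<close> each. In return their share of the exponent shrinks by
  \<open>r\<^sup>2\<close>; large \<open>N\<close> and small \<open>r\<close> then make the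
  exponential rate arbitrarily small, uniformly in \<open>n\<close>.\<close>

lemma pdet_growth:
  assumes r: "0 < r" "r \<le> 1"
  shows "cmod (pdet n a c z) \<le> (2 / r) ^ (2 * N) * exp (cmod z * hs_head r N n a c)"
proof (induction N arbitrary: a c)
  case 0
  show ?case
    using norm_pdet_le[of n a c z] by (simp add: hs_def hs_head_def)
next
  case (Suc N)
  let ?B = "(2 / r) ^ (2 * N) * exp (cmod z * hs_head r (Suc N) n a c)"
  have "cmod (pdet n (a(N := u)) (c(N := w)) z) \<le> ?B"
    if "norm u \<le> r * norm (a N)" "norm w \<le> r * norm (c N)" for u w
  proof -
    have "(norm u)\<^sup>2 \<le> r\<^sup>2 * (norm (a N))\<^sup>2" "(norm w)\<^sup>2 \<le> r\<^sup>2 * (norm (c N))\<^sup>2"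
      using that by (metis norm_ge_zero power_mono power_mult_distrib)+
    then have "hs_head r N n (a(N := u)) (c(N := w)) \<le> hs_head r (Suc N) n a c"
      unfolding hs_head_def by (intro sum_mono) (auto simp: algebra_simps less_Suc_eq)
    then have "(2 / r) ^ (2 * N) * exp (cmod z * hs_head r N n (a(N := u)) (c(N := w))) \<le> ?B"
      using r by (intro mult_left_mono) (auto intro!: mult_left_mono)
    then show ?thesis
      by (rule order.trans[OF Suc.IH])
  qed
  then have "cmod (pdet n a c z) \<le> 2 / r * (2 / r * ?B)"
    by (intro pdet_shorten[OF r, of _ N] pdet_shorten'[OF r, of _ N])
  then show ?case
    by (simp add: power2_eq_square mult_ac)
qed

text \<open>The difference vanishes if either vector of the pair \<open>k\<close> does, is linear in
  \<open>a k\<close> and conjugate linear in \<open>c k\<close>. So it suffices to bound it for unit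
  vectors, where Weyl's inequality applies; such a pair contributes \<open>(1 + 1) / 2 = 1\<close>
  to \<open>hs\<close>.\<close>

lemma pdet_entry_bound:
  assumes "k < n"
  shows "cmod (pdet n a c z - pdet n (a(k := 0)) c z)
    \<le> norm (a k) * norm (c k) * (2 * exp (cmod z * (hs n (a(k := 0)) (c(k := 0)) + 1)))"
proof -
  let ?B = "exp (cmod z * (hs n (a(k := 0)) (c(k := 0)) + 1))"
  define D where "D u w = pdet n (a(k := u)) (c(k := w)) z - pdet n (a(k := 0)) c z" for u w
  have D1: "D (t *\<^sub>C u) w = t * D u w" for t u w
    using pdet_fun_upd_scaleC[OF assms, of a t u "c(k := w)" z] pdet_fun_upd_0[OF assms, of "a(k := 0)" c w z]
    by (simp add: D_def)
  have c0: "pdet n (a(k := u)) (c(k := 0)) z = pdet n (a(k := 0)) c z" for u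
    using pdet_fun_upd_0[OF assms, of "c(k := 0)" a _ "cnj z"] pdet_fun_upd_0[OF assms, of "a(k := 0)" c 0 z]
    by (simp add: cnj_pdet[of n _ _ z])
  have D2: "D u (t *\<^sub>C w) = cnj t * D u w" for t u w
    using pdet_fun_upd_scaleC'[OF assms, of "a(k := u)" c t w z] c0[of u]
    by (simp add: D_def)
  show ?thesis
  proof (cases "a k = 0 \<or> c k = 0")
    case True
    have "D (a k) (c k) = 0"
      using True D1[of 0 0 "c k"] D2[of "a k" 0 0] by auto
    then show ?thesis
      by (simp add: D_def)
  next
    case False
    define u w where "u = complex_of_real (inverse (norm (a k))) *\<^sub>C a k"
      and "w = complex_of_real (inverse (norm (c k))) *\<^sub>C c k"
    have n1: "norm u = 1" "norm w = 1"
      using False by (simp_all add: u_def w_def norm_scaleC norm_inverse)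
    have "hs n (a(k := u)) (c(k := w)) = hs n (a(k := 0)) (c(k := 0)) + (\<Sum>i<n. if i = k then 1 else 0)"
      unfolding hs_def sum.distrib[symmetric] using n1 by (intro sum.cong) auto
    then have 1: "cmod (pdet n (a(k := u)) (c(k := w)) z) \<le> ?B"
      using norm_pdet_le[of n "a(k := u)" "c(k := w)" z] assms by simp
    have "cmod (pdet n (a(k := 0)) (c(k := 0)) z) \<le> ?B"
      by (rule order.trans[OF norm_pdet_le]) (simp add: mult_left_mono)
    then have "cmod (D u w) \<le> 2 * ?B"
      unfolding D_def using 1 by (intro norm_triangle_le_diff) (simp add: c0)
    moreover have "a k = complex_of_real (norm (a k)) *\<^sub>C u" "c k = complex_of_real (norm (c k)) *\<^sub>C w"
      using False by (simp_all add: u_def w_def scaleC_scaleC flip: of_real_mult)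
    then have "D (a k) (c k) = complex_of_real (norm (a k)) * (complex_of_real (norm (c k)) * D u w)"
      by (metis D1 D2 complex_cnj_complex_of_real)
    then have "cmod (D (a k) (c k)) = norm (a k) * norm (c k) * cmod (D u w)"
      by (simp add: norm_mult)
    ultimately have "cmod (D (a k) (c k)) \<le> norm (a k) * norm (c k) * (2 * ?B)"
      by (simp add: mult_left_mono)
    then show ?thesis
      by (simp add: D_def)
  qed
qed

subsection \<open>Fredholm determinants of sequences\<close>

definition sqsum :: "(nat \<Rightarrow> 'h::real_normed_vector) \<Rightarrow> bool"
  where "sqsum a \<longleftrightarrow> summable (\<lambda>k. (norm (a k))\<^sup>2)"

definition hsi :: "(nat \<Rightarrow> 'h::real_normed_vector) \<Rightarrow> (nat \<Rightarrow> 'h) \<Rightarrow> real"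
  where "hsi a c = suminf (\<lambda>k. ((norm (a k))\<^sup>2 + (norm (c k))\<^sup>2) / 2)"

definition nuclear :: "(nat \<Rightarrow> 'h::complex_hilbert) \<Rightarrow> (nat \<Rightarrow> 'h) \<Rightarrow> 'h \<Rightarrow> 'h"
  where "nuclear a c x = suminf (\<lambda>k. cinner (c k) x *\<^sub>C a k)"

definition fdet :: "(nat \<Rightarrow> 'h::complex_hilbert) \<Rightarrow> (nat \<Rightarrow> 'h) \<Rightarrow> complex \<Rightarrow> complex"
  where "fdet a c z = lim (\<lambda>n. pdet n a c z)"

lemma summable_hs: "sqsum a \<Longrightarrow> sqsum c \<Longrightarrow> summable (\<lambda>k. ((norm (a k))\<^sup>2 + (norm (c k))\<^sup>2) / 2)"
  unfolding sqsum_def by (intro summable_divide summable_add)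

lemma hs_le_hsi: "sqsum a \<Longrightarrow> sqsum c \<Longrightarrow> hs n a c \<le> hsi a c"
  unfolding hs_def hsi_def by (intro sum_le_suminf summable_hs) auto

lemma summable_norm_mult:
  assumes "sqsum a" "sqsum c"
  shows "summable (\<lambda>k. norm (a k) * norm (c k))"
proof (rule summable_comparison_test[OF _ summable_hs[OF assms]])
  show "\<exists>N. \<forall>n\<ge>N. norm (norm (a n) * norm (c n)) \<le> ((norm (a n))\<^sup>2 + (norm (c n))\<^sup>2) / 2"
    using sum_squares_bound[of "norm (a n)" "norm (c n)" for n] by (auto simp: field_simps)
qed

lemma sqsum_mono: "sqsum a \<Longrightarrow> (\<And>k. norm (b k) \<le> norm (a k)) \<Longrightarrow> sqsum b"
  unfolding sqsum_def by (erule summable_comparison_test') (simp add: power_mono)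

lemma sqsum_case_nat [simp]: "sqsum (case_nat b a) \<longleftrightarrow> sqsum a"
  unfolding sqsum_def by (subst summable_Suc_iff[symmetric]) simp

lemma sqsum_shift [simp]: "sqsum (\<lambda>k. a (N + k)) \<longleftrightarrow> sqsum a"
  unfolding sqsum_def using summable_iff_shift[of "\<lambda>k. (norm (a k))\<^sup>2" N] by (simp add: add.commute)

lemma nuclear_sums:
  assumes "sqsum a" "sqsum c"
  shows "(\<lambda>k. cinner (c k) x *\<^sub>C a k) sums nuclear a c x"
proof -
  have "summable (\<lambda>k. norm x * (norm (a k) * norm (c k)))"
    by (intro summable_mult summable_norm_mult assms)
  then have "summable (\<lambda>k. cinner (c k) x *\<^sub>C a k)"
  proof (rule summable_comparison_test')
    fix k
    show "norm (cinner (c k) x *\<^sub>C a k) \<le> norm x * (norm (a k) * norm (c k))"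
      using mult_right_mono[OF cinner_Cauchy_Schwarz[of "c k" x], of "norm (a k)"]
      by (simp add: norm_scaleC mult_ac)
  qed
  then show ?thesis
    by (simp add: nuclear_def summable_sums)
qed

text \<open>One more pair is an entry that was zero before. The point is a bound by the product of
  the two norms, which is summable over \<open>n\<close> and thus fits the Weierstrass test.\<close>

lemma pdet_diff_le:
  assumes "sqsum a" "sqsum c" "cmod z \<le> R"
  shows "cmod (pdet (Suc n) a c z - pdet n a c z)
    \<le> 2 * exp (R * (hsi a c + 1)) * (norm (a n) * norm (c n))"
proof -
  have "0 \<le> R"
    using assms(3) norm_ge_zero order_trans by blast
  have "pdet n a c z = pdet n (a(n := 0)) c z"
    by (rule pdet_cong) simp
  then have "pdet n a c z = pdet (Suc n) (a(n := 0)) c z"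
    by (simp add: pdet_last_zero)
  then have "cmod (pdet (Suc n) a c z - pdet n a c z)
    \<le> norm (a n) * norm (c n) * (2 * exp (cmod z * (hs (Suc n) (a(n := 0)) (c(n := 0)) + 1)))"
    using pdet_entry_bound[of n "Suc n" a c z] by simp
  also have "hs (Suc n) (a(n := 0)) (c(n := 0)) = hs n a c"
    by (simp add: hs_def)
  also have "norm (a n) * norm (c n) * (2 * exp (cmod z * (hs n a c + 1)))
      \<le> norm (a n) * norm (c n) * (2 * exp (R * (hsi a c + 1)))"
    using assms \<open>0 \<le> R\<close> by (intro mult_left_mono) (auto intro!: mult_mono hs_le_hsi)
  finally show ?thesis
    by (simp add: mult_ac)
qed

lemma pdet_uniform_limit:
  assumes "sqsum a" "sqsum c"
  shows "uniform_limit (cball 0 R) (\<lambda>n. pdet n a c) (fdet a c) sequentially"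
proof -
  let ?D = "\<lambda>n z. pdet (Suc n) a c z - pdet n a c z"
  have "uniform_limit (cball 0 R) (\<lambda>n z. \<Sum>k<n. ?D k z) (\<lambda>z. suminf (\<lambda>k. ?D k z)) sequentially"
    using pdet_diff_le[OF assms] summable_mult[OF summable_norm_mult[OF assms]]
    by (intro Weierstrass_m_test[where M = "\<lambda>n. 2 * exp (R * (hsi a c + 1)) * (norm (a n) * norm (c n))"])
      auto
  then have lim: "uniform_limit (cball 0 R) (\<lambda>n z. pdet n a c z - 1) (\<lambda>z. suminf (\<lambda>k. ?D k z)) sequentially"
    by (simp add: sum_lessThan_telescope[of "\<lambda>k. pdet k a c z" for z])
  have "uniform_limit (cball 0 R) (\<lambda>n z. 1 + (pdet n a c z - 1)) (\<lambda>z. 1 + (suminf (\<lambda>k. ?D k z))) sequentially"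
    by (intro uniform_limit_intros lim)
  then have u: "uniform_limit (cball 0 R) (\<lambda>n. pdet n a c) (\<lambda>z. 1 + (suminf (\<lambda>k. ?D k z))) sequentially"
    by simp
  have "fdet a c z = 1 + (suminf (\<lambda>k. ?D k z))" if "z \<in> cball 0 R" for z
    unfolding fdet_def using tendsto_uniform_limitI[OF u that] by (rule limI)
  then show ?thesis
    by (intro iffD2[OF uniform_limit_cong' u]) simp_all
qed

lemma pdet_tendsto: "sqsum a \<Longrightarrow> sqsum c \<Longrightarrow> (\<lambda>n. pdet n a c z) \<longlonglongrightarrow> fdet a c z"
  using tendsto_uniform_limitI[OF pdet_uniform_limit[of a c "cmod z"], of z] by simp

lemma fdet_holomorphic:
  assumes "sqsum a" "sqsum c"
  shows "fdet a c holomorphic_on UNIV"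
proof (rule holomorphic_uniform_sequence[OF open_UNIV])
  show "pdet n a c holomorphic_on UNIV" for n
  proof -
    obtain p where "\<forall>z. pdet n a c z = poly p z"
      using pdet_poly by blast
    then have "pdet n a c = poly p"
      by auto
    then show ?thesis
      by (simp add: holomorphic_intros)
  qed
  fix x :: complex
  have "cball x 1 \<subseteq> cball 0 (cmod x + 1)"
  proof
    fix y assume "y \<in> cball x 1"
    then show "y \<in> cball 0 (cmod x + 1)"
      using norm_triangle_ineq2[of y x] by (simp add: dist_norm norm_minus_commute)
  qed
  then have "uniform_limit (cball x 1) (\<lambda>n. pdet n a c) (fdet a c) sequentially"
    using pdet_uniform_limit[OF assms] uniform_limit_on_subset by blast
  then show "\<exists>d>0. cball x d \<subseteq> UNIV \<and> uniform_limit (cball x d) (\<lambda>n. pdet n a c) (fdet a c) sequentially"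
    by (intro exI[of _ 1]) auto
qed

lemma fdet_at_0: "fdet a c 0 = 1"
  by (simp add: fdet_def)

lemma fdet_cong:
  "(\<And>i j. cinner (c i) (a j) = cinner (c' i) (a' j)) \<Longrightarrow> fdet a c z = fdet a' c' z"
  unfolding fdet_def by (intro arg_cong[where f = lim] ext pdet_cong)

lemma null_sequence_le:
  fixes f :: "nat \<Rightarrow> 'a::real_normed_vector"
  assumes "g \<longlonglongrightarrow> l" "\<And>n. norm (f n) \<le> g n" "l = 0"
  shows "f \<longlonglongrightarrow> 0"
  by (rule Lim_null_comparison[where g = g]) (use assms in auto)

lemma nuclear_add:
  assumes "sqsum a" "sqsum c"
  shows "nuclear a c (x + y) = nuclear a c x + nuclear a c y"
  using sums_add[OF nuclear_sums[OF assms, of x] nuclear_sums[OF assms, of y]] nuclear_sums[OF assms, of "x + y"]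
  by (simp add: cinner_add_right scaleC_add_left sums_unique2)

lemma nuclear_scaleC:
  assumes "sqsum a" "sqsum c"
  shows "nuclear a c (t *\<^sub>C x) = t *\<^sub>C nuclear a c x"
  using bounded_linear.sums[OF bounded_linear_scaleC nuclear_sums[OF assms, of x], of t]
    nuclear_sums[OF assms, of "t *\<^sub>C x"]
  by (simp add: cinner_scaleC_right scaleC_scaleC sums_unique2)

lemma nuclear_diff: "sqsum a \<Longrightarrow> sqsum c \<Longrightarrow> nuclear a c (x - y) = nuclear a c x - nuclear a c y"
  using nuclear_add[of a c x "(-1) *\<^sub>C y"] nuclear_scaleC[of a c "-1" y] by simp

lemma norm_nuclear_le:
  assumes "sqsum a" "sqsum c"
  shows "norm (nuclear a c x) \<le> hsi a c * norm x"
proof -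
  have "norm (cinner (c k) x *\<^sub>C a k) \<le> ((norm (a k))\<^sup>2 + (norm (c k))\<^sup>2) / 2 * norm x" for k
  proof -
    have "norm (cinner (c k) x *\<^sub>C a k) \<le> (norm (a k) * norm (c k)) * norm x"
      using mult_right_mono[OF cinner_Cauchy_Schwarz[of "c k" x], of "norm (a k)"]
      by (simp add: norm_scaleC mult_ac)
    also have "\<dots> \<le> ((norm (a k))\<^sup>2 + (norm (c k))\<^sup>2) / 2 * norm x"
      using sum_squares_bound[of "norm (a k)" "norm (c k)"] by (intro mult_right_mono) auto
    finally show ?thesis .
  qed
  then have "norm (suminf (\<lambda>k. cinner (c k) x *\<^sub>C a k))
      \<le> suminf (\<lambda>k. ((norm (a k))\<^sup>2 + (norm (c k))\<^sup>2) / 2 * norm x)"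
    by (intro norm_suminf_le summable_mult2 summable_hs assms)
  then show ?thesis
    by (simp add: nuclear_def hsi_def suminf_mult2[OF summable_hs[OF assms]])
qed

lemma cinner_nuclear:
  assumes "sqsum a" "sqsum c"
  shows "cinner (nuclear c a x) y = cinner x (nuclear a c y)"
proof (rule sums_unique2)
  show "(\<lambda>k. cinner (cinner (a k) x *\<^sub>C c k) y) sums cinner (nuclear c a x) y"
    by (intro bounded_linear.sums[OF bounded_linear_cinner_left] nuclear_sums assms)
  have "(\<lambda>k. cinner x (cinner (c k) y *\<^sub>C a k)) sums cinner x (nuclear a c y)"
    by (intro bounded_linear.sums[OF bounded_linear_cinner_right] nuclear_sums assms)
  then show "(\<lambda>k. cinner (cinner (a k) x *\<^sub>C c k) y) sums cinner x (nuclear a c y)"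
    by (simp add: cinner_algebra cinner_commute[of x "a k" for k] mult.commute)
qed

lemma hsi_nonneg: "sqsum a \<Longrightarrow> sqsum c \<Longrightarrow> 0 \<le> hsi a c"
  unfolding hsi_def by (intro suminf_nonneg summable_hs) auto

lemma hsi_mono:
  assumes "sqsum a" "sqsum c"
    and "\<And>k. norm (a' k) \<le> norm (a k)" "\<And>k. norm (c' k) \<le> norm (c k)"
  shows "hsi a' c' \<le> hsi a c"
proof -
  have "sqsum a'" "sqsum c'"
    using assms sqsum_mono by blast+
  then show ?thesis
    unfolding hsi_def using assms
    by (intro suminf_le summable_hs divide_right_mono add_mono power_mono) auto
qed

lemma case_nat_fun_upd [simp]: "(case_nat x a)(0 := b) = case_nat b a"
  by (auto simp: fun_eq_iff split: nat.split)

lemma pdet_case_nat_0: "pdet (Suc n) (case_nat 0 a) (case_nat w c) z = pdet n a c z"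
  using pdet_case_nat[where y = 0 and b = 0 and n = n and a = a and c = c and w = w and z = z] by simp

lemma pdet_case_nat_0': "pdet (Suc n) (case_nat b a) (case_nat 0 c) z = pdet n a c z"
  by (simp add: cnj_pdet[of _ "case_nat b a"] cnj_pdet[of n a] pdet_case_nat_0)

text \<open>The bound does not depend on \<open>n\<close>, so a prepended vector may be replaced by
  an approximation before the limit is taken.\<close>

lemma pdet_case_nat_bound:
  assumes "sqsum a" "sqsum c"
  shows "cmod (pdet (Suc n) (case_nat b a) (case_nat w c) z - pdet n a c z)
    \<le> norm b * norm w * (2 * exp (cmod z * (hsi a c + 1)))"
proof -
  have "hs (Suc n) (case_nat 0 a) (case_nat 0 c) = hs n a c"
    unfolding hs_def by (subst sum.lessThan_Suc_shift) simp
  then have "cmod (pdet (Suc n) (case_nat b a) (case_nat w c) z - pdet n a c z)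
    \<le> norm b * norm w * (2 * exp (cmod z * (hs n a c + 1)))"
    using pdet_entry_bound[of 0 "Suc n" "case_nat b a" "case_nat w c" z]
    by (simp add: pdet_case_nat_0)
  also have "\<dots> \<le> norm b * norm w * (2 * exp (cmod z * (hsi a c + 1)))"
    using assms by (intro mult_left_mono) (auto intro!: mult_left_mono hs_le_hsi)
  finally show ?thesis .
qed

text \<open>At stage \<open>n\<close> the vector \<open>y\<close> solves the truncated equation with
  right side \<open>bn n\<close> instead of \<open>b\<close>, and for \<open>bn n\<close> the rank
  one formula is exact. The error comes from prepending \<open>b - bn n\<close>, which tends to
  zero.\<close>

lemma fdet_case_nat:
  assumes ac: "sqsum a" "sqsum c" and y: "y + z *\<^sub>C nuclear a c y = b"
  shows "fdet (case_nat b a) (case_nat w c) z = (1 + z * cinner w y) * fdet a c z"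
proof -
  define bn where "bn n = y + z *\<^sub>C (\<Sum>k<n. cinner (c k) y *\<^sub>C a k)" for n
  define C where "C = 2 * exp (cmod z * (hsi a c + 1))"
  have "bn \<longlonglongrightarrow> b"
    unfolding bn_def y[symmetric] using nuclear_sums[OF ac, of y]
    by (intro tendsto_intros bounded_linear.tendsto[OF bounded_linear_scaleC]) (simp add: sums_def)
  then have "(\<lambda>n. norm (b - bn n) * norm w * C) \<longlonglongrightarrow> norm (b - b) * norm w * C"
    by (intro tendsto_intros)
  moreover have "cmod (pdet (Suc n) (case_nat b a) (case_nat w c) z - (1 + z * cinner w y) * pdet n a c z)
      \<le> norm (b - bn n) * norm w * C" for n
  proof -
    have "pdet (Suc n) (case_nat (bn n + (b - bn n)) a) (case_nat w c) z - pdet n a c z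
      = (pdet (Suc n) (case_nat (bn n) a) (case_nat w c) z - pdet n a c z)
        + (pdet (Suc n) (case_nat (b - bn n) a) (case_nat w c) z - pdet n a c z)"
      using pdet_fun_upd_add[of 0 "Suc n" "case_nat b a" "bn n" "b - bn n" "case_nat w c" z]
      by (simp add: pdet_case_nat_0)
    moreover have "pdet (Suc n) (case_nat (bn n) a) (case_nat w c) z = (1 + z * cinner w y) * pdet n a c z"
      by (rule pdet_case_nat) (simp add: bn_def)
    ultimately have "pdet (Suc n) (case_nat b a) (case_nat w c) z - (1 + z * cinner w y) * pdet n a c z
      = pdet (Suc n) (case_nat (b - bn n) a) (case_nat w c) z - pdet n a c z"
      by (simp add: algebra_simps)
    then show ?thesis
      using pdet_case_nat_bound[OF ac, of n "b - bn n" w z] by (simp add: C_def)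
  qed
  ultimately have "(\<lambda>n. pdet (Suc n) (case_nat b a) (case_nat w c) z - (1 + z * cinner w y) * pdet n a c z) \<longlonglongrightarrow> 0"
    by (rule null_sequence_le) simp_all
  moreover have "(\<lambda>n. pdet (Suc n) (case_nat b a) (case_nat w c) z - (1 + z * cinner w y) * pdet n a c z)
    \<longlonglongrightarrow> fdet (case_nat b a) (case_nat w c) z - (1 + z * cinner w y) * fdet a c z"
    using ac by (intro tendsto_diff tendsto_mult tendsto_const LIMSEQ_Suc[OF pdet_tendsto] pdet_tendsto) auto
  ultimately have "fdet (case_nat b a) (case_nat w c) z - (1 + z * cinner w y) * fdet a c z = 0"
    by (rule LIMSEQ_unique[rotated])
  then show ?thesis
    by simp
qed

section \<open>Deflation of operators given by infinite sequences\<close>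

lemma sqsum_perp: "norm x = 1 \<Longrightarrow> sqsum a \<Longrightarrow> sqsum (\<lambda>k. perp x (a k))"
  by (erule sqsum_mono) (rule norm_perp_le)

lemma bounded_linear_perp: "bounded_linear (perp x)"
  unfolding perp_def
  by (intro bounded_linear_sub bounded_linear_ident
      bounded_linear_compose[OF bounded_linear_scaleC_left bounded_linear_cinner_right])

lemma nuclear_perp:
  assumes "sqsum a" "sqsum c" "norm x = 1"
  shows "nuclear (\<lambda>k. perp x (a k)) c y = perp x (nuclear a c y)"
proof -
  have "(\<lambda>k. perp x (cinner (c k) y *\<^sub>C a k)) sums perp x (nuclear a c y)"
    by (intro bounded_linear.sums[OF bounded_linear_perp] nuclear_sums assms)
  then show ?thesis
    unfolding nuclear_def[of "\<lambda>k. perp x (a k)"] by (simp add: perp_scaleC sums_iff)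
qed

text \<open>Projecting both families gives \<open>P K P\<close> with \<open>P = perp x\<close>. This
  equals \<open>P K\<close>, because \<open>K\<close> maps \<open>x\<close> to a multiple of itself,
  which \<open>P\<close> kills.\<close>

lemma nuclear_perp_perp:
  assumes "sqsum a" "sqsum c" "norm x = 1" "nuclear a c x = \<mu> *\<^sub>C x"
  shows "nuclear (\<lambda>k. perp x (a k)) (\<lambda>k. perp x (c k)) y = perp x (nuclear a c y)"
proof -
  have "cinner (perp x (c k)) y = cinner (c k) (perp x y)" for k
    by (simp add: perp_def cinner_algebra cinner_commute[of x "c k"])
  then have "nuclear (\<lambda>k. perp x (a k)) (\<lambda>k. perp x (c k)) y = nuclear (\<lambda>k. perp x (a k)) c (perp x y)"
    by (simp add: nuclear_def)
  also have "\<dots> = perp x (nuclear a c (perp x y))"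
    by (rule nuclear_perp[OF assms(1-3)])
  also have "nuclear a c (perp x y) = nuclear a c y - (cinner x y * \<mu>) *\<^sub>C x"
    using assms by (simp add: perp_def nuclear_diff nuclear_scaleC scaleC_scaleC)
  also have "perp x \<dots> = perp x (nuclear a c y)"
    using perp_add[of x "nuclear a c y - (cinner x y * \<mu>) *\<^sub>C x" "(cinner x y * \<mu>) *\<^sub>C x"] assms(3)
    by (simp add: perp_scaleC perp_self)
  finally show ?thesis .
qed

text \<open>The vector \<open>x\<close> is an eigenvector of the full operator but in general not of
  its truncations, so \<open>pdet_deflate\<close> cannot be used at stage \<open>n\<close>. The
  shear alone is exact there, with the partial sum \<open>wn n\<close> instead of \<open>w\<close>;
  the rank one formula is applied only after the limit.\<close>

lemma fdet_deflate:
  assumes ac: "sqsum a" "sqsum c" and x: "norm x = 1" and eig: "nuclear a c x = \<mu> *\<^sub>C x"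
  shows "fdet a c z = (1 + z * \<mu>) * fdet (\<lambda>k. perp x (a k)) (\<lambda>k. perp x (c k)) z"
proof -
  define a' where "a' = (\<lambda>k. perp x (a k))"
  have a': "sqsum a'"
    unfolding a'_def by (rule sqsum_perp[OF x ac(1)])
  define w where "w = nuclear c a x"
  define wn where "wn n = (\<Sum>k<n. cinner (a k) x *\<^sub>C c k)" for n
  define C where "C = 2 * exp (cmod z * (hsi a' c + 1))"
  have "wn \<longlonglongrightarrow> w"
    unfolding wn_def w_def using nuclear_sums[OF ac(2,1), of x] by (simp add: sums_def)
  then have "(\<lambda>n. norm x * norm (w - wn n) * C) \<longlonglongrightarrow> norm x * norm (w - w) * C"
    by (intro tendsto_intros)
  moreover have "cmod (pdet (Suc n) (case_nat x a') (case_nat w c) z - pdet n a c z)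
      \<le> norm x * norm (w - wn n) * C" for n
  proof -
    have "pdet (Suc n) (case_nat x a') (case_nat (wn n + (w - wn n)) c) z - pdet n a' c z
      = (pdet (Suc n) (case_nat x a') (case_nat (wn n) c) z - pdet n a' c z)
        + (pdet (Suc n) (case_nat x a') (case_nat (w - wn n) c) z - pdet n a' c z)"
      using pdet_fun_upd_add'[of 0 "Suc n" "case_nat x a'" "case_nat w c" "wn n" "w - wn n" z]
      by (simp add: pdet_case_nat_0')
    moreover have "pdet (Suc n) (case_nat x a') (case_nat (wn n) c) z = pdet n a c z"
      using pdet_shear[of n x a "\<lambda>k. cinner x (a k)" c z]
      by (simp add: a'_def perp_def wn_def cinner_commute[of _ x, symmetric])
    ultimately have "pdet (Suc n) (case_nat x a') (case_nat w c) z - pdet n a c z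
      = pdet (Suc n) (case_nat x a') (case_nat (w - wn n) c) z - pdet n a' c z"
      by (simp add: algebra_simps)
    then show ?thesis
      using pdet_case_nat_bound[OF a' ac(2), of n x "w - wn n" z] by (simp add: C_def)
  qed
  ultimately have "(\<lambda>n. pdet (Suc n) (case_nat x a') (case_nat w c) z - pdet n a c z) \<longlonglongrightarrow> 0"
    by (rule null_sequence_le) simp_all
  moreover have "(\<lambda>n. pdet (Suc n) (case_nat x a') (case_nat w c) z - pdet n a c z)
    \<longlonglongrightarrow> fdet (case_nat x a') (case_nat w c) z - fdet a c z"
    using ac a' by (intro tendsto_diff LIMSEQ_Suc[OF pdet_tendsto] pdet_tendsto) auto
  ultimately have "fdet (case_nat x a') (case_nat w c) z - fdet a c z = 0"
    by (rule LIMSEQ_unique[rotated])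
  then have "fdet a c z = fdet (case_nat x a') (case_nat w c) z"
    by simp
  also have "\<dots> = (1 + z * cinner w x) * fdet a' c z"
  proof (rule fdet_case_nat[OF a' ac(2)])
    show "x + z *\<^sub>C nuclear a' c x = x"
      using x by (simp add: a'_def nuclear_perp[OF ac x] eig perp_scaleC perp_self)
  qed
  also have "cinner w x = \<mu>"
    using x by (simp add: w_def cinner_nuclear[OF ac] eig cinner_scaleC_right cinner_self)
  also have "fdet a' c z = fdet a' (\<lambda>k. perp x (c k)) z"
    by (rule fdet_cong) (simp add: a'_def cinner_perp_perp x)
  finally show ?thesis
    by (simp add: a'_def)
qed

text \<open>The eigenvalue is \<open>cinner x (nuclear a c x)\<close>, a series that is estimated
  term by term.\<close>

lemma hsi_deflate:
  assumes ac: "sqsum a" "sqsum c" and x: "norm x = 1" and eig: "nuclear a c x = \<mu> *\<^sub>C x"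
  shows "cmod \<mu> \<le> hsi a c - hsi (\<lambda>k. perp x (a k)) (\<lambda>k. perp x (c k))"
proof -
  let ?f = "\<lambda>k. ((norm (a k))\<^sup>2 + (norm (c k))\<^sup>2) / 2 - ((norm (perp x (a k)))\<^sup>2 + (norm (perp x (c k)))\<^sup>2) / 2"
  have s: "summable ?f"
    using ac x by (intro summable_diff summable_hs sqsum_perp)
  have "(\<lambda>k. cinner x (cinner (c k) x *\<^sub>C a k)) sums cinner x (nuclear a c x)"
    by (intro bounded_linear.sums[OF bounded_linear_cinner_right] nuclear_sums ac)
  then have "(\<lambda>k. cinner (c k) x * cinner x (a k)) sums \<mu>"
    using x by (simp add: eig cinner_scaleC_right cinner_self)
  then have "cmod \<mu> = cmod (suminf (\<lambda>k. cinner (c k) x * cinner x (a k)))"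
    by (simp add: sums_iff)
  also have "\<dots> \<le> suminf ?f"
    by (intro norm_suminf_le s cinner_mult_le_perp x)
  also have "\<dots> = hsi a c - hsi (\<lambda>k. perp x (a k)) (\<lambda>k. perp x (c k))"
    unfolding hsi_def using ac x by (intro suminf_diff[symmetric] summable_hs sqsum_perp)
  finally show ?thesis .
qed

section \<open>Zeros of the entire determinant\<close>

lemma pdet_tendsto_columns:
  assumes "\<And>j. j < N \<Longrightarrow> (\<lambda>n. Y n j) \<longlonglongrightarrow> Z j"
  shows "(\<lambda>n. pdet N (Y n) c z) \<longlonglongrightarrow> pdet N Z c z"
proof -
  have *: "pdet N a c z = (\<Sum>p | p permutes {0..<N}. signof p *
      (\<Prod>i = 0..<N. (if i = p i then 1 else 0) + z * cinner (c i) (a (p i))))" for a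
    unfolding pdet_def by (subst Determinant.det_def')
      (auto simp: permutes_in_image intro!: sum.cong prod.cong)
  show ?thesis
    unfolding * using assms
    by (intro tendsto_intros bounded_linear.tendsto[OF bounded_linear_cinner_right])
      (auto simp: permutes_in_image)
qed

lemma nuclear_solve:
  assumes ac: "sqsum a" "sqsum c" and small: "cmod z * hsi a c \<le> 1 / 2"
  shows "\<exists>y. y + z *\<^sub>C nuclear a c y = b"
proof -
  have "dist (b - z *\<^sub>C nuclear a c x) (b - z *\<^sub>C nuclear a c y) \<le> 1 / 2 * dist x y" for x y
  proof -
    have "dist (b - z *\<^sub>C nuclear a c x) (b - z *\<^sub>C nuclear a c y) = norm (z *\<^sub>C nuclear a c (y - x))"
      by (simp add: dist_norm nuclear_diff[OF ac] scaleC_algebra)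
    also have "\<dots> \<le> cmod z * (hsi a c * norm (y - x))"
      by (simp add: norm_scaleC mult_left_mono norm_nuclear_le[OF ac])
    also have "\<dots> \<le> 1 / 2 * norm (y - x)"
      using mult_right_mono[OF small, of "norm (y - x)"] by (simp add: mult.assoc)
    finally show ?thesis
      by (simp add: dist_norm norm_minus_commute)
  qed
  then have "\<exists>!y. b - z *\<^sub>C nuclear a c y = y"
    by (intro banach_fix_type[where c = "1 / 2"]) auto
  then show ?thesis
    by (metis diff_add_cancel)
qed

lemma nuclear_truncate:
  "nuclear (\<lambda>k. if k < n then a k else 0) c x = (\<Sum>k<n. cinner (c k) x *\<^sub>C a k)"
proof -
  have "(\<lambda>k. cinner (c k) x *\<^sub>C (if k < n then a k else 0))
    sums (\<Sum>k<n. cinner (c k) x *\<^sub>C (if k < n then a k else 0))"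
    by (rule sums_finite) auto
  then show ?thesis
    by (simp add: nuclear_def sums_iff)
qed

lemma nuclear_split:
  assumes "sqsum a" "sqsum c"
  shows "nuclear a c x = (\<Sum>k<N. cinner (c k) x *\<^sub>C a k) + nuclear (\<lambda>k. a (N + k)) (\<lambda>k. c (N + k)) x"
  using suminf_split_initial_segment[OF sums_summable[OF nuclear_sums[OF assms, of x]], of N]
  by (simp add: nuclear_def add.commute)

text \<open>The limit of \<open>pdet_block\<close> with an infinite tail. Smallness makes
  \<open>Id + z K\<close> invertible for the tail and for all its truncations, with inverses of norm
  at most 2, so the truncated solutions \<open>Z n j\<close> tend to \<open>Y j\<close>.\<close>

lemma fdet_block:
  assumes ac: "sqsum a" "sqsum c"
    and small: "cmod z * hsi (\<lambda>k. a (N + k)) (\<lambda>k. c (N + k)) \<le> 1 / 2"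
    and Y: "\<And>j. Y j + z *\<^sub>C nuclear (\<lambda>k. a (N + k)) (\<lambda>k. c (N + k)) (Y j) = a j"
  shows "fdet a c z = pdet N Y c z * fdet (\<lambda>k. a (N + k)) (\<lambda>k. c (N + k)) z"
proof -
  define a' c' where "a' = (\<lambda>k. a (N + k))" and "c' = (\<lambda>k. c (N + k))"
  have ac': "sqsum a'" "sqsum c'"
    using ac by (simp_all add: a'_def c'_def)
  define an where "an n k = (if k < n then a' k else 0)" for n k
  have an: "sqsum (an n)" for n
    by (rule sqsum_mono[OF ac'(1)]) (simp add: an_def)
  have "hsi (an n) c' \<le> hsi a' c'" for n
    by (rule hsi_mono[OF ac']) (auto simp: an_def)
  then have small': "cmod z * hsi (an n) c' \<le> 1 / 2" for n
    by (rule order.trans[OF mult_left_mono[OF _ norm_ge_zero] small[folded a'_def c'_def]])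
  have nuclear_an: "nuclear (an n) c' x = (\<Sum>k<n. cinner (c' k) x *\<^sub>C a' k)" for n x
    unfolding an_def by (rule nuclear_truncate)
  define Z where "Z n j = (SOME y. y + z *\<^sub>C nuclear (an n) c' y = a j)" for n j
  have Z: "Z n j + z *\<^sub>C nuclear (an n) c' (Z n j) = a j" for n j
    unfolding Z_def by (rule someI_ex) (rule nuclear_solve[OF an ac'(2) small'])
  have "(\<lambda>n. Z n j) \<longlonglongrightarrow> Y j" for j
  proof -
    define e where "e n = z *\<^sub>C (nuclear a' c' (Y j) - nuclear (an n) c' (Y j))" for n
    have "e \<longlonglongrightarrow> z *\<^sub>C (nuclear a' c' (Y j) - nuclear a' c' (Y j))"
      unfolding e_def nuclear_an using nuclear_sums[OF ac', of "Y j"]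
      by (intro tendsto_intros bounded_linear.tendsto[OF bounded_linear_scaleC]) (simp add: sums_def)
    then have "(\<lambda>n. 2 * norm (e n)) \<longlonglongrightarrow> 2 * norm (z *\<^sub>C (nuclear a' c' (Y j) - nuclear a' c' (Y j)))"
      by (intro tendsto_intros)
    \<comment> \<open>The error term contains half of the difference itself, which is absorbed into
      the left side.\<close>
    moreover have "norm (Z n j - Y j) \<le> 2 * norm (e n)" for n
    proof -
      have "Z n j + z *\<^sub>C nuclear (an n) c' (Z n j) = Y j + z *\<^sub>C nuclear a' c' (Y j)"
        using Z Y by (simp add: a'_def c'_def)
      then have "Z n j - Y j = e n - z *\<^sub>C nuclear (an n) c' (Z n j - Y j)"
        by (simp add: e_def nuclear_diff[OF an ac'(2)] scaleC_algebra algebra_simps)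
      then have "norm (Z n j - Y j) \<le> norm (e n) + norm (z *\<^sub>C nuclear (an n) c' (Z n j - Y j))"
        by (metis norm_triangle_ineq4)
      also have "norm (z *\<^sub>C nuclear (an n) c' (Z n j - Y j)) \<le> cmod z * (hsi (an n) c' * norm (Z n j - Y j))"
        by (simp add: norm_scaleC mult_left_mono norm_nuclear_le[OF an ac'(2)])
      also have "\<dots> \<le> 1 / 2 * norm (Z n j - Y j)"
        using mult_right_mono[OF small', of "norm (Z n j - Y j)"] by (simp add: mult.assoc)
      finally show ?thesis by simp
    qed
    ultimately have "(\<lambda>n. Z n j - Y j) \<longlonglongrightarrow> 0"
      by (rule null_sequence_le) simp_all
    then show ?thesis
      by (simp add: LIM_zero_iff)
  qed
  then have "(\<lambda>n. pdet N (Z n) c z * pdet n a' c' z) \<longlonglongrightarrow> pdet N Y c z * fdet a' c' z"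
    by (intro tendsto_mult pdet_tendsto_columns pdet_tendsto ac')
  moreover have "pdet (N + n) a c z = pdet N (Z n) c z * pdet n a' c' z" for n
    unfolding a'_def c'_def
    by (rule pdet_block) (use Z in \<open>simp add: nuclear_an[unfolded a'_def c'_def, symmetric] c'_def\<close>)
  ultimately have "(\<lambda>n. pdet (N + n) a c z) \<longlonglongrightarrow> pdet N Y c z * fdet a' c' z"
    by simp
  moreover have "(\<lambda>n. pdet (N + n) a c z) \<longlonglongrightarrow> fdet a c z"
    using LIMSEQ_ignore_initial_segment[OF pdet_tendsto[OF ac], of N] by (simp add: add.commute)
  ultimately show ?thesis
    using LIMSEQ_unique by (auto simp: a'_def c'_def)
qed

text \<open>A form of the Fredholm alternative. The tail is made so small that its determinant
  differs from 1 by at most \<open>exp (1 / 2) - 1 < 1\<close> and hence is not zero. By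
  \<open>fdet_block\<close> the finite determinant of the solutions \<open>Y j\<close> must vanish,
  and a finite determinant has a null vector.\<close>

lemma fdet_root_eigenvector:
  assumes ac: "sqsum a" "sqsum c" and "fdet a c z = 0"
  obtains v where "v \<noteq> 0" "v + z *\<^sub>C nuclear a c v = 0"
proof -
  \<comment> \<open>Chosen so that \<open>cmod z * e\<close> is at most \<open>1 / 2\<close>; the
    summand 1 allows for \<open>z = 0\<close>.\<close>
  define e where "e = 1 / (2 * (cmod z + 1))"
  have "e > 0"
    by (simp add: e_def add_nonneg_pos)
  then obtain N where N: "norm (suminf (\<lambda>i. ((norm (a (i + N)))\<^sup>2 + (norm (c (i + N)))\<^sup>2) / 2)) < e"
    using suminf_exist_split[OF _ summable_hs[OF ac], of e] by blast
  define a' c' where "a' = (\<lambda>k. a (N + k))" and "c' = (\<lambda>k. c (N + k))"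
  have ac': "sqsum a'" "sqsum c'"
    using ac by (simp_all add: a'_def c'_def)
  have "hsi a' c' \<le> e"
    using N by (simp add: hsi_def a'_def c'_def add.commute)
  then have "cmod z * hsi a' c' \<le> (cmod z + 1) * e"
    using hsi_nonneg[OF ac'] by (intro mult_mono) auto
  also have "\<dots> = 1 / 2"
  proof -
    have "cmod z + 1 > 0"
      using norm_ge_zero[of z] by linarith
    then show ?thesis
      by (simp add: e_def)
  qed
  finally have small: "cmod z * hsi a' c' \<le> 1 / 2" .
  define Y where "Y j = (SOME y. y + z *\<^sub>C nuclear a' c' y = a j)" for j
  have Y: "Y j + z *\<^sub>C nuclear a' c' (Y j) = a j" for j
    unfolding Y_def by (rule someI_ex) (rule nuclear_solve[OF ac' small])
  have "fdet a' c' z \<noteq> 0"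
  proof
    assume "fdet a' c' z = 0"
    have "cmod (pdet n a' c' z - 1) \<le> exp (1 / 2) - 1" for n
    proof -
      have "cmod z * hs n a' c' \<le> 1 / 2"
        by (rule order.trans[OF mult_left_mono[OF hs_le_hsi[OF ac'] norm_ge_zero] small])
      then have "exp (cmod z * hs n a' c') - 1 \<le> exp (1 / 2) - 1"
        by simp
      then show ?thesis
        by (rule order.trans[OF norm_pdet_minus_1_le])
    qed
    moreover have "(\<lambda>n. cmod (pdet n a' c' z - 1)) \<longlonglongrightarrow> cmod (fdet a' c' z - 1)"
      by (intro tendsto_intros pdet_tendsto ac')
    ultimately have "cmod (fdet a' c' z - 1) \<le> exp (1 / 2) - 1"
      by (intro LIMSEQ_le_const2) auto
    moreover have "exp (1 / 2 :: real) < 2"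
    proof (rule power_less_imp_less_base)
      have "exp (1 / 2 :: real) ^ 2 = exp 1"
        using exp_double[of "1 / 2 :: real"] by simp
      then show "exp (1 / 2 :: real) ^ 2 < 2 ^ 2"
        using exp_le by simp
    qed simp
    ultimately show False
      using \<open>fdet a' c' z = 0\<close> by simp
  qed
  then have "pdet N Y c z = 0"
    using fdet_block[OF ac small[unfolded a'_def c'_def] Y[unfolded a'_def c'_def]] assms(3)
    by (simp add: a'_def c'_def)
  then obtain v where v: "v \<noteq> 0" "v + z *\<^sub>C (\<Sum>k<N. cinner (c k) v *\<^sub>C Y k) = 0"
    by (rule pdet_root_eigenvector)
  \<comment> \<open>The map \<open>h\<close> takes \<open>Y k\<close> to \<open>a k\<close>. Applied
    to the equation for \<open>v\<close> it therefore restores the original vectors of the head and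
    adds the tail.\<close>
  define h where "h x = x + z *\<^sub>C nuclear a' c' x" for x
  have h_add: "h (x + y) = h x + h y" for x y
    by (simp add: h_def nuclear_add[OF ac'] scaleC_add_right algebra_simps)
  have h_scale: "h (t *\<^sub>C x) = t *\<^sub>C h x" for t x
    by (simp add: h_def nuclear_scaleC[OF ac'] scaleC_algebra mult.commute)
  have h0: "h 0 = 0"
    using h_scale[of 0 0] by simp
  have h_sum: "h (sum f I) = (\<Sum>i\<in>I. h (f i))" for f and I :: "nat set"
    by (induction I rule: infinite_finite_induct) (simp_all add: h_add h0)
  have "h v + z *\<^sub>C (\<Sum>k<N. cinner (c k) v *\<^sub>C h (Y k)) = h (v + z *\<^sub>C (\<Sum>k<N. cinner (c k) v *\<^sub>C Y k))"
    by (simp add: h_add h_scale h_sum)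
  also have "\<dots> = 0"
    by (simp only: v h0)
  finally have "h v + z *\<^sub>C (\<Sum>k<N. cinner (c k) v *\<^sub>C a k) = 0"
    by (simp only: h_def Y)
  moreover have "nuclear a c v = (\<Sum>k<N. cinner (c k) v *\<^sub>C a k) + nuclear a' c' v"
    unfolding a'_def c'_def by (rule nuclear_split[OF ac])
  ultimately have "v + z *\<^sub>C nuclear a c v = 0"
    by (simp add: h_def scaleC_add_right add_ac)
  with v(1) show thesis
    by (rule that)
qed

subsection \<open>Algebraic multiplicities\<close>

definition gen_null :: "('v::complex_vector \<Rightarrow> 'v) \<Rightarrow> 'v set"
  where "gen_null S = {x. \<exists>n. (S ^^ n) x = 0}"

text \<open>The number \<open>complex_vector.dim U\<close> is 0 for spaces of infinite dimension
  too; this predicate also asserts that a finite basis exists.\<close>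

definition has_dim :: "'v::complex_vector set \<Rightarrow> nat \<Rightarrow> bool"
  where "has_dim U m \<longleftrightarrow> (\<exists>B. finite B \<and> \<not> complex_vector.dependent B \<and>
    complex_vector.span B = U \<and> card B = m)"

lemma has_dim_imp_dim: "has_dim U m \<Longrightarrow> complex_vector.dim U = m"
  unfolding has_dim_def by (metis complex_vector.dim_eq_card complex_vector.span_span)

lemma has_dim_insert:
  assumes "has_dim U m" "x \<notin> U"
  shows "has_dim {y. \<exists>t. y - t *\<^sub>C x \<in> U} (Suc m)"
proof -
  obtain B where B: "finite B" "\<not> complex_vector.dependent B" "complex_vector.span B = U" "card B = m"
    using assms(1) by (auto simp: has_dim_def)
  have "x \<notin> B"
    using B(3) assms(2) complex_vector.span_base by blast
  then show ?thesis
    unfolding has_dim_def using B assms(2)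
    by (intro exI[of _ "insert x B"])
      (simp add: complex_vector.independent_insert complex_vector.span_insert)
qed

lemma has_dim_remove:
  assumes W: "has_dim {y. \<exists>t. y - t *\<^sub>C x \<in> U} (Suc m)" and "x \<notin> U" and U: "complex_vector.subspace U"
  shows "has_dim U m"
proof -
  define W where "W = {y. \<exists>t. y - t *\<^sub>C x \<in> U}"
  obtain C where C: "finite C" "complex_vector.span C = W"
    using W by (auto simp: has_dim_def W_def)
  obtain B where B: "B \<subseteq> U" "\<not> complex_vector.dependent B" "U \<subseteq> complex_vector.span B"
    using complex_vector.maximal_independent_subset[of U] by blast
  then have sB: "complex_vector.span B = U"
    using U complex_vector.span_minimal by blast
  have "U \<subseteq> W"
    unfolding W_def by (auto intro: exI[of _ 0])
  then have fB: "finite B"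
    using complex_vector.independent_span_bound[OF C(1) B(2)] B(1) C(2) by blast
  have "x \<notin> B"
    using B(1) assms(2) by blast
  have "\<not> complex_vector.dependent (insert x B)" "complex_vector.span (insert x B) = W"
    using B sB assms(2) \<open>x \<notin> B\<close>
    by (simp_all add: complex_vector.independent_insert complex_vector.span_insert W_def)
  then have "complex_vector.dim W = card (insert x B)"
    by (metis complex_vector.dim_eq_card complex_vector.span_span)
  moreover have "complex_vector.dim W = Suc m"
    using has_dim_imp_dim[OF W] by (simp add: W_def)
  ultimately have "card B = m"
    using fB \<open>x \<notin> B\<close> by simp
  then show ?thesis
    unfolding has_dim_def using fB B sB by blast
qed

lemma clinear_funpow:
  fixes S :: "'v::complex_vector \<Rightarrow> 'v"
  assumes "clinear_on UNIV S"
  shows "(S ^^ n) (x + y) = (S ^^ n) x + (S ^^ n) y" "(S ^^ n) (t *\<^sub>C x) = t *\<^sub>C (S ^^ n) x" "(S ^^ n) 0 = 0"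
proof -
  show "(S ^^ n) (x + y) = (S ^^ n) x + (S ^^ n) y"
    using assms by (induction n) (simp_all add: clinear_on_def)
  show *: "(S ^^ n) (t *\<^sub>C x) = t *\<^sub>C (S ^^ n) x" for t x
    using assms by (induction n) (simp_all add: clinear_on_def)
  show "(S ^^ n) 0 = 0"
    using *[of 0 0] by simp
qed

lemma subspace_gen_null:
  assumes "clinear_on UNIV S"
  shows "complex_vector.subspace (gen_null S)"
proof (rule complex_vector.subspaceI)
  show "0 \<in> gen_null S"
    by (auto simp: gen_null_def intro: exI[of _ 0])
  fix x assume "x \<in> gen_null S"
  then obtain n where n: "(S ^^ n) x = 0"
    by (auto simp: gen_null_def)
  then show "t *\<^sub>C x \<in> gen_null S" for t
    by (auto simp: gen_null_def clinear_funpow[OF assms] intro: exI[of _ n])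
  fix y assume "y \<in> gen_null S"
  then obtain m where m: "(S ^^ m) y = 0"
    by (auto simp: gen_null_def)
  have "(S ^^ (m + n)) x = 0"
    using n by (simp add: funpow_add clinear_funpow[OF assms])
  moreover have "(S ^^ (m + n)) y = 0"
    using m by (subst add.commute) (simp add: funpow_add clinear_funpow[OF assms])
  ultimately have "(S ^^ (m + n)) (x + y) = 0"
    by (simp add: clinear_funpow[OF assms])
  then show "x + y \<in> gen_null S"
    unfolding gen_null_def by blast
qed

lemma funpow_eigenvector:
  assumes "clinear_on UNIV S" "S x = \<sigma> *\<^sub>C x"
  shows "(S ^^ n) x = \<sigma> ^ n *\<^sub>C x"
  using assms by (induction n) (simp_all add: clinear_on_def scaleC_scaleC mult.commute)

text \<open>The left side consists of the vectors that become generalized null vectors modulo the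
  line of \<open>x\<close>. If \<open>\<sigma> = 0\<close>, one more application of \<open>S\<close>
  removes the remaining multiple of \<open>x\<close>. Otherwise \<open>S\<close> is invertible on
  that line, and \<open>y\<close> is corrected by \<open>t / \<sigma> ^ n\<close> times
  \<open>x\<close>.\<close>

lemma gen_null_mod_eigenvector:
  assumes S: "clinear_on UNIV S" and x: "S x = \<sigma> *\<^sub>C x" "x \<noteq> 0"
  shows "{y. \<exists>n t. (S ^^ n) y = t *\<^sub>C x} = (if \<sigma> = 0 then gen_null S else {y. \<exists>t. y - t *\<^sub>C x \<in> gen_null S})"
    and "\<sigma> \<noteq> 0 \<Longrightarrow> x \<notin> gen_null S"
proof -
  have *: "(S ^^ n) (y - t *\<^sub>C x) = (S ^^ n) y - (t * \<sigma> ^ n) *\<^sub>C x" for n t y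
    using clinear_funpow(1)[OF S, of n y "(- t) *\<^sub>C x"] clinear_funpow(2)[OF S, of n "- t" x]
    by (simp add: funpow_eigenvector[OF S x(1)] scaleC_scaleC)
  show "\<sigma> \<noteq> 0 \<Longrightarrow> x \<notin> gen_null S"
    using x(2) by (auto simp: gen_null_def funpow_eigenvector[OF S x(1)] complex_vector.scale_eq_0_iff)
  show "{y. \<exists>n t. (S ^^ n) y = t *\<^sub>C x} = (if \<sigma> = 0 then gen_null S else {y. \<exists>t. y - t *\<^sub>C x \<in> gen_null S})"
  proof (cases "\<sigma> = 0")
    case True
    have "y \<in> gen_null S" if "(S ^^ n) y = t *\<^sub>C x" for y n t
    proof -
      have "(S ^^ Suc n) y = t *\<^sub>C S x"
        using that S by (simp add: clinear_on_def)
      then have "(S ^^ Suc n) y = 0"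
        using True x by simp
      then show ?thesis
        unfolding gen_null_def by blast
    qed
    moreover have "\<exists>n t. (S ^^ n) y = t *\<^sub>C x" if "y \<in> gen_null S" for y
    proof -
      obtain n where "(S ^^ n) y = 0 *\<^sub>C x"
        using \<open>y \<in> gen_null S\<close> by (auto simp: gen_null_def)
      then show ?thesis by blast
    qed
    ultimately show ?thesis
      using True by auto
  next
    case False
    have "\<exists>s. y - s *\<^sub>C x \<in> gen_null S" if "(S ^^ n) y = t *\<^sub>C x" for y n t
      using that False
      by (intro exI[of _ "t / \<sigma> ^ n"]) (auto simp: gen_null_def * intro!: exI[of _ n])
    moreover have "\<exists>n t. (S ^^ n) y = t *\<^sub>C x" if "y - s *\<^sub>C x \<in> gen_null S" for y s
      using that by (auto simp: gen_null_def *)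
    ultimately show ?thesis
      using False by auto
  qed
qed

text \<open>Since \<open>S'\<close> maps the line of \<open>x\<close> into itself, the powers of
  \<open>S\<close> and \<open>S'\<close> also differ only by multiples of \<open>x\<close>.\<close>

lemma mod_eigenvector_cong:
  assumes S: "clinear_on UNIV S" "clinear_on UNIV S'" and x: "S' x = \<sigma> *\<^sub>C x"
    and diff: "\<And>y. \<exists>t. S' y = S y + t *\<^sub>C x"
  shows "(\<exists>n t. (S ^^ n) y = t *\<^sub>C x) \<longleftrightarrow> (\<exists>n t. (S' ^^ n) y = t *\<^sub>C x)"
proof -
  have *: "\<exists>t. (S' ^^ n) y = (S ^^ n) y + t *\<^sub>C x" for n
  proof (induction n)
    case 0
    show ?case by (auto intro: exI[of _ 0])
  next
    case (Suc n)
    then obtain t where t: "(S' ^^ n) y = (S ^^ n) y + t *\<^sub>C x"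
      by blast
    obtain s where s: "S' ((S ^^ n) y) = S ((S ^^ n) y) + s *\<^sub>C x"
      using diff by blast
    have "(S' ^^ Suc n) y = (S ^^ Suc n) y + (s + t * \<sigma>) *\<^sub>C x"
      using S(2) by (simp add: t clinear_on_def s x scaleC_add_left scaleC_scaleC)
    then show ?case by blast
  qed
  show ?thesis
  proof safe
    fix n t assume "(S ^^ n) y = t *\<^sub>C x"
    then show "\<exists>n t. (S' ^^ n) y = t *\<^sub>C x"
      using *[of n] by (metis scaleC_add_left)
  next
    fix n t assume 1: "(S' ^^ n) y = t *\<^sub>C x"
    obtain s where "(S' ^^ n) y = (S ^^ n) y + s *\<^sub>C x"
      using * by blast
    then have "(S ^^ n) y = (t - s) *\<^sub>C x"
      using 1 by (simp add: complex_vector.scale_left_diff_distrib)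
    then show "\<exists>n t. (S ^^ n) y = t *\<^sub>C x"
      by blast
  qed
qed

text \<open>\<open>K\<close> and its deflation \<open>K'\<close> induce the same operator modulo the eigenvector \<open>x\<close>.\<close>

lemma has_dim_deflate:
  assumes K: "clinear_on UNIV K" "clinear_on UNIV K'" and x: "x \<noteq> 0" "K x = \<mu> *\<^sub>C x" "K' x = 0"
    and diff: "\<And>y. \<exists>t. K' y = K y + t *\<^sub>C x" and "\<nu> \<noteq> 0"
    and dim: "has_dim (gen_null (\<lambda>y. K' y - \<nu> *\<^sub>C y)) m"
  shows "has_dim (gen_null (\<lambda>y. K y - \<nu> *\<^sub>C y)) (if \<nu> = \<mu> then Suc m else m)"
proof -
  define S S' where "S = (\<lambda>y. K y - \<nu> *\<^sub>C y)" and "S' = (\<lambda>y. K' y - \<nu> *\<^sub>C y)"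
  have S: "clinear_on UNIV S" "clinear_on UNIV S'"
    using K by (auto simp: S_def S'_def clinear_on_def scaleC_algebra mult.commute)
  \<comment> \<open>The eigenvalue of \<open>x\<close> is \<open>- \<nu> \<noteq> 0\<close> for
    \<open>S'\<close>, so the set \<open>W\<close> below is the generalized kernel of
    \<open>S'\<close> enlarged by the line of \<open>x\<close>. For \<open>S\<close> the eigenvalue
    is \<open>\<mu> - \<nu>\<close>: if \<open>\<nu> = \<mu>\<close>, the line already lies in the
    generalized kernel and counts, otherwise it has to be removed again.\<close>
  have Sx: "S x = (\<mu> - \<nu>) *\<^sub>C x" "S' x = (- \<nu>) *\<^sub>C x"
    using x by (simp_all add: S_def S'_def complex_vector.scale_left_diff_distrib)
  have "\<exists>t. S' y = S y + t *\<^sub>C x" for y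
    using diff[of y] by (auto simp: S_def S'_def)
  then have W: "{y. \<exists>n t. (S ^^ n) y = t *\<^sub>C x} = {y. \<exists>n t. (S' ^^ n) y = t *\<^sub>C x}"
    using mod_eigenvector_cong[OF S Sx(2)] by blast
  also have "\<dots> = {y. \<exists>t. y - t *\<^sub>C x \<in> gen_null S'}"
    using gen_null_mod_eigenvector(1)[OF S(2) Sx(2) x(1)] \<open>\<nu> \<noteq> 0\<close> by simp
  finally have "has_dim {y. \<exists>n t. (S ^^ n) y = t *\<^sub>C x} (Suc m)"
    using has_dim_insert dim gen_null_mod_eigenvector(2)[OF S(2) Sx(2) x(1)] \<open>\<nu> \<noteq> 0\<close>
    by (simp add: S'_def)
  then have "has_dim (gen_null S) (if \<nu> = \<mu> then Suc m else m)"
    using gen_null_mod_eigenvector[OF S(1) Sx(1) x(1)] has_dim_remove[OF _ _ subspace_gen_null[OF S(1)]]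
    by (auto split: if_splits)
  then show ?thesis
    by (simp add: S_def)
qed

lemma gen_null_nontrivial:
  fixes S :: "'v::complex_vector \<Rightarrow> 'v"
  assumes "clinear_on UNIV S" "y \<in> gen_null S" "y \<noteq> 0"
  obtains x where "x \<noteq> 0" "S x = 0"
proof -
  obtain n where "(S ^^ n) y = 0"
    using assms(2) by (auto simp: gen_null_def)
  then have "\<exists>x. x \<noteq> 0 \<and> S x = 0"
    using assms(3)
  proof (induction n arbitrary: y)
    case (Suc n)
    show ?case
    proof (cases "S y = 0")
      case False
      then show ?thesis
        using Suc.IH[of "S y"] Suc.prems by (simp add: funpow_swap1)
    qed (use Suc.prems in blast)
  qed simp
  then show thesis
    using that by blast
qed

lemma alg_mult_eq: "has_dim (gen_null (\<lambda>y. K y - \<mu> *\<^sub>C y)) m \<Longrightarrow> alg_mult K \<mu> = m"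
  unfolding alg_mult_def gen_null_def[symmetric] by (rule has_dim_imp_dim)

lemma has_dim_pos_iff_eigenvalue:
  assumes K: "clinear_on UNIV K" and "has_dim (gen_null (\<lambda>y. K y - \<mu> *\<^sub>C y)) m"
  shows "0 < m \<longleftrightarrow> eigenvalue K \<mu>"
proof -
  have S: "clinear_on UNIV (\<lambda>y. K y - \<mu> *\<^sub>C y)"
    using K by (auto simp: clinear_on_def scaleC_algebra mult.commute)
  obtain B where B: "finite B" "\<not> complex_vector.dependent B"
    "complex_vector.span B = gen_null (\<lambda>y. K y - \<mu> *\<^sub>C y)" "card B = m"
    using assms by (auto simp: has_dim_def)
  show ?thesis
  proof
    assume "0 < m"
    then obtain b where "b \<in> B"
      using B by fastforce
    then have "b \<in> gen_null (\<lambda>y. K y - \<mu> *\<^sub>C y)" "b \<noteq> 0"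
      using B complex_vector.span_base complex_vector.dependent_zero by blast+
    then obtain x where "x \<noteq> 0" "K x - \<mu> *\<^sub>C x = 0"
      using gen_null_nontrivial[OF S] by blast
    then show "eigenvalue K \<mu>"
      by (auto simp: eigenvalue_def)
  next
    assume "eigenvalue K \<mu>"
    then obtain x where "x \<noteq> 0" "K x = \<mu> *\<^sub>C x"
      by (auto simp: eigenvalue_def)
    then have "x \<in> complex_vector.span B"
      unfolding B(3) gen_null_def by (auto intro!: exI[of _ 1])
    then have "B \<noteq> {}"
      using \<open>x \<noteq> 0\<close> by auto
    then show "0 < m"
      using B(1) card_gt_0_iff unfolding B(4)[symmetric] by blast
  qed
qed

lemma has_dim_no_eigenvalue:
  assumes K: "clinear_on UNIV K" and "\<not> eigenvalue K \<mu>"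
  shows "has_dim (gen_null (\<lambda>y. K y - \<mu> *\<^sub>C y)) 0"
proof -
  have S: "clinear_on UNIV (\<lambda>y. K y - \<mu> *\<^sub>C y)"
    using K by (auto simp: clinear_on_def scaleC_algebra mult.commute)
  have "gen_null (\<lambda>y. K y - \<mu> *\<^sub>C y) = {0}"
    using gen_null_nontrivial[OF S] assms(2) complex_vector.subspace_0[OF subspace_gen_null[OF S]]
    by (auto simp: eigenvalue_def)
  then show ?thesis
    unfolding has_dim_def by (intro exI[of _ "{}"]) (simp add: complex_vector.independent_empty)
qed

section \<open>Splitting off all eigenvectors of finitely many eigenvalues\<close>

lemma clinear_nuclear: "sqsum a \<Longrightarrow> sqsum c \<Longrightarrow> clinear_on UNIV (nuclear a c)"
  by (simp add: clinear_on_def nuclear_add nuclear_scaleC)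

abbreviation nuclear_dim :: "(nat \<Rightarrow> 'h::complex_hilbert) \<Rightarrow> (nat \<Rightarrow> 'h) \<Rightarrow> complex \<Rightarrow> nat \<Rightarrow> bool"
  where "nuclear_dim a c \<mu> \<equiv> has_dim (gen_null (\<lambda>y. nuclear a c y - \<mu> *\<^sub>C y))"

text \<open>Deflation is repeated until \<nu> is no eigenvalue any more; each step lowers
  \<open>hsi\<close> by at least \<open>cmod \<nu>\<close>, which bounds the number of steps.
  Multiplicities are found backwards: at the end the generalized kernel for \<nu> is zero, and
  undoing one step raises its dimension by one while leaving those for other nonzero numbers
  unchanged.\<close>

lemma nuclear_deflate_eigenvalue:
  fixes a c :: "nat \<Rightarrow> 'h::complex_hilbert"
  assumes "sqsum a" "sqsum c" "\<nu> \<noteq> 0"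
  shows "\<exists>m (a' :: nat \<Rightarrow> 'h) (c' :: nat \<Rightarrow> 'h). (\<forall>k. norm (a' k) \<le> norm (a k)) \<and> (\<forall>k. norm (c' k) \<le> norm (c k)) \<and>
    (\<forall>z. fdet a c z = (1 + z * \<nu>) ^ m * fdet a' c' z) \<and> hsi a' c' + m * cmod \<nu> \<le> hsi a c \<and>
    nuclear_dim a c \<nu> m \<and> \<not> eigenvalue (nuclear a' c') \<nu> \<and>
    (\<forall>\<mu> m'. \<mu> \<noteq> \<nu> \<longrightarrow> \<mu> \<noteq> 0 \<longrightarrow> nuclear_dim a' c' \<mu> m' \<longrightarrow> nuclear_dim a c \<mu> m')"
  using assms(1,2)
proof (induction "nat \<lfloor>hsi a c / cmod \<nu>\<rfloor>" arbitrary: a c rule: less_induct)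
  case (less a c)
  note ac = less.prems
  show ?case
  proof (cases "eigenvalue (nuclear a c) \<nu>")
    case False
    show ?thesis
      by (rule exI[of _ 0], rule exI[of _ a], rule exI[of _ c])
        (simp add: has_dim_no_eigenvalue[OF clinear_nuclear[OF ac] False] False)
  next
    case True
    then obtain v where v: "v \<noteq> 0" "nuclear a c v = \<nu> *\<^sub>C v"
      by (auto simp: eigenvalue_def)
    define x where "x = complex_of_real (inverse (norm v)) *\<^sub>C v"
    have x: "norm x = 1"
      using v by (simp add: x_def norm_scaleC norm_inverse)
    then have x0: "x \<noteq> 0"
      by auto
    have eig: "nuclear a c x = \<nu> *\<^sub>C x"
      using v by (simp add: x_def nuclear_scaleC[OF ac] scaleC_scaleC mult.commute)
    define a1 c1 where "a1 = (\<lambda>k. perp x (a k))" and "c1 = (\<lambda>k. perp x (c k))"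
    have ac1: "sqsum a1" "sqsum c1"
      using ac x by (simp_all add: a1_def c1_def sqsum_perp)
    have le: "norm (a1 k) \<le> norm (a k)" "norm (c1 k) \<le> norm (c k)" for k
      using x by (simp_all add: a1_def c1_def norm_perp_le)
    have nuclear1: "nuclear a1 c1 y = perp x (nuclear a c y)" for y
      unfolding a1_def c1_def by (rule nuclear_perp_perp[OF ac x eig])
    have hsi: "cmod \<nu> \<le> hsi a c - hsi a1 c1"
      unfolding a1_def c1_def by (rule hsi_deflate[OF ac x eig])
    then have "(hsi a1 c1 + cmod \<nu>) / cmod \<nu> \<le> hsi a c / cmod \<nu>"
      by (intro divide_right_mono) auto
    then have "hsi a1 c1 / cmod \<nu> + 1 \<le> hsi a c / cmod \<nu>"
      using assms(3) by (simp add: add_divide_distrib)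
    moreover have "0 \<le> hsi a1 c1 / cmod \<nu>"
      using hsi_nonneg[OF ac1] by simp
    ultimately have "nat \<lfloor>hsi a1 c1 / cmod \<nu>\<rfloor> < nat \<lfloor>hsi a c / cmod \<nu>\<rfloor>"
      by linarith
    from less.hyps[OF this ac1] obtain m and a' c' :: "nat \<Rightarrow> 'h" where
      IH: "\<forall>k. norm (a' k) \<le> norm (a1 k)" "\<forall>k. norm (c' k) \<le> norm (c1 k)"
      "\<forall>z. fdet a1 c1 z = (1 + z * \<nu>) ^ m * fdet a' c' z" "hsi a' c' + m * cmod \<nu> \<le> hsi a1 c1"
      "nuclear_dim a1 c1 \<nu> m" "\<not> eigenvalue (nuclear a' c') \<nu>"
      "\<forall>\<mu> m'. \<mu> \<noteq> \<nu> \<longrightarrow> \<mu> \<noteq> 0 \<longrightarrow> nuclear_dim a' c' \<mu> m' \<longrightarrow> nuclear_dim a1 c1 \<mu> m'"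
      by blast
    have "\<exists>t. nuclear a1 c1 y = nuclear a c y + t *\<^sub>C x" for y
      by (auto simp: nuclear1 perp_def intro!: exI[of _ "- cinner x (nuclear a c y)"])
    moreover have "nuclear a1 c1 x = 0"
      using x by (simp add: nuclear1 eig perp_scaleC perp_self)
    ultimately have dim: "nuclear_dim a c \<mu> (if \<mu> = \<nu> then Suc m' else m')"
      if "nuclear_dim a1 c1 \<mu> m'" "\<mu> \<noteq> 0" for \<mu> m'
      using has_dim_deflate[OF clinear_nuclear[OF ac] clinear_nuclear[OF ac1] x0 eig _ _ that(2,1)] by blast
    show ?thesis
    proof (rule exI[of _ "Suc m"], rule exI[of _ a'], rule exI[of _ c'], intro conjI allI impI)
      show "norm (a' k) \<le> norm (a k)" "norm (c' k) \<le> norm (c k)" for k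
        using IH(1,2) le order_trans by blast+
      show "fdet a c z = (1 + z * \<nu>) ^ Suc m * fdet a' c' z" for z
        using fdet_deflate[OF ac x eig, of z] IH(3) by (simp add: a1_def c1_def mult.assoc)
      show "hsi a' c' + Suc m * cmod \<nu> \<le> hsi a c"
        using IH(4) hsi by (simp add: algebra_simps)
      show "nuclear_dim a c \<nu> (Suc m)"
        using dim[OF IH(5) assms(3)] by simp
      show "nuclear_dim a c \<mu> m'" if "\<mu> \<noteq> \<nu>" "\<mu> \<noteq> 0" "nuclear_dim a' c' \<mu> m'" for \<mu> m'
        using dim[of \<mu> m'] IH(7) that by simp
    qed (rule IH(6))
  qed
qed

lemma nuclear_has_dim:
  assumes "sqsum a" "sqsum c" "\<nu> \<noteq> 0"
  shows "nuclear_dim a c \<nu> (alg_mult (nuclear a c) \<nu>)"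
  using nuclear_deflate_eigenvalue[OF assms] alg_mult_eq by metis

text \<open>The last clause carries the induction: it identifies the number of deflations at the
  next eigenvalue with its multiplicity for the original operator.\<close>

lemma nuclear_deflate_finite:
  fixes a c :: "nat \<Rightarrow> 'h::complex_hilbert"
  assumes ac: "sqsum a" "sqsum c" and "finite F" "0 \<notin> F"
  shows "\<exists>(a' :: nat \<Rightarrow> 'h) (c' :: nat \<Rightarrow> 'h). (\<forall>k. norm (a' k) \<le> norm (a k)) \<and> (\<forall>k. norm (c' k) \<le> norm (c k)) \<and>
    (\<forall>z. fdet a c z = (\<Prod>\<nu>\<in>F. (1 + z * \<nu>) ^ alg_mult (nuclear a c) \<nu>) * fdet a' c' z) \<and>
    hsi a' c' + (\<Sum>\<nu>\<in>F. alg_mult (nuclear a c) \<nu> * cmod \<nu>) \<le> hsi a c \<and>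
    (\<forall>\<mu>. \<mu> \<noteq> 0 \<longrightarrow> eigenvalue (nuclear a' c') \<mu> \<longrightarrow> eigenvalue (nuclear a c) \<mu> \<and> \<mu> \<notin> F) \<and>
    (\<forall>\<mu>. \<mu> \<noteq> 0 \<longrightarrow> \<mu> \<notin> F \<longrightarrow> alg_mult (nuclear a' c') \<mu> = alg_mult (nuclear a c) \<mu>)"
  using assms(3,4)
proof (induction F rule: finite_induct)
  case empty
  show ?case
    by (rule exI[of _ a], rule exI[of _ c]) simp
next
  case (insert \<nu> F)
  have "0 \<notin> F"
    using insert.prems by auto
  from insert.IH[OF this] obtain a1 c1 :: "nat \<Rightarrow> 'h" where
    IH: "\<forall>k. norm (a1 k) \<le> norm (a k)" "\<forall>k. norm (c1 k) \<le> norm (c k)"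
    "\<forall>z. fdet a c z = (\<Prod>\<nu>\<in>F. (1 + z * \<nu>) ^ alg_mult (nuclear a c) \<nu>) * fdet a1 c1 z"
    "hsi a1 c1 + (\<Sum>\<nu>\<in>F. alg_mult (nuclear a c) \<nu> * cmod \<nu>) \<le> hsi a c"
    "\<forall>\<mu>. \<mu> \<noteq> 0 \<longrightarrow> eigenvalue (nuclear a1 c1) \<mu> \<longrightarrow> eigenvalue (nuclear a c) \<mu> \<and> \<mu> \<notin> F"
    "\<forall>\<mu>. \<mu> \<noteq> 0 \<longrightarrow> \<mu> \<notin> F \<longrightarrow> alg_mult (nuclear a1 c1) \<mu> = alg_mult (nuclear a c) \<mu>"
    by blast
  have ac1: "sqsum a1" "sqsum c1"
    using sqsum_mono[OF ac(1)] sqsum_mono[OF ac(2)] IH(1,2) by blast+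
  have "\<nu> \<noteq> 0"
    using insert.prems by auto
  obtain m and a' c' :: "nat \<Rightarrow> 'h" where
    D: "\<forall>k. norm (a' k) \<le> norm (a1 k)" "\<forall>k. norm (c' k) \<le> norm (c1 k)"
      "\<forall>z. fdet a1 c1 z = (1 + z * \<nu>) ^ m * fdet a' c' z" "hsi a' c' + m * cmod \<nu> \<le> hsi a1 c1"
      "nuclear_dim a1 c1 \<nu> m" "\<not> eigenvalue (nuclear a' c') \<nu>"
      "\<forall>\<mu> m'. \<mu> \<noteq> \<nu> \<longrightarrow> \<mu> \<noteq> 0 \<longrightarrow> nuclear_dim a' c' \<mu> m' \<longrightarrow> nuclear_dim a1 c1 \<mu> m'"
    using nuclear_deflate_eigenvalue[OF ac1 \<open>\<nu> \<noteq> 0\<close>] by blast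
  have m: "m = alg_mult (nuclear a c) \<nu>"
    using alg_mult_eq[OF D(5)] IH(6) insert.hyps \<open>\<nu> \<noteq> 0\<close> by simp
  have ac': "sqsum a'" "sqsum c'"
    using sqsum_mono[OF ac1(1)] sqsum_mono[OF ac1(2)] D(1,2) by blast+
  have dim': "nuclear_dim a1 c1 \<mu> (alg_mult (nuclear a' c') \<mu>)" if "\<mu> \<noteq> 0" "\<mu> \<noteq> \<nu>" for \<mu>
    using nuclear_has_dim[OF ac' that(1)] D(7) that by blast
  show ?case
  proof (rule exI[of _ a'], rule exI[of _ c'], intro conjI allI impI)
    show "norm (a' k) \<le> norm (a k)" "norm (c' k) \<le> norm (c k)" for k
      using IH(1,2) D(1,2) order_trans by blast+
    show "fdet a c z = (\<Prod>\<nu>\<in>insert \<nu> F. (1 + z * \<nu>) ^ alg_mult (nuclear a c) \<nu>) * fdet a' c' z" for z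
      using IH(3) D(3) insert.hyps m by (simp add: mult_ac)
    show "hsi a' c' + (\<Sum>\<nu>\<in>insert \<nu> F. alg_mult (nuclear a c) \<nu> * cmod \<nu>) \<le> hsi a c"
      using IH(4) D(4) insert.hyps m by simp
    fix \<mu> :: complex
    assume "\<mu> \<noteq> 0"
    show "alg_mult (nuclear a' c') \<mu> = alg_mult (nuclear a c) \<mu>" if "\<mu> \<notin> insert \<nu> F"
      using alg_mult_eq[OF dim'[OF \<open>\<mu> \<noteq> 0\<close>]] IH(6) that \<open>\<mu> \<noteq> 0\<close> by simp
    assume e: "eigenvalue (nuclear a' c') \<mu>"
    then have "\<mu> \<noteq> \<nu>"
      using D(6) by auto
    moreover have "0 < alg_mult (nuclear a' c') \<mu>"
      using has_dim_pos_iff_eigenvalue[OF clinear_nuclear[OF ac'] nuclear_has_dim[OF ac' \<open>\<mu> \<noteq> 0\<close>]] e by simp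
    then have "eigenvalue (nuclear a1 c1) \<mu>"
      using has_dim_pos_iff_eigenvalue[OF clinear_nuclear[OF ac1] dim'[OF \<open>\<mu> \<noteq> 0\<close> \<open>\<mu> \<noteq> \<nu>\<close>]] by simp
    then have "eigenvalue (nuclear a c) \<mu> \<and> \<mu> \<notin> F"
      using IH(5) \<open>\<mu> \<noteq> 0\<close> by blast
    ultimately show "eigenvalue (nuclear a c) \<mu>" "\<mu> \<notin> insert \<nu> F"
      by auto
  qed
qed

text \<open>Every eigenvalue of modulus at least \<open>r\<close> uses up at least \<open>r\<close>
  of the finite amount \<open>hsi a c\<close> when it is split off.\<close>

lemma finite_large_eigenvalues:
  assumes ac: "sqsum a" "sqsum c" and "0 < r"
  shows "finite {\<mu>. eigenvalue (nuclear a c) \<mu> \<and> r \<le> cmod \<mu>}"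
proof (rule ccontr)
  assume "infinite {\<mu>. eigenvalue (nuclear a c) \<mu> \<and> r \<le> cmod \<mu>}"
  then obtain F where F: "F \<subseteq> {\<mu>. eigenvalue (nuclear a c) \<mu> \<and> r \<le> cmod \<mu>}" "finite F"
    "card F = Suc (nat \<lfloor>hsi a c / r\<rfloor>)"
    using infinite_arbitrarily_large by blast
  then have "0 \<notin> F"
    using assms(3) by auto
  then obtain a' c' :: "nat \<Rightarrow> 'a" where *: "\<forall>k. norm (a' k) \<le> norm (a k)" "\<forall>k. norm (c' k) \<le> norm (c k)"
    "hsi a' c' + (\<Sum>\<nu>\<in>F. alg_mult (nuclear a c) \<nu> * cmod \<nu>) \<le> hsi a c"
    using nuclear_deflate_finite[OF ac F(2)] by blast
  have "0 \<le> hsi a' c'"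
    using sqsum_mono[OF ac(1)] sqsum_mono[OF ac(2)] *(1,2) by (intro hsi_nonneg) blast+
  have "real (card F) * r = (\<Sum>\<nu>\<in>F. r)"
    by simp
  also have "\<dots> \<le> (\<Sum>\<nu>\<in>F. alg_mult (nuclear a c) \<nu> * cmod \<nu>)"
  proof (rule sum_mono)
    fix \<nu> assume "\<nu> \<in> F"
    then have "\<nu> \<noteq> 0" "eigenvalue (nuclear a c) \<nu>" "r \<le> cmod \<nu>"
      using F(1) \<open>0 \<notin> F\<close> by auto
    then have "1 \<le> alg_mult (nuclear a c) \<nu>"
      using has_dim_pos_iff_eigenvalue[OF clinear_nuclear[OF ac] nuclear_has_dim[OF ac \<open>\<nu> \<noteq> 0\<close>]] by simp
    then have "1 * r \<le> alg_mult (nuclear a c) \<nu> * cmod \<nu>"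
      using \<open>r \<le> cmod \<nu>\<close> \<open>0 < r\<close> by (intro mult_mono) auto
    then show "r \<le> alg_mult (nuclear a c) \<nu> * cmod \<nu>"
      by simp
  qed
  also have "\<dots> \<le> hsi a c"
    using *(3) \<open>0 \<le> hsi a' c'\<close> by simp
  finally have "real (card F) \<le> hsi a c / r"
    using assms(3) by (simp add: field_simps)
  then show False
    using F(3) by linarith
qed

subsection \<open>The determinant as a product over the eigenvalues\<close>

text \<open>The constant depends only on \<open>a\<close>, \<open>c\<close> and \<delta> and holds
  for all pairs of sequences dominated by them, in particular for every deflation. Beyond
  \<open>N\<close> the sequences contribute at most half of \<delta> to the exponent; before
  \<open>N\<close> the shortening factor \<open>r\<close> achieves the same.\<close>

lemma fdet_growth:
  fixes a c :: "nat \<Rightarrow> 'h::complex_hilbert"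
  assumes ac: "sqsum a" "sqsum c" and \<delta>: "0 < \<delta>"
  obtains C where "0 < C"
    "\<And>(a' :: nat \<Rightarrow> 'h) (c' :: nat \<Rightarrow> 'h) z. (\<And>k. norm (a' k) \<le> norm (a k)) \<Longrightarrow> (\<And>k. norm (c' k) \<le> norm (c k)) \<Longrightarrow>
      cmod (fdet a' c' z) \<le> C * exp (\<delta> * cmod z)"
proof -
  define g where "g k = ((norm (a k))\<^sup>2 + (norm (c k))\<^sup>2) / 2" for k
  have g: "summable g"
    unfolding g_def by (rule summable_hs[OF ac])
  have g0: "0 \<le> g k" for k
    by (simp add: g_def)
  obtain N where N: "norm (suminf (\<lambda>i. g (i + N))) < \<delta> / 2"
    using suminf_exist_split[OF _ g, of "\<delta> / 2"] \<delta> by auto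
  define h where "h k = (if k < N then 0 else g k)" for k
  have h0: "0 \<le> h k" for k
    by (simp add: h_def g0)
  have h: "summable h"
    by (rule summable_comparison_test'[OF g]) (simp add: h_def g0)
  have "suminf h = suminf (\<lambda>i. h (i + N)) + (\<Sum>i<N. h i)"
    by (rule suminf_split_initial_segment[OF h])
  then have "suminf h \<le> \<delta> / 2"
    using N by (simp add: h_def)
  \<comment> \<open>Since \<open>r \<le> 1\<close>, the square of \<open>r\<close> is at most
    \<open>r\<close>, and so \<open>r\<^sup>2 * hsi a c\<close> is at most
    \<open>\<delta> / 2\<close>. The summand 1 keeps the denominator positive.\<close>
  define r where "r = min 1 (\<delta> / (2 * (hsi a c + 1)))"
  have hsi0: "0 \<le> hsi a c"
    by (rule hsi_nonneg[OF ac])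
  then have r: "0 < r" "r \<le> 1"
    using \<delta> by (simp_all add: r_def)
  have "r\<^sup>2 * hsi a c \<le> r * (hsi a c + 1)"
    using r hsi0 by (intro mult_mono) (auto simp: power2_eq_square mult_left_le)
  also have "\<dots> \<le> \<delta> / (2 * (hsi a c + 1)) * (hsi a c + 1)"
    using hsi0 by (intro mult_right_mono) (auto simp: r_def)
  also have "\<dots> = \<delta> / 2"
    using hsi0 by (simp add: field_simps add_nonneg_eq_0_iff)
  finally have r2: "r\<^sup>2 * hsi a c \<le> \<delta> / 2" .
  show thesis
  proof (rule that[of "(2 / r) ^ (2 * N)"])
    show "0 < (2 / r) ^ (2 * N)"
      using r by simp
    fix a' c' :: "nat \<Rightarrow> 'h" and z
    assume le: "\<And>k. norm (a' k) \<le> norm (a k)" "\<And>k. norm (c' k) \<le> norm (c k)"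
    have "hs_head r N n a' c' \<le> \<delta>" for n
    proof -
      have "hs_head r N n a' c' \<le> (\<Sum>k<n. r\<^sup>2 * g k + h k)"
        unfolding hs_head_def
      proof (rule sum_mono)
        fix k
        have "((norm (a' k))\<^sup>2 + (norm (c' k))\<^sup>2) / 2 \<le> g k"
          unfolding g_def by (intro divide_right_mono add_mono power_mono le) auto
        then have "(if k < N then r\<^sup>2 else 1) * (((norm (a' k))\<^sup>2 + (norm (c' k))\<^sup>2) / 2)
            \<le> (if k < N then r\<^sup>2 else 1) * g k"
          by (intro mult_left_mono) auto
        also have "\<dots> \<le> r\<^sup>2 * g k + h k"
          using g0[of k] by (simp add: h_def)
        finally show "(if k < N then r\<^sup>2 else 1) * (((norm (a' k))\<^sup>2 + (norm (c' k))\<^sup>2) / 2)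
            \<le> r\<^sup>2 * g k + h k" .
      qed
      also have "\<dots> = r\<^sup>2 * (\<Sum>k<n. g k) + (\<Sum>k<n. h k)"
        by (simp add: sum.distrib sum_distrib_left)
      also have "\<dots> \<le> r\<^sup>2 * suminf g + suminf h"
        using g h g0 h0 by (intro add_mono mult_left_mono sum_le_suminf) simp_all
      also have "\<dots> \<le> \<delta>"
        using r2 \<open>suminf h \<le> \<delta> / 2\<close> by (simp add: hsi_def g_def[abs_def])
      finally show ?thesis .
    qed
    then have *: "cmod (pdet n a' c' z) \<le> (2 / r) ^ (2 * N) * exp (\<delta> * cmod z)" for n
      by (intro order.trans[OF pdet_growth[OF r, of n a' c' z N]] mult_left_mono)
        (auto simp: mult.commute[of \<delta>] r less_imp_le intro!: mult_left_mono)
    have "sqsum a'" "sqsum c'"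
      using sqsum_mono[OF ac(1)] sqsum_mono[OF ac(2)] le by blast+
    then have "(\<lambda>n. cmod (pdet n a' c' z)) \<longlonglongrightarrow> cmod (fdet a' c' z)"
      by (intro tendsto_norm pdet_tendsto)
    then show "cmod (fdet a' c' z) \<le> (2 / r) ^ (2 * N) * exp (\<delta> * cmod z)"
      by (rule LIMSEQ_le_const2) (use * in auto)
  qed
qed

lemma norm_exp_minus_1_le: "cmod (exp z - 1) \<le> exp (cmod z) - 1"
proof -
  have 1: "(\<lambda>n. z ^ Suc n /\<^sub>R fact (Suc n)) sums (exp z - 1)"
    using exp_converges[of z] by (subst sums_Suc_iff) simp
  have 2: "(\<lambda>n. cmod z ^ Suc n /\<^sub>R fact (Suc n)) sums (exp (cmod z) - 1)"
    using exp_converges[of "cmod z"] by (subst sums_Suc_iff) simp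
  have "cmod (suminf (\<lambda>n. z ^ Suc n /\<^sub>R fact (Suc n))) \<le> suminf (\<lambda>n. cmod z ^ Suc n /\<^sub>R fact (Suc n))"
    using sums_summable[OF 2] by (intro norm_suminf_le) (simp_all add: norm_mult norm_power)
  then show ?thesis
    using sums_unique[OF 1] sums_unique[OF 2] by simp
qed

text \<open>Borel--Caratheodory: the Schwarz lemma for \<open>h / (2M - h)\<close>, where \<open>h\<close> is the logarithm of \<open>g\<close>.\<close>

lemma norm_minus_1_le_of_nonvanishing:
  assumes g: "g holomorphic_on ball 0 R" and g0: "g 0 = 1" and R: "1 < R" and M: "0 < M"
    and nz: "\<And>z. z \<in> ball 0 R \<Longrightarrow> g z \<noteq> 0"
    and bound: "\<And>z. z \<in> ball 0 R \<Longrightarrow> cmod (g z) < exp M"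
  shows "cmod (g 1 - 1) \<le> exp (2 * M / (R - 1)) - 1"
proof -
  obtain h' where h': "h' holomorphic_on ball 0 R" "\<And>z. z \<in> ball 0 R \<Longrightarrow> g z = exp (h' z)"
    by (rule holomorphic_logarithm_exists[OF convex_ball open_ball g nz, of 0]) (use R in auto)
  define h where "h z = h' z - h' 0" for z
  have h: "h holomorphic_on ball 0 R"
    unfolding h_def by (intro holomorphic_intros h')
  have "exp (h' 0) = 1"
    using h'(2)[of 0] g0 R by simp
  then have gh: "g z = exp (h z)" if "z \<in> ball 0 R" for z
    using h'(2)[OF that] by (simp add: h_def exp_diff)
  have Re: "Re (h z) < M" if "z \<in> ball 0 R" for z
    using bound[OF that] gh[OF that] by simp
  define F where "F w = h (of_real R * w) / (2 * of_real M - h (of_real R * w))" for w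
  have in_ball: "of_real R * w \<in> ball 0 R" if "cmod w < 1" for w
    using that R by (simp add: norm_mult)
  have nz': "2 * complex_of_real M - h (of_real R * w) \<noteq> 0" if "cmod w < 1" for w
  proof
    assume "2 * complex_of_real M - h (of_real R * w) = 0"
    then have "h (of_real R * w) = 2 * complex_of_real M"
      by simp
    then have "Re (h (of_real R * w)) = 2 * M"
      by simp
    then show False
      using Re[OF in_ball[OF that]] M by linarith
  qed
  have "F holomorphic_on ball 0 1"
    unfolding F_def
  proof (intro holomorphic_intros)
    have "(h \<circ> (\<lambda>w. of_real R * w)) holomorphic_on ball 0 1"
      using in_ball by (intro holomorphic_on_compose_gen[OF _ h] holomorphic_intros) auto
    then show "(\<lambda>w. h (of_real R * w)) holomorphic_on ball 0 1"
      "(\<lambda>w. h (of_real R * w)) holomorphic_on ball 0 1"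
      by (simp_all add: o_def)
  qed (use nz' in auto)
  moreover have "F 0 = 0"
    by (simp add: F_def h_def)
  moreover have "cmod (F w) < 1" if "cmod w < 1" for w
  proof -
    define u where "u = h (of_real R * w)"
    have "Re u < M"
      unfolding u_def by (rule Re[OF in_ball[OF that]])
    \<comment> \<open>\<open>Re u < M\<close> says that \<open>u\<close> is closer to 0 than to
      \<open>2 * M\<close>.\<close>
    then have "(cmod u)\<^sup>2 < (cmod (2 * M - u))\<^sup>2"
      unfolding cmod_power2 using mult_pos_pos[OF M, of "M - Re u"]
      by (simp add: power2_eq_square algebra_simps)
    then have "cmod u < cmod (2 * M - u)"
      by (rule power_less_imp_less_base) simp
    then show ?thesis
      using nz'[OF that] by (simp add: F_def u_def norm_divide)
  qed
  ultimately have "cmod (F (1 / R)) \<le> cmod (1 / R)"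
    by (rule Schwarz_Lemma(1)) (use R in \<open>auto simp: norm_divide\<close>)
  then have "cmod (h 1) \<le> cmod (2 * M - h 1) / R"
    using nz'[of "1 / R"] R by (simp add: F_def norm_divide field_simps)
  also have "\<dots> \<le> (2 * M + cmod (h 1)) / R"
    using R M norm_triangle_ineq4[of "2 * complex_of_real M" "h 1"] by (intro divide_right_mono) auto
  finally have "cmod (h 1) * (R - 1) \<le> 2 * M"
    using R by (simp add: field_simps)
  then have "cmod (h 1) \<le> 2 * M / (R - 1)"
    using R by (simp add: field_simps)
  then have "exp (cmod (h 1)) - 1 \<le> exp (2 * M / (R - 1)) - 1"
    by simp
  moreover have "cmod (g 1 - 1) \<le> exp (cmod (h 1)) - 1"
  proof -
    have "cmod (exp (h 1) - 1) \<le> exp (cmod (h 1)) - 1"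
      by (rule norm_exp_minus_1_le)
    then show ?thesis
      using gh[of 1] R by simp
  qed
  ultimately show ?thesis
    by linarith
qed

text \<open>For a finite set \<open>F\<close> of eigenvalues the value at 1 is
  \<open>D = P * g\<close> with the finite product \<open>P\<close> and the remaining factor
  \<open>g\<close>. Once \<open>g\<close> is close to 1, \<open>P\<close> is at most twice as large
  as \<open>D\<close>, so \<open>P\<close> is close to \<open>D\<close> even if
  \<open>D = 0\<close>.\<close>

lemma nuclear_det_tendsto:
  fixes a c :: "nat \<Rightarrow> 'h::complex_hilbert"
  assumes ac: "sqsum a" "sqsum c"
  shows "((\<lambda>F. \<Prod>\<mu>\<in>F. (1 + \<mu>) ^ alg_mult (nuclear a c) \<mu>) \<longlongrightarrow> fdet a c 1)
    (finite_subsets_at_top {\<mu>. \<mu> \<noteq> 0 \<and> eigenvalue (nuclear a c) \<mu>})"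
proof (rule tendstoI)
  fix e :: real
  assume e: "0 < e"
  define D where "D = fdet a c 1"
  \<comment> \<open>The tolerance for \<open>g\<close>: the bound \<open>1 / 2\<close> gives
    \<open>cmod g \<ge> 1 / 2\<close>, the other bound makes the final error
    \<open>2 * cmod D * \<eta>\<close> smaller than \<open>e\<close>.\<close>
  define \<eta> where "\<eta> = min (1 / 2) (e / (4 * (cmod D + 1)))"
  have D1: "0 < cmod D + 1"
    using norm_ge_zero[of D] by linarith
  then have \<eta>: "0 < \<eta>" "\<eta> \<le> 1 / 2"
    using e unfolding \<eta>_def by (simp, intro min.cobounded1)
  have "2 * cmod D * \<eta> \<le> 2 * cmod D * (e / (4 * (cmod D + 1)))"
    by (intro mult_left_mono) (auto simp: \<eta>_def)
  also have "\<dots> < e"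
  proof -
    have "0 \<le> e * (cmod D * 2)"
      using e by simp
    then show ?thesis
      using D1 e by (simp add: field_simps add_pos_nonneg)
  qed
  finally have \<eta>D: "2 * cmod D * \<eta> < e" .
  define t where "t = ln (1 + \<eta>)"
  have t: "0 < t"
    using \<eta> by (simp add: t_def)
  obtain C where C: "0 < C" "\<And>(a' :: nat \<Rightarrow> 'h) (c' :: nat \<Rightarrow> 'h) z. (\<And>k. norm (a' k) \<le> norm (a k)) \<Longrightarrow>
      (\<And>k. norm (c' k) \<le> norm (c k)) \<Longrightarrow> cmod (fdet a' c' z) \<le> C * exp (t / 4 * cmod z)"
    using fdet_growth[OF ac, of "t / 4"] t by auto
  \<comment> \<open>On the disc of radius \<open>R\<close> the growth bound with rate
    \<open>t / 4\<close> stays strictly below \<open>exp M\<close>, because \<open>L > ln C\<close>.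
    The lower bound for \<open>R\<close> is equivalent to \<open>2 * M \<le> t * (R - 1)\<close>, so
    that the estimate at 1 is \<open>exp t - 1 = \<eta>\<close>.\<close>
  define L where "L = \<bar>ln C\<bar> + 1"
  define R where "R = max 2 ((4 * L + 2 * t) / t)"
  define M where "M = L + t / 4 * R"
  have R: "1 < R" "(4 * L + 2 * t) / t \<le> R"
    by (auto simp: R_def)
  have "0 < L"
    unfolding L_def by linarith
  then have M: "0 < M"
    unfolding M_def using t R(1) by (intro add_pos_pos mult_pos_pos) auto
  have "4 * L + 2 * t \<le> R * t"
    using R(2) t by (simp add: pos_divide_le_eq)
  then have "2 * M \<le> t * (R - 1)"
    by (simp add: M_def algebra_simps)
  then have MR: "2 * M / (R - 1) \<le> t"
    using R by (simp add: pos_divide_le_eq)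
  define F0 where "F0 = {\<mu>. eigenvalue (nuclear a c) \<mu> \<and> 1 / R \<le> cmod \<mu>}"
  have F0: "finite F0"
    unfolding F0_def using R by (intro finite_large_eigenvalues ac) simp
  have F0': "F0 \<subseteq> {\<mu>. \<mu> \<noteq> 0 \<and> eigenvalue (nuclear a c) \<mu>}"
    using R by (auto simp: F0_def)
  have main: "dist (\<Prod>\<mu>\<in>F. (1 + \<mu>) ^ alg_mult (nuclear a c) \<mu>) D < e"
    if F: "finite F" "F0 \<subseteq> F" "F \<subseteq> {\<mu>. \<mu> \<noteq> 0 \<and> eigenvalue (nuclear a c) \<mu>}" for F
  proof -
    have "0 \<notin> F"
      using F(3) by auto
    then obtain a' c' :: "nat \<Rightarrow> 'h" where
      le: "\<forall>k. norm (a' k) \<le> norm (a k)" "\<forall>k. norm (c' k) \<le> norm (c k)" and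
      det: "\<forall>z. fdet a c z = (\<Prod>\<nu>\<in>F. (1 + z * \<nu>) ^ alg_mult (nuclear a c) \<nu>) * fdet a' c' z" and
      ev: "\<forall>\<mu>. \<mu> \<noteq> 0 \<longrightarrow> eigenvalue (nuclear a' c') \<mu> \<longrightarrow> eigenvalue (nuclear a c) \<mu> \<and> \<mu> \<notin> F"
      using nuclear_deflate_finite[OF ac F(1)] by blast
    have ac': "sqsum a'" "sqsum c'"
      using sqsum_mono[OF ac(1)] sqsum_mono[OF ac(2)] le by blast+
    define P where "P = (\<Prod>\<mu>\<in>F. (1 + \<mu>) ^ alg_mult (nuclear a c) \<mu>)"
    define g where "g = fdet a' c' 1"
    have "cmod (g - 1) \<le> exp (2 * M / (R - 1)) - 1"
      unfolding g_def
    proof (rule norm_minus_1_le_of_nonvanishing)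
      show "fdet a' c' 0 = 1" "1 < R" "0 < M"
        by (simp_all add: fdet_at_0 R(1) M)
      show "fdet a' c' holomorphic_on ball 0 R"
        using fdet_holomorphic[OF ac'] by (rule holomorphic_on_subset) simp
      fix z :: complex
      assume z: "z \<in> ball 0 R"
      \<comment> \<open>A zero \<open>z\<close> in the disc gives the eigenvalue
        \<open>- 1 / z\<close> of modulus above \<open>1 / R\<close>, which belongs to
        \<open>F0\<close> and was split off.\<close>
      show "fdet a' c' z \<noteq> 0"
      proof
        assume "fdet a' c' z = 0"
        then obtain v where v: "v \<noteq> 0" "v + z *\<^sub>C nuclear a' c' v = 0"
          by (rule fdet_root_eigenvector[OF ac'])
        have "z \<noteq> 0"
          using v by auto
        have "z *\<^sub>C nuclear a' c' v = - v"
          using v(2) by (simp add: eq_neg_iff_add_eq_0 add.commute)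
        then have "inverse z *\<^sub>C (z *\<^sub>C nuclear a' c' v) = (- inverse z) *\<^sub>C v"
          by simp
        then have "nuclear a' c' v = (- inverse z) *\<^sub>C v"
          using \<open>z \<noteq> 0\<close> by (simp add: scaleC_scaleC)
        then have "eigenvalue (nuclear a' c') (- inverse z)"
          using v(1) by (auto simp: eigenvalue_def)
        then have "- inverse z \<notin> F0" "eigenvalue (nuclear a c) (- inverse z)"
          using ev \<open>z \<noteq> 0\<close> F(2) by auto
        then have "cmod (- inverse z) < 1 / R"
          by (auto simp: F0_def)
        then have "inverse (cmod z) < inverse R"
          by (simp add: norm_inverse norm_divide inverse_eq_divide)
        then have "R < cmod z"
          by (rule inverse_less_imp_less) (use \<open>z \<noteq> 0\<close> in simp)
        then show False
          using z by simp
      qed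
      have "cmod (fdet a' c' z) \<le> C * exp (t / 4 * cmod z)"
        using C(2) le by blast
      also have "\<dots> \<le> exp (ln C) * exp (t / 4 * R)"
        using C(1) z t by (intro mult_mono) auto
      also have "\<dots> < exp M"
        unfolding M_def L_def exp_add[symmetric] by simp
      finally show "cmod (fdet a' c' z) < exp M" .
    qed
    also have "\<dots> \<le> exp t - 1"
      using MR by simp
    also have "\<dots> = \<eta>"
      using \<eta> by (simp add: t_def)
    finally have g: "cmod (g - 1) \<le> \<eta>" .
    have "1 - cmod g \<le> 1 / 2"
      using norm_triangle_ineq2[of 1 g] g \<eta> by (simp add: norm_minus_commute)
    then have "cmod P * (1 / 2) \<le> cmod P * cmod g"
      by (intro mult_left_mono) auto
    also have DP: "D = P * g"
      using det by (simp add: D_def P_def g_def)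
    then have "cmod P * cmod g = cmod D"
      by (simp add: norm_mult)
    finally have P: "cmod P \<le> 2 * cmod D"
      by simp
    have "dist P D = cmod P * cmod (g - 1)"
      by (simp add: DP dist_norm norm_mult[symmetric] algebra_simps norm_minus_commute)
    also have "\<dots> \<le> 2 * cmod D * \<eta>"
      using P g by (intro mult_mono) auto
    finally show ?thesis
      using \<eta>D by (simp add: P_def)
  qed
  show "\<forall>\<^sub>F F in finite_subsets_at_top {\<mu>. \<mu> \<noteq> 0 \<and> eigenvalue (nuclear a c) \<mu>}.
      dist (\<Prod>\<mu>\<in>F. (1 + \<mu>) ^ alg_mult (nuclear a c) \<mu>) (fdet a c 1) < e"
    unfolding eventually_finite_subsets_at_top D_def[symmetric]
    by (rule exI[of _ F0]) (intro conjI allI impI F0 F0' main, simp_all)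
qed

theorem fredholm_det_nuclear:
  assumes "sqsum a" "sqsum c"
  shows "fredholm_det (\<lambda>x. x + nuclear a c x) = fdet a c 1"
  unfolding fredholm_det_def Let_def
  using tendsto_Lim[OF _ nuclear_det_tendsto[OF assms]] by simp

lemma fredholm_det_rank_one:
  assumes ac: "sqsum a" "sqsum c" and y: "y + nuclear a c y = b"
  shows "fredholm_det (\<lambda>x. x + nuclear (case_nat b a) (case_nat w c) x)
    = (1 + cinner w y) * fredholm_det (\<lambda>x. x + nuclear a c x)"
  using fdet_case_nat[OF ac, of y 1 b w] y ac by (simp add: fredholm_det_nuclear)

section \<open>The determinant of an inverse\<close>

text \<open>With \<open>W = Id + J\<close> one has \<open>V Q^-1 = V W^-1 V^-1\<close>. Hence
  \<open>V\<close> maps generalized eigenspaces of \<open>J\<close> onto those of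
  \<open>K = V Q^-1 - Id\<close>, and each factor \<open>1 + \<mu>\<close> of the one product is the
  reciprocal of a factor of the other. The determinant of \<open>W\<close> is not zero because
  \<open>W\<close> is injective.\<close>

lemma fredholm_det_inverse:
  fixes V Q :: "'h::complex_hilbert \<Rightarrow> 'h"
  assumes ac: "sqsum a" "sqsum c" and V: "clinear_on UNIV V" "bij V"
    and Q: "bij Q" "\<And>x. Q x = V (x + nuclear a c x)"
  shows "fredholm_det (V \<circ> the_inv Q) = inverse (fredholm_det (\<lambda>x. x + nuclear a c x))"
    and "fredholm_det (\<lambda>x. x + nuclear a c x) \<noteq> 0"
proof -
  define J where "J = nuclear a c"
  define K where "K x = V (the_inv Q x) - x" for x
  define W where "W x = x + J x" for x
  have J: "clinear_on UNIV J"
    unfolding J_def by (rule clinear_nuclear[OF ac])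
  have W: "clinear_on UNIV W"
    using J by (auto simp: clinear_on_def W_def scaleC_add_right)
  have V0: "V x = 0 \<longleftrightarrow> x = 0" for x
    using V by (metis UNIV_I bij_is_inj clinear_on_def complex_vector.scale_zero_left injD)
  have Vd: "V (x - y) = V x - V y" "V (t *\<^sub>C x) = t *\<^sub>C V x" for x y t
  proof -
    have "V ((x - y) + y) = V (x - y) + V y"
      using V(1) unfolding clinear_on_def by blast
    then show "V (x - y) = V x - V y" by simp
    show "V (t *\<^sub>C x) = t *\<^sub>C V x"
      using V(1) unfolding clinear_on_def by blast
  qed
  have QV: "Q x = V (W x)" for x
    by (simp add: Q(2) W_def J_def)
  have inj_W: "x = 0" if "W x = 0" for x
  proof -
    have "Q x = Q 0"
      using that W clinear_funpow(3)[OF W, of 1] by (simp add: QV)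
    then show ?thesis
      using Q(1) by (meson bij_is_inj injD)
  qed
  then have "fdet a c 1 \<noteq> 0"
    using fdet_root_eigenvector[OF ac, of 1] by (metis J_def W_def scaleC_one)
  then show nz: "fredholm_det (\<lambda>x. x + nuclear a c x) \<noteq> 0"
    by (simp add: fredholm_det_nuclear[OF ac])
  \<comment> \<open>The solution of \<open>(1 + \<phi> \<mu>) * (1 + \<mu>) = 1\<close>; it is its
    own inverse.\<close>
  define \<phi> where "\<phi> \<mu> = - \<mu> / (1 + \<mu>)" for \<mu> :: complex
  have QinvV: "the_inv Q (V (W y)) = y" for y
    using Q(1) by (metis QV bij_is_inj the_inv_f_f)
  have KVW: "K (V (W y)) = V y - V (W y)" for y
    by (simp add: K_def QinvV)
  have surj_W: "\<exists>y. x = W y" for x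
  proof -
    obtain y where "V x = Q y"
      using Q(1) by (metis bij_pointE)
    then have "x = W y"
      using V(2) by (simp add: QV bij_is_inj inj_eq)
    then show ?thesis by blast
  qed
  have surj_V: "\<exists>y. x = V y" for x
    using V(2) by (metis bij_pointE)
  have K: "clinear_on UNIV K"
    unfolding clinear_on_def
  proof (intro conjI ballI allI)
    fix x y :: 'h and t
    obtain x' y' where xy: "x = V (W x')" "y = V (W y')"
      using surj_V surj_W by metis
    have "x + y = V (W (x' + y'))"
      using V(1) W by (simp add: xy clinear_on_def)
    then show "K (x + y) = K x + K y"
      using V(1) W by (simp add: xy KVW) (simp add: clinear_on_def)
    have "t *\<^sub>C x = V (W (t *\<^sub>C x'))"
      using V(1) W by (simp add: xy clinear_on_def)
    then show "K (t *\<^sub>C x) = t *\<^sub>C K x"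
      using V(1) W by (simp add: xy KVW) (simp add: clinear_on_def scaleC_algebra)
  qed
  have gen: "gen_null (\<lambda>y. K y - \<mu> *\<^sub>C y) = V ` gen_null (\<lambda>y. J y - \<phi> \<mu> *\<^sub>C y)"
    if \<mu>: "1 + \<mu> \<noteq> 0" for \<mu>
  proof -
    define S where "S = (\<lambda>y. J y - \<phi> \<mu> *\<^sub>C y)"
    define U where "U = (\<lambda>y. K y - \<mu> *\<^sub>C y)"
    have S: "clinear_on UNIV S"
      using J by (auto simp: S_def clinear_on_def scaleC_algebra mult.commute)
    have U: "clinear_on UNIV U"
      using K by (auto simp: U_def clinear_on_def scaleC_algebra mult.commute)
    have SW: "S (W y) = W (S y)" for y
    proof -
      have "J (y + J y) = J y + J (J y)" "J (\<phi> \<mu> *\<^sub>C y) = \<phi> \<mu> *\<^sub>C J y"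
        "J (J y - \<phi> \<mu> *\<^sub>C y + \<phi> \<mu> *\<^sub>C y) = J (J y - \<phi> \<mu> *\<^sub>C y) + J (\<phi> \<mu> *\<^sub>C y)"
        using J unfolding clinear_on_def by blast+
      then show ?thesis
        by (simp add: S_def W_def scaleC_add_right algebra_simps)
    qed
    have SWn: "S ((W ^^ n) y) = (W ^^ n) (S y)" for n y
      by (induction n) (simp_all add: SW)
    have SnW: "(S ^^ n) (W y) = W ((S ^^ n) y)" for n y
      by (induction n) (simp_all add: SW)
    have SnWn: "(S ^^ n) ((W ^^ m) y) = (W ^^ m) ((S ^^ n) y)" for m n y
      by (induction m) (simp_all add: SnW)
    \<comment> \<open>As operators, \<open>U V W = - (1 + \<mu>) V S\<close>. Since \<open>W\<close>
      commutes with \<open>S\<close>, the \<open>n\<close>-th powers satisfy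
      \<open>U^n V W^n = (- (1 + \<mu>))^n V S^n\<close>. As \<open>W^n\<close> is bijective,
      \<open>U^n V\<close> and \<open>S^n\<close> have the same kernel.\<close>
    have step: "U (V (W y)) = (- (1 + \<mu>)) *\<^sub>C V (S y)" for y
    proof -
      have "U (V (W y)) = V y - (1 + \<mu>) *\<^sub>C V (W y)"
        by (simp add: U_def KVW scaleC_add_left)
      also have "\<dots> = V (y - (1 + \<mu>) *\<^sub>C W y)"
        by (simp add: Vd)
      also have "y - (1 + \<mu>) *\<^sub>C W y = (- (1 + \<mu>)) *\<^sub>C S y"
      proof -
        have "(1 + \<mu>) * \<phi> \<mu> = - \<mu>"
          using \<mu> by (simp add: \<phi>_def)
        then have "(1 + \<mu>) *\<^sub>C S y = (1 + \<mu>) *\<^sub>C J y + \<mu> *\<^sub>C y"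
          by (simp add: S_def complex_vector.scale_right_diff_distrib scaleC_scaleC)
        moreover have "(1 + \<mu>) *\<^sub>C W y = y + \<mu> *\<^sub>C y + (1 + \<mu>) *\<^sub>C J y"
          by (simp add: W_def scaleC_add_right scaleC_add_left)
        ultimately show ?thesis
          by (simp only: complex_vector.scale_minus_left) simp
      qed
      finally show ?thesis
        by (simp only: Vd)
    qed
    have Un: "(U ^^ n) (V ((W ^^ n) y)) = (- (1 + \<mu>)) ^ n *\<^sub>C V ((S ^^ n) y)" for n y
    proof (induction n arbitrary: y)
      case (Suc n)
      have "(U ^^ Suc n) (V ((W ^^ Suc n) y)) = (U ^^ n) (U (V (W ((W ^^ n) y))))"
        by (simp add: funpow_swap1)
      also have "\<dots> = (- (1 + \<mu>)) *\<^sub>C (U ^^ n) (V ((W ^^ n) (S y)))"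
        by (simp only: step SWn clinear_funpow(2)[OF U])
      also have "\<dots> = (- (1 + \<mu>)) ^ Suc n *\<^sub>C V ((S ^^ Suc n) y)"
        by (simp only: Suc.IH scaleC_scaleC funpow_Suc_right power_Suc o_apply)
      finally show ?case .
    qed simp
    have Wn: "y = 0" if "(W ^^ n) y = 0" for n y
      using that by (induction n) (auto dest: inj_W)
    then have Wn: "(W ^^ n) y = 0 \<longleftrightarrow> y = 0" for n y
      using clinear_funpow(3)[OF W] by blast
    have surj_Wn: "\<exists>y. x = (W ^^ n) y" for n x
    proof (induction n arbitrary: x)
      case (Suc n)
      obtain y where "x = W y"
        using surj_W by blast
      moreover obtain z where "y = (W ^^ n) z"
        using Suc.IH by blast
      ultimately show ?case
        by (intro exI[of _ z]) simp
    qed simp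
    have *: "(U ^^ n) (V x) = 0 \<longleftrightarrow> (S ^^ n) x = 0" for n x
    proof -
      obtain y where y: "x = (W ^^ n) y"
        using surj_Wn by blast
      have "(U ^^ n) (V x) = 0 \<longleftrightarrow> V ((S ^^ n) y) = 0"
        using \<mu> by (simp add: y Un complex_vector.scale_eq_0_iff) (metis add_eq_0_iff)
      also have "\<dots> \<longleftrightarrow> (S ^^ n) x = 0"
        by (simp add: y SnWn Wn V0)
      finally show ?thesis .
    qed
    show ?thesis
      unfolding S_def[symmetric] U_def[symmetric]
    proof (intro equalityI subsetI)
      fix y assume "y \<in> gen_null U"
      moreover obtain x where "y = V x"
        using surj_V by blast
      ultimately show "y \<in> V ` gen_null S"
        by (auto simp: gen_null_def *)
    next
      fix y assume "y \<in> V ` gen_null S"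
      then show "y \<in> gen_null U"
        by (auto simp: gen_null_def *)
    qed
  qed
  have dim: "has_dim (gen_null (\<lambda>y. K y - \<mu> *\<^sub>C y)) (alg_mult J (\<phi> \<mu>))" if "\<mu> \<noteq> 0" "1 + \<mu> \<noteq> 0" for \<mu>
  proof -
    have "\<phi> \<mu> \<noteq> 0"
      using that by (simp add: \<phi>_def)
    then obtain B where B: "finite B" "\<not> complex_vector.dependent B"
      "complex_vector.span B = gen_null (\<lambda>y. J y - \<phi> \<mu> *\<^sub>C y)" "card B = alg_mult J (\<phi> \<mu>)"
      using nuclear_has_dim[OF ac] unfolding has_dim_def J_def by blast
    interpret V: Vector_Spaces.linear scaleC scaleC V
      using V(1) by unfold_locales (simp_all add: clinear_on_def)
    have "inj V"
      using V(2) by (rule bij_is_inj)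
    then show ?thesis
      unfolding has_dim_def gen[OF that(2)] using B
      by (intro exI[of _ "V ` B"])
        (simp add: V.independent_inj_image V.span_image card_image inj_on_subset)
  qed
  have ev: "eigenvalue K \<mu> \<longleftrightarrow> eigenvalue J (\<phi> \<mu>)" and mult: "alg_mult K \<mu> = alg_mult J (\<phi> \<mu>)"
    if "\<mu> \<noteq> 0" "1 + \<mu> \<noteq> 0" for \<mu>
  proof -
    have "\<phi> \<mu> \<noteq> 0"
      using that by (simp add: \<phi>_def)
    then show "eigenvalue K \<mu> \<longleftrightarrow> eigenvalue J (\<phi> \<mu>)"
      using has_dim_pos_iff_eigenvalue[OF K dim[OF that]]
        has_dim_pos_iff_eigenvalue[OF clinear_nuclear[OF ac] nuclear_has_dim[OF ac]] by (simp add: J_def)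
    show "alg_mult K \<mu> = alg_mult J (\<phi> \<mu>)"
      by (rule alg_mult_eq[OF dim[OF that]])
  qed
  have K1: "1 + \<mu> \<noteq> 0" if "eigenvalue K \<mu>" for \<mu>
  proof
    assume "1 + \<mu> = 0"
    obtain x where x: "x \<noteq> 0" "K x = \<mu> *\<^sub>C x"
      using \<open>eigenvalue K \<mu>\<close> by (auto simp: eigenvalue_def)
    obtain y where y: "x = V (W y)"
      using surj_V surj_W by metis
    have "\<mu> = - 1"
      using \<open>1 + \<mu> = 0\<close> by (simp add: add_eq_0_iff)
    then have "y = 0"
      using x(2) by (simp add: y KVW V0)
    then show False
      using x(1) clinear_funpow(3)[OF W, of 1] by (simp add: y V0)
  qed
  have J1: "1 + \<nu> \<noteq> 0" if "eigenvalue J \<nu>" for \<nu>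
  proof
    assume "1 + \<nu> = 0"
    obtain x where x: "x \<noteq> 0" "J x = \<nu> *\<^sub>C x"
      using \<open>eigenvalue J \<nu>\<close> by (auto simp: eigenvalue_def)
    have "\<nu> = - 1"
      using \<open>1 + \<nu> = 0\<close> by (simp add: add_eq_0_iff)
    then have "W x = 0"
      using x(2) by (simp add: W_def)
    then show False
      using x(1) inj_W by blast
  qed
  have \<phi>1: "1 + \<phi> \<mu> = inverse (1 + \<mu>)" "\<phi> (\<phi> \<mu>) = \<mu>" if "1 + \<mu> \<noteq> 0" for \<mu>
  proof -
    show "1 + \<phi> \<mu> = inverse (1 + \<mu>)"
      using that by (simp add: \<phi>_def field_simps)
    then have "\<phi> (\<phi> \<mu>) = - \<phi> \<mu> / inverse (1 + \<mu>)"
      by (simp add: \<phi>_def[of "\<phi> \<mu>"])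
    also have "\<dots> = \<mu>"
      using that by (simp add: \<phi>_def)
    finally show "\<phi> (\<phi> \<mu>) = \<mu>" .
  qed
  define EK EJ where "EK = {\<mu>. \<mu> \<noteq> 0 \<and> eigenvalue K \<mu>}" and "EJ = {\<mu>. \<mu> \<noteq> 0 \<and> eigenvalue J \<mu>}"
  have inj: "inj_on \<phi> EK"
    by (rule inj_on_inverseI[of _ \<phi>]) (auto simp: EK_def \<phi>1 K1)
  have "\<phi> ` EK = EJ"
  proof (intro equalityI subsetI)
    fix \<nu> assume "\<nu> \<in> \<phi> ` EK"
    then show "\<nu> \<in> EJ"
      using ev K1 by (auto simp: EK_def EJ_def) (simp add: \<phi>_def)
  next
    fix \<nu> assume \<nu>: "\<nu> \<in> EJ"
    then have 1: "1 + \<nu> \<noteq> 0" "\<nu> \<noteq> 0"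
      using J1 by (auto simp: EJ_def)
    then have "1 + \<phi> \<nu> \<noteq> 0" "\<phi> \<nu> \<noteq> 0"
      by (simp_all add: \<phi>1) (simp add: \<phi>_def)
    then have "\<phi> \<nu> \<in> EK"
      using ev[of "\<phi> \<nu>"] \<nu> by (simp add: EK_def EJ_def \<phi>1 1)
    then show "\<nu> \<in> \<phi> ` EK"
      using \<phi>1(2)[OF 1(1)] by (metis imageI)
  qed
  then have "filterlim ((`) \<phi>) (finite_subsets_at_top EJ) (finite_subsets_at_top EK)"
    using filtermap_image_finite_subsets_at_top[OF inj] by (simp add: filterlim_def)
  then have "((\<lambda>F. \<Prod>\<mu>\<in>\<phi> ` F. (1 + \<mu>) ^ alg_mult J \<mu>) \<longlongrightarrow> fdet a c 1) (finite_subsets_at_top EK)"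
    using nuclear_det_tendsto[OF ac] unfolding EJ_def J_def by (rule filterlim_compose[rotated])
  then have "((\<lambda>F. inverse (\<Prod>\<mu>\<in>\<phi> ` F. (1 + \<mu>) ^ alg_mult J \<mu>)) \<longlongrightarrow> inverse (fdet a c 1)) (finite_subsets_at_top EK)"
    by (rule tendsto_inverse) fact
  moreover have "inverse (\<Prod>\<mu>\<in>\<phi> ` F. (1 + \<mu>) ^ alg_mult J \<mu>) = (\<Prod>\<mu>\<in>F. (1 + \<mu>) ^ alg_mult K \<mu>)"
    if "F \<subseteq> EK" for F
  proof -
    have "(\<Prod>\<mu>\<in>\<phi> ` F. (1 + \<mu>) ^ alg_mult J \<mu>) = (\<Prod>\<mu>\<in>F. (1 + \<phi> \<mu>) ^ alg_mult J (\<phi> \<mu>))"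
      using inj_on_subset[OF inj that] by (simp add: prod.reindex)
    also have "\<dots> = (\<Prod>\<mu>\<in>F. inverse ((1 + \<mu>) ^ alg_mult K \<mu>))"
      using that by (intro prod.cong) (auto simp: EK_def \<phi>1 mult K1 power_inverse)
    finally show ?thesis
      by (simp add: prod_inversef[symmetric])
  qed
  then have "\<forall>\<^sub>F F in finite_subsets_at_top EK.
      inverse (\<Prod>\<mu>\<in>\<phi> ` F. (1 + \<mu>) ^ alg_mult J \<mu>) = (\<Prod>\<mu>\<in>F. (1 + \<mu>) ^ alg_mult K \<mu>)"
    by (intro eventually_finite_subsets_at_top_weakI) auto
  ultimately have "((\<lambda>F. \<Prod>\<mu>\<in>F. (1 + \<mu>) ^ alg_mult K \<mu>) \<longlongrightarrow> inverse (fdet a c 1)) (finite_subsets_at_top EK)"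
    by (rule Lim_transform_eventually)
  then have "Lim (finite_subsets_at_top EK) (\<lambda>F. \<Prod>\<mu>\<in>F. (1 + \<mu>) ^ alg_mult K \<mu>) = inverse (fdet a c 1)"
    by (intro tendsto_Lim) simp_all
  then show "fredholm_det (V \<circ> the_inv Q) = inverse (fredholm_det (\<lambda>x. x + nuclear a c x))"
    by (simp add: fredholm_det_nuclear[OF ac]) (simp add: fredholm_det_def EK_def K_def[abs_def])
qed

subsection \<open>Trace class operators\<close>

lemma bounded_clinearD:
  assumes "bounded_clinear Q"
  shows "Q (x + y) = Q x + Q y" "Q (t *\<^sub>C x) = t *\<^sub>C Q x" "Q 0 = 0" "Q (x - y) = Q x - Q y"
    "bounded_linear Q"
  using assms unfolding bounded_clinear_def clinear_on_def
  by (auto simp: linear_simps)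

section \<open>Positive operators and Cholesky elimination\<close>

definition psd :: "('h::complex_hilbert \<Rightarrow> 'h) \<Rightarrow> bool"
  where "psd Q \<longleftrightarrow> bounded_clinear Q \<and> (\<forall>x. cinner (Q x) x \<in> \<real>\<^sub>\<ge>\<^sub>0)"

lemma psd_Re: "psd Q \<Longrightarrow> 0 \<le> Re (cinner (Q x) x)" "psd Q \<Longrightarrow> Im (cinner (Q x) x) = 0"
  by (auto simp: psd_def complex_nonneg_Reals_iff)

text \<open>Polarization: the form is real at \<open>x + y\<close>, which relates the imaginary
  parts of the mixed terms, and at \<open>x + \<i> *\<^sub>C y\<close>, which relates their real
  parts.\<close>

lemma psd_hermitian:
  assumes "psd Q"
  shows "cinner (Q x) y = cinner x (Q y)"
proof -
  have l: "bounded_clinear Q"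
    using assms by (simp add: psd_def)
  have "Im (cinner (Q (x + y)) (x + y)) = 0" "Im (cinner (Q (x + \<i> *\<^sub>C y)) (x + \<i> *\<^sub>C y)) = 0"
    "Im (cinner (Q x) x) = 0" "Im (cinner (Q y) y) = 0"
    using psd_Re(2)[OF assms] by blast+
  then have "Im (cinner (Q x) y) = - Im (cinner (Q y) x)" "Re (cinner (Q x) y) = Re (cinner (Q y) x)"
    by (simp_all add: bounded_clinearD[OF l] cinner_algebra)
  then have "cinner (Q x) y = cnj (cinner (Q y) x)"
    by (simp add: complex_eq_iff)
  then show ?thesis
    using cinner_commute[of x "Q y"] by simp
qed

text \<open>With \<open>b\<close> the mixed value, the form at \<open>y - s *\<^sub>C x\<close>,
  \<open>s = t * b\<close>, is a nonnegative quadratic in the real number \<open>t\<close>. For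
  \<open>p > 0\<close> its minimum at \<open>t = 1 / p\<close> gives the claim; for
  \<open>p = 0\<close> and \<open>b \<noteq> 0\<close> it would be negative for large
  \<open>t\<close>.\<close>

lemma psd_Cauchy_Schwarz:
  assumes "psd Q"
  shows "(cmod (cinner (Q x) y))\<^sup>2 \<le> Re (cinner (Q x) x) * Re (cinner (Q y) y)"
proof -
  have l: "bounded_clinear Q"
    using assms by (simp add: psd_def)
  define b where "b = cinner (Q x) y"
  define p where "p = Re (cinner (Q x) x)"
  define q where "q = Re (cinner (Q y) y)"
  have pq: "0 \<le> p" "0 \<le> q"
    using psd_Re(1)[OF assms] by (simp_all add: p_def q_def)
  have b': "cinner (Q y) x = cnj b"
    using psd_hermitian[OF assms, of y x] cinner_commute[of y "Q x"] by (simp add: b_def)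
  have "0 \<le> q - 2 * t * (cmod b)\<^sup>2 + t\<^sup>2 * (cmod b)\<^sup>2 * p" for t :: real
  proof -
    define s where "s = complex_of_real t * b"
    have "0 \<le> Re (cinner (Q (y - s *\<^sub>C x)) (y - s *\<^sub>C x))"
      by (rule psd_Re(1)[OF assms])
    also have "cinner (Q (y - s *\<^sub>C x)) (y - s *\<^sub>C x)
        = cinner (Q y) y - s * cnj b - cnj s * b + cnj s * s * cinner (Q x) x"
      by (simp add: bounded_clinearD[OF l] cinner_algebra b' b_def[symmetric] algebra_simps)
    also have "Re \<dots> = q - 2 * t * (cmod b)\<^sup>2 + t\<^sup>2 * (cmod b)\<^sup>2 * p"
      unfolding cmod_power2 using psd_Re(2)[OF assms, of x]
      by (simp add: s_def q_def p_def power2_eq_square algebra_simps)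
    finally show ?thesis .
  qed
  note quad = this
  show ?thesis
  proof (cases "b = 0")
    case True
    then show ?thesis
      using pq by (simp add: b_def p_def q_def)
  next
    case False
    then have cb: "0 < (cmod b)\<^sup>2"
      by simp
    have "p \<noteq> 0"
    proof
      assume "p = 0"
      then have "2 * ((q + 1) / (cmod b)\<^sup>2) * (cmod b)\<^sup>2 \<le> q"
        using quad[of "(q + 1) / (cmod b)\<^sup>2"] by simp
      then show False
        using cb pq by simp
    qed
    then have "0 < p"
      using pq by simp
    have "0 \<le> q - 2 * (1 / p) * (cmod b)\<^sup>2 + (1 / p)\<^sup>2 * (cmod b)\<^sup>2 * p"
      by (rule quad)
    also have "\<dots> = q - (cmod b)\<^sup>2 / p"
      using \<open>0 < p\<close> by (simp add: power2_eq_square field_simps)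
    finally have "(cmod b)\<^sup>2 \<le> p * q"
      using \<open>0 < p\<close> by (simp add: field_simps)
    then show ?thesis
      by (simp add: b_def p_def q_def)
  qed
qed

lemma psd_zero:
  assumes "psd Q" "cinner (Q x) x = 0"
  shows "Q x = 0"
  using psd_Cauchy_Schwarz[OF assms(1), of x "Q x"] assms(2) by (simp add: cinner_self)

text \<open>One elimination step with pivot vector \<open>e\<close>. Positivity of what remains is
  precisely the Cauchy-Schwarz inequality for \<open>Q\<close>. If the pivot is 0, then
  \<open>Q e = 0\<close> and division by zero leaves \<open>Q\<close> as it is.\<close>

lemma psd_schur_complement:
  fixes Q :: "'h::complex_hilbert \<Rightarrow> 'h" and e y :: 'h
  assumes "psd Q"
  defines "Q' \<equiv> \<lambda>y. Q y - (cinner (Q e) y / cinner (Q e) e) *\<^sub>C Q e"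
  shows "psd Q'" "Re (cinner (Q' y) y) \<le> Re (cinner (Q y) y)" "Q' e = 0" "Q y = 0 \<Longrightarrow> Q' y = 0"
    "Re (cinner (Q' y) y) = Re (cinner (Q y) y) - (cmod (cinner (Q e) y))\<^sup>2 / Re (cinner (Q e) e)"
proof -
  have l: "bounded_clinear Q"
    using assms by (simp add: psd_def)
  have "bounded_linear (\<lambda>y. (cinner (Q e) y / cinner (Q e) e) *\<^sub>C Q e)"
    by (intro bounded_linear_compose[OF bounded_linear_scaleC_left]
        bounded_linear_compose[OF bounded_linear_divide] bounded_linear_cinner_right)
  then have "bounded_linear Q'"
    unfolding Q'_def by (intro bounded_linear_sub bounded_clinearD(5)[OF l])
  then have "bounded_clinear Q'"
    by (simp add: bounded_clinear_def clinear_on_def Q'_def bounded_clinearD[OF l] cinner_algebra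
        scaleC_algebra add_divide_distrib)
  define q where "q = Re (cinner (Q e) e)"
  have q: "cinner (Q e) e = of_real q"
    using psd_Re(2)[OF assms(1), of e] by (simp add: q_def complex_eq_iff)
  have *: "cinner (Q' y) y = cinner (Q y) y - of_real ((cmod (cinner (Q e) y))\<^sup>2 / q)" for y
    by (simp add: Q'_def cinner_algebra q complex_norm_square[symmetric] mult.commute[of "cnj _"] del: of_real_power)
  show eq: "Re (cinner (Q' y) y) = Re (cinner (Q y) y) - (cmod (cinner (Q e) y))\<^sup>2 / Re (cinner (Q e) e)" for y
    by (simp add: * q_def)
  have le: "(cmod (cinner (Q e) y))\<^sup>2 / q \<le> Re (cinner (Q y) y)" for y
  proof (cases "q = 0")
    case False
    then have "0 < q"
      using psd_Re(1)[OF assms(1), of e] by (simp add: q_def)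
    then show ?thesis
      using psd_Cauchy_Schwarz[OF assms(1), of e y] by (simp add: q_def field_simps)
  qed (use psd_Re(1)[OF assms(1), of y] in simp)
  have "cinner (Q' y) y \<in> \<real>\<^sub>\<ge>\<^sub>0" for y
    using le[of y] psd_Re(2)[OF assms(1), of y] by (simp add: * complex_nonneg_Reals_iff)
  then show "psd Q'"
    using \<open>bounded_clinear Q'\<close> by (simp add: psd_def)
  have "0 \<le> q"
    using psd_Re(1)[OF assms(1), of e] by (simp add: q_def)
  then show "Re (cinner (Q' y) y) \<le> Re (cinner (Q y) y)"
    by (simp add: eq flip: q_def)
  show "Q' e = 0"
    using psd_zero[OF assms(1), of e] by (cases "cinner (Q e) e = 0") (simp_all add: Q'_def)
  show "Q' y = 0" if "Q y = 0"
    using that psd_hermitian[OF assms(1), of e y] by (simp add: Q'_def)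
qed

text \<open>\<open>P \<circ> chol P e n\<close> is what remains of the positive operator \<open>P\<close> after \<open>n\<close> steps of Cholesky
  elimination with pivot vectors \<open>e\<close>. A vanishing pivot causes no step, since \<open>x / 0 = 0\<close>.\<close>

primrec chol :: "('h::complex_hilbert \<Rightarrow> 'h) \<Rightarrow> (nat \<Rightarrow> 'h) \<Rightarrow> nat \<Rightarrow> 'h \<Rightarrow> 'h" where
  "chol P e 0 = (\<lambda>y. y)"
| "chol P e (Suc n) = (\<lambda>y. chol P e n y -
    (cinner (P (chol P e n (e n))) y / cinner (P (chol P e n (e n))) (e n)) *\<^sub>C chol P e n (e n))"

text \<open>Step \<open>j\<close> kills \<open>e j\<close>, and an elimination step enlarges the
  kernel, so earlier pivot vectors stay killed.\<close>

lemma chol: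
  assumes "psd P"
  shows "psd (\<lambda>y. P (chol P e n y))" "Re (cinner (P (chol P e n y)) y) \<le> Re (cinner (P y) y)"
    "j < n \<Longrightarrow> P (chol P e n (e j)) = 0"
proof -
  have l: "bounded_clinear P"
    using assms by (simp add: psd_def)
  have step: "P (chol P e (Suc n) y) = P (chol P e n y) -
      (cinner (P (chol P e n (e n))) y / cinner (P (chol P e n (e n))) (e n)) *\<^sub>C P (chol P e n (e n))" for n y
    by (simp add: bounded_clinearD[OF l])
  have 1: "psd (\<lambda>y. P (chol P e n y))" for n
  proof (induction n)
    case (Suc n)
    show ?case
      unfolding step by (rule psd_schur_complement(1)[OF Suc])
  qed (simp add: assms)
  then show "psd (\<lambda>y. P (chol P e n y))" .
  show "Re (cinner (P (chol P e n y)) y) \<le> Re (cinner (P y) y)"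
  proof (induction n)
    case (Suc n)
    show ?case
      unfolding step by (rule order.trans[OF psd_schur_complement(2)[OF 1] Suc])
  qed simp
  show "P (chol P e n (e j)) = 0" if "j < n"
    using that
  proof (induction n)
    case (Suc n)
    show ?case
    proof (cases "j = n")
      case True
      show ?thesis
        unfolding step True by (rule psd_schur_complement(3)[OF 1])
    next
      case False
      then have "P (chol P e n (e j)) = 0"
        using Suc by simp
      then show ?thesis
        unfolding step by (rule psd_schur_complement(4)[OF 1])
    qed
  qed simp
qed

text \<open>The sum is the squared norm of the projection \<open>p\<close> of \<open>v\<close> onto
  the span of \<open>G\<close>, and \<open>p\<close> is at least as close to \<open>v\<close> as the
  approximation \<open>w\<close>, which lies in the span of \<open>F\<close>.\<close>

lemma norm_sq_le_Bessel:
  assumes E: "orthonormal_basis E" and "0 < \<epsilon>"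
  obtains F where "finite F" "F \<subseteq> E"
    "\<And>G. finite G \<Longrightarrow> F \<subseteq> G \<Longrightarrow> G \<subseteq> E \<Longrightarrow> (norm v)\<^sup>2 \<le> (\<Sum>e\<in>G. (cmod (cinner v e))\<^sup>2) + \<epsilon>"
proof -
  have "v \<in> closure (complex_vector.span E)"
    using E by (simp add: orthonormal_basis_def)
  then obtain w where w: "w \<in> complex_vector.span E" "dist w v < sqrt \<epsilon>"
    using assms(2) by (metis closure_approachable real_sqrt_gt_zero)
  obtain F r where F: "finite F" "F \<subseteq> E" "w = (\<Sum>e\<in>F. r e *\<^sub>C e)"
    using w(1) unfolding complex_vector.span_explicit by blast
  show thesis
  proof (rule that[OF F(1,2)])
    fix G
    assume G: "finite G" "F \<subseteq> G" "G \<subseteq> E"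
    have orth: "cinner x y = (if x = y then 1 else 0)" if "x \<in> G" "y \<in> G" for x y
      using E that G unfolding orthonormal_basis_def by blast
    define p where "p = (\<Sum>e\<in>G. cinner e v *\<^sub>C e)"
    have ep: "cinner e p = cinner e v" if "e \<in> G" for e
      using that G(1) by (simp add: p_def cinner_sum_right cinner_scaleC_right orth
          if_distrib[of "\<lambda>x. _ * x"] cong: if_cong)
    have gp: "cinner g (v - p) = 0" if g: "g \<in> complex_vector.span G" for g
    proof -
      obtain r where "g = (\<Sum>e\<in>G. r e *\<^sub>C e)"
        using g unfolding complex_vector.span_finite[OF G(1)] by blast
      then show ?thesis
        by (simp add: cinner_sum_left cinner_scaleC_left cinner_diff_right ep)
    qed
    have pG: "p \<in> complex_vector.span G"
      unfolding p_def by (intro span_intros)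
    have "w \<in> complex_vector.span F"
      unfolding F(3) by (intro span_intros)
    then have wG: "w - p \<in> complex_vector.span G"
      using complex_vector.span_mono[OF G(2)] pG complex_vector.span_diff by blast
    have *: "(norm (x + y))\<^sup>2 = (norm x)\<^sup>2 + (norm y)\<^sup>2" if "cinner x y = 0" for x y :: 'a
    proof -
      have "cinner y x = 0"
        using that cinner_commute[of y x] by simp
      then have "complex_of_real ((norm (x + y))\<^sup>2) = complex_of_real ((norm x)\<^sup>2 + (norm y)\<^sup>2)"
        using that by (simp add: cinner_self[symmetric] cinner_algebra del: of_real_power)
      then show ?thesis
        using of_real_eq_iff by blast
    qed
    have "(norm v)\<^sup>2 = (norm (p + (v - p)))\<^sup>2"
      by simp
    also have "\<dots> = (norm p)\<^sup>2 + (norm (v - p))\<^sup>2"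
      by (rule *[OF gp[OF pG]])
    also have "(norm p)\<^sup>2 = (\<Sum>e\<in>G. (cmod (cinner v e))\<^sup>2)"
    proof -
      have "complex_of_real ((norm p)\<^sup>2) = (\<Sum>e\<in>G. cnj (cinner e v) * cinner e v)"
        unfolding cinner_self[symmetric]
        by (subst (1) p_def) (simp add: cinner_sum_left cinner_scaleC_left ep)
      also have "\<dots> = complex_of_real (\<Sum>e\<in>G. (cmod (cinner v e))\<^sup>2)"
        by (simp add: complex_norm_square cinner_commute[of v x for x] mult.commute del: of_real_power)
      finally show ?thesis
        using of_real_eq_iff by blast
    qed
    also have "(norm (v - p))\<^sup>2 \<le> (norm ((w - p) - (v - p)))\<^sup>2"
    proof -
      have "cinner (w - p) (- (v - p)) = 0"
        by (simp add: cinner_minus_right gp[OF wG] del: minus_diff_eq)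
      from *[OF this] show ?thesis
        by (simp add: norm_minus_commute)
    qed
    also have "\<dots> \<le> (sqrt \<epsilon>)\<^sup>2"
      using w(2) by (intro power_mono) (auto simp: dist_norm)
    also have "\<dots> = \<epsilon>"
      using assms(2) by simp
    finally show "(norm v)\<^sup>2 \<le> (\<Sum>e\<in>G. (cmod (cinner v e))\<^sup>2) + \<epsilon>"
      by simp
  qed
qed

text \<open>Cholesky elimination expands \<open>P\<close> as the sum of the
  \<open>cinner (v k) x *\<^sub>C v k\<close> with \<open>v k = P (d k)\<close>. The remainder acts
  from the right, and \<open>K\<close> and \<open>P\<close> have equal norms on every vector, so
  applying \<open>K\<close> to the \<open>d k\<close> expands \<open>K\<close> in the same way.
  Positivity of the remainders bounds the sum of the squared norms of the \<open>v k\<close> by the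
  trace of \<open>P\<close>.\<close>

lemma trace_class_imp_nuclear:
  fixes K :: "'h::complex_hilbert \<Rightarrow> 'h"
  assumes "trace_class K"
  obtains a c where "sqsum a" "sqsum c" "K = nuclear a c"
proof -
  obtain P E where K: "bounded_clinear K" and P: "is_abs_op K P" and E: "orthonormal_basis E"
    and sum: "(\<lambda>e. cinner (P e) e) summable_on E"
    using assms by (auto simp: trace_class_def)
  have psd: "psd P" and PK: "\<And>x y. cinner (P (P x)) y = cinner (K x) (K y)"
    using P by (auto simp: is_abs_op_def psd_def)
  have l: "bounded_clinear P"
    using psd by (simp add: psd_def)
  have normK: "norm (K x) = norm (P x)" for x
  proof -
    have "complex_of_real ((norm (K x))\<^sup>2) = complex_of_real ((norm (P x))\<^sup>2)"
      by (simp only: cinner_self[symmetric] PK[symmetric] psd_hermitian[OF psd, of "P x"])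
    then show ?thesis
      using of_real_eq_iff power2_eq_iff_nonneg norm_ge_zero by blast
  qed
  define q where "q e = Re (cinner (P e) e)" for e
  have q0: "0 \<le> q e" for e
    using psd_Re(1)[OF psd] by (simp add: q_def)
  have q: "q summable_on E"
    using summable_on_Re[OF sum] by (simp add: q_def[abs_def])
  \<comment> \<open>The basis may be uncountable, but only countably many of its vectors have a
    nonzero diagonal entry; \<open>P\<close> kills the others. The vector 0 makes the set nonempty
    for its enumeration and, as a pivot, causes no step.\<close>
  define S where "S = insert 0 {e \<in> E. q e \<noteq> 0}"
  have "countable {e \<in> E. q e \<noteq> 0}"
    using q by (rule summable_countable_real)
  then have "countable S"
    by (simp add: S_def)
  define e where "e = from_nat_into S"
  have e: "range e = S"
    unfolding e_def using \<open>countable S\<close> by (intro range_from_nat_into) (auto simp: S_def)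
  define R where "R = chol P e"
  define s where "s n = Re (cinner (P (R n (e n))) (e n))" for n
  note chol = chol[OF psd, where e = e, folded R_def]
  have s: "cinner (P (R n (e n))) (e n) = complex_of_real (s n)" "0 \<le> s n" for n
    using psd_Re[OF chol(1)[of n]] by (simp_all add: s_def complex_eq_iff)
  \<comment> \<open>Scaled so that each step subtracts \<open>cinner (v n) y *\<^sub>C v n\<close>
    from \<open>P (R n y)\<close>. A vanishing pivot gives \<open>d n = 0\<close>, again by division
    by zero.\<close>
  define d where "d n = complex_of_real (1 / sqrt (s n)) *\<^sub>C R n (e n)" for n
  define v where "v n = P (d n)" for n
  have v: "v n = complex_of_real (1 / sqrt (s n)) *\<^sub>C P (R n (e n))" for n
    by (simp add: v_def d_def bounded_clinearD[OF l])
  have ss: "sqrt (s n) * sqrt (s n) = s n" for n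
    using s(2) by simp
  have R_Suc: "R (Suc n) y = R n y - cinner (v n) y *\<^sub>C d n" for n y
    by (simp add: R_def s(1)[unfolded R_def] v[unfolded R_def] d_def[unfolded R_def] cinner_scaleC_left
        scaleC_scaleC ss s(2) abs_of_nonneg[OF s(2)[unfolded R_def]] flip: of_real_mult)
  have R_sum: "R n y = y - (\<Sum>k<n. cinner (v k) y *\<^sub>C d k)" for n y
  proof (induction n)
    case (Suc n)
    then show ?case
      by (simp add: R_Suc)
  qed (simp add: R_def)
  have PR_sum: "P (R n y) = P y - (\<Sum>k<n. cinner (v k) y *\<^sub>C v k)" for n y
    unfolding R_sum bounded_clinearD[OF l] v_def
    by (simp add: linear_sum[OF bounded_linear.linear[OF bounded_clinearD(5)[OF l]]] bounded_clinearD[OF l])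
  obtain C where C: "\<And>x. norm (P x) \<le> norm x * C" "0 < C"
    using bounded_linear.pos_bounded[OF bounded_clinearD(5)[OF l]] by blast
  \<comment> \<open>For a positive operator the squared norm of an image is at most the operator
    bound times the quadratic form. The constant \<open>C\<close> of \<open>P\<close> serves all
    remainders, since their forms lie below that of \<open>P\<close>.\<close>
  have bound: "(norm (P (R n x)))\<^sup>2 \<le> C * Re (cinner (P (R n x)) x)" for n x
  proof -
    define u where "u = P (R n x)"
    have "((norm u)\<^sup>2)\<^sup>2 \<le> Re (cinner u x) * Re (cinner (P (R n u)) u)"
      using psd_Cauchy_Schwarz[OF chol(1)[of n], of x u] by (simp add: u_def[symmetric] cinner_self norm_power)
    also have "\<dots> \<le> Re (cinner u x) * (C * (norm u)\<^sup>2)"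
    proof (rule mult_left_mono)
      have "Re (cinner (P (R n u)) u) \<le> Re (cinner (P u) u)"
        by (rule chol(2))
      also have "\<dots> \<le> norm (P u) * norm u"
        using complex_Re_le_cmod cinner_Cauchy_Schwarz by (rule order.trans)
      also have "\<dots> \<le> C * (norm u)\<^sup>2"
        using mult_right_mono[OF C(1)[of u], of "norm u"] by (simp add: power2_eq_square mult_ac)
      finally show "Re (cinner (P (R n u)) u) \<le> C * (norm u)\<^sup>2" .
      show "0 \<le> Re (cinner u x)"
        using psd_Re(1)[OF chol(1)[of n], of x] by (simp add: u_def)
    qed
    finally have "(norm u)\<^sup>2 * (norm u)\<^sup>2 \<le> (C * Re (cinner u x)) * (norm u)\<^sup>2"
      by (simp add: power2_eq_square mult_ac)
    moreover have "0 \<le> C * Re (cinner u x)"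
      using psd_Re(1)[OF chol(1)[of n], of x] C(2) by (simp add: u_def)
    ultimately show ?thesis
      unfolding u_def[symmetric] by (cases "u = 0") (simp_all only: mult_le_cancel_right, simp_all)
  qed
  have normPR: "norm (P (R n x)) \<le> C * norm x" for n x
  proof -
    have "Re (cinner (P (R n x)) x) \<le> norm (P (R n x)) * norm x"
      using complex_Re_le_cmod cinner_Cauchy_Schwarz by (rule order.trans)
    then have "(norm (P (R n x)))\<^sup>2 \<le> C * (norm (P (R n x)) * norm x)"
      using bound[of n x] mult_left_mono[of _ _ C] C(2) by (meson less_imp_le order.trans)
    then have "norm (P (R n x)) * norm (P (R n x)) \<le> (C * norm x) * norm (P (R n x))"
      by (simp add: power2_eq_square mult_ac)
    then show ?thesis
      using C(2) by (cases "P (R n x) = 0") (simp_all add: mult_le_cancel_right)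
  qed
  have R_add: "P (R n (x + y)) = P (R n x) + P (R n y)" and R_scale: "P (R n (t *\<^sub>C x)) = t *\<^sub>C P (R n x)"
    and R_diff: "P (R n (x - y)) = P (R n x) - P (R n y)" for n x y t
    using chol(1)[of n] bounded_clinearD[of "\<lambda>x. P (R n x)"] by (auto simp: psd_def)
  have lim_E: "(\<lambda>n. P (R n x)) \<longlonglongrightarrow> 0" if "x \<in> E" for x
  proof (cases "q x = 0")
    case True
    have "P (R n x) = 0" for n
    proof -
      have "Re (cinner (P (R n x)) x) \<le> 0"
        using chol(2)[of n x] True by (simp add: q_def)
      then have "cinner (P (R n x)) x = 0"
        using psd_Re[OF chol(1)[of n], of x] by (simp add: complex_eq_iff)
      then show ?thesis
        by (rule psd_zero[OF chol(1)])
    qed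
    then show ?thesis by simp
  next
    case False
    then have "x \<in> range e"
      using that by (simp add: e S_def)
    then obtain j where "x = e j"
      by blast
    then have "\<forall>\<^sub>F n in sequentially. P (R n x) = 0"
      using chol(3) by (intro eventually_sequentiallyI[of "Suc j"]) auto
    then show ?thesis
      by (rule tendsto_eventually)
  qed
  have lim_span: "(\<lambda>n. P (R n x)) \<longlonglongrightarrow> 0" if "x \<in> complex_vector.span E" for x
    using that
  proof (induction rule: complex_vector.span_induct_alt)
    case base
    have "P (R n 0) = 0" for n
      using R_scale[of n 0 0] by simp
    then show ?case by simp
  next
    case (step t x y)
    have "(\<lambda>n. t *\<^sub>C P (R n x) + P (R n y)) \<longlonglongrightarrow> t *\<^sub>C 0 + 0"
      using step lim_E by (intro tendsto_add bounded_linear.tendsto[OF bounded_linear_scaleC])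
    then show ?case
      by (simp add: R_add R_scale)
  qed
  \<comment> \<open>The bound \<open>normPR\<close> is uniform in \<open>n\<close>, so convergence
    extends from the dense span to all vectors.\<close>
  have lim: "(\<lambda>n. P (R n x)) \<longlonglongrightarrow> 0" for x
  proof (rule tendstoI)
    fix \<epsilon> :: real
    assume "0 < \<epsilon>"
    have "x \<in> closure (complex_vector.span E)"
      using E by (simp add: orthonormal_basis_def)
    then obtain w where w: "w \<in> complex_vector.span E" "dist w x < \<epsilon> / (2 * C)"
      using \<open>0 < \<epsilon>\<close> C(2) by (metis closure_approachable divide_pos_pos mult_pos_pos zero_less_numeral)
    have "\<forall>\<^sub>F n in sequentially. dist (P (R n w)) 0 < \<epsilon> / 2"
      using tendstoD[OF lim_span[OF w(1)], of "\<epsilon> / 2"] \<open>0 < \<epsilon>\<close> by simp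
    then show "\<forall>\<^sub>F n in sequentially. dist (P (R n x)) 0 < \<epsilon>"
    proof eventually_elim
      case (elim n)
      have "norm (P (R n x) - P (R n w)) \<le> C * norm (x - w)"
        using normPR[of n "x - w"] by (simp add: R_diff)
      also have "\<dots> < \<epsilon> / 2"
        using w(2) C(2) by (simp add: dist_norm norm_minus_commute field_simps)
      finally show ?case
        using elim norm_triangle_ineq[of "P (R n w)" "P (R n x) - P (R n w)"] by simp
    qed
  qed
  have sv: "sqsum v"
    unfolding sqsum_def
  proof (rule bounded_imp_summable)
    fix n
    have "(\<Sum>k\<le>n. (norm (v k))\<^sup>2) \<le> infsum q E + \<delta>" if "0 < \<delta>" for \<delta>
    proof -
      \<comment> \<open>There are \<open>Suc n\<close> vectors \<open>v k\<close>, each of which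
        loses \<epsilon> when its norm is computed from finitely many coordinates.\<close>
      define \<epsilon> where "\<epsilon> = \<delta> / Suc n"
      have "0 < \<epsilon>"
        using that by (simp add: \<epsilon>_def)
      then have "\<exists>F. finite F \<and> F \<subseteq> E \<and> (\<forall>G. finite G \<longrightarrow> F \<subseteq> G \<longrightarrow> G \<subseteq> E \<longrightarrow>
          (norm (v k))\<^sup>2 \<le> (\<Sum>e\<in>G. (cmod (cinner (v k) e))\<^sup>2) + \<epsilon>)" for k
        using norm_sq_le_Bessel[OF E] by metis
      then obtain F where F: "\<And>k. finite (F k)" "\<And>k. F k \<subseteq> E"
        "\<And>k G. finite G \<Longrightarrow> F k \<subseteq> G \<Longrightarrow> G \<subseteq> E \<Longrightarrow>
          (norm (v k))\<^sup>2 \<le> (\<Sum>e\<in>G. (cmod (cinner (v k) e))\<^sup>2) + \<epsilon>"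
        by metis
      define G where "G = (\<Union>k\<le>n. F k)"
      have G: "finite G" "G \<subseteq> E" "\<And>k. k \<le> n \<Longrightarrow> F k \<subseteq> G"
        using F(1,2) by (auto simp: G_def)
      have "(\<Sum>k\<le>n. (norm (v k))\<^sup>2) \<le> (\<Sum>k\<le>n. (\<Sum>e\<in>G. (cmod (cinner (v k) e))\<^sup>2) + \<epsilon>)"
        using F(3)[OF G(1) _ G(2)] G(3) by (intro sum_mono) simp
      also have "\<dots> = (\<Sum>e\<in>G. \<Sum>k\<le>n. (cmod (cinner (v k) e))\<^sup>2) + \<delta>"
        by (subst sum.swap) (simp add: sum.distrib \<epsilon>_def)
      also have "(\<Sum>e\<in>G. \<Sum>k\<le>n. (cmod (cinner (v k) e))\<^sup>2) \<le> (\<Sum>e\<in>G. q e)"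
      proof (rule sum_mono)
        fix x
        have "cinner (P (R (Suc n) x)) x = cinner (P x) x - (\<Sum>k\<le>n. complex_of_real ((cmod (cinner (v k) x))\<^sup>2))"
          by (simp add: PR_sum cinner_diff_left cinner_sum_left cinner_scaleC_left complex_norm_square
              mult.commute lessThan_Suc_atMost del: of_real_power sum.lessThan_Suc)
        then have "q x - (\<Sum>k\<le>n. (cmod (cinner (v k) x))\<^sup>2) = Re (cinner (P (R (Suc n) x)) x)"
          by (simp add: q_def)
        also have "\<dots> \<ge> 0"
          by (rule psd_Re(1)[OF chol(1)])
        finally show "(\<Sum>k\<le>n. (cmod (cinner (v k) x))\<^sup>2) \<le> q x"
          by simp
      qed
      also have "(\<Sum>e\<in>G. q e) \<le> infsum q E"
        using q G q0 by (intro finite_sum_le_infsum) auto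
      finally show ?thesis by simp
    qed
    then show "(\<Sum>k\<le>n. (norm (v k))\<^sup>2) \<le> infsum q E"
      by (rule field_le_epsilon)
  qed simp
  define a where "a n = K (d n)" for n
  have sa: "sqsum a"
    using sv by (simp add: sqsum_def a_def normK v_def)
  have "K x = nuclear a v x" for x
  proof -
    have KR: "K (R n x) = K x - (\<Sum>k<n. cinner (v k) x *\<^sub>C a k)" for n
      unfolding R_sum bounded_clinearD[OF K] a_def
      by (simp add: linear_sum[OF bounded_linear.linear[OF bounded_clinearD(5)[OF K]]] bounded_clinearD[OF K])
    have "(\<lambda>n. norm (P (R n x))) \<longlonglongrightarrow> norm (0 :: 'h)"
      by (intro tendsto_norm lim)
    then have "(\<lambda>n. K (R n x)) \<longlonglongrightarrow> 0"
      by (rule null_sequence_le) (simp_all add: normK)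
    from tendsto_diff[OF tendsto_const[of "K x"] this]
    have "(\<lambda>n. \<Sum>k<n. cinner (v k) x *\<^sub>C a k) \<longlonglongrightarrow> K x"
      by (simp add: KR)
    then show ?thesis
      by (simp add: nuclear_def sums_def[symmetric] sums_iff)
  qed
  then have "K = nuclear a v"
    by (rule ext)
  with sa sv show thesis
    by (rule that)
qed

subsection \<open>Orthogonal projections onto finite-dimensional subspaces\<close>

lemma finite_orthonormal_span:
  fixes B :: "'h::complex_hilbert set"
  assumes "finite B"
  shows "\<exists>Q. finite Q \<and> complex_vector.span Q = complex_vector.span B \<and>
    (\<forall>x\<in>Q. \<forall>y\<in>Q. cinner x y = (if x = y then 1 else 0))"
  using assms
proof (induction B rule: finite_induct)
  case empty
  show ?case by (intro exI[of _ "{}"]) simp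
next
  case (insert b B)
  then obtain Q where Q: "finite Q" "complex_vector.span Q = complex_vector.span B"
    and orth: "\<And>x y. x \<in> Q \<Longrightarrow> y \<in> Q \<Longrightarrow> cinner x y = (if x = y then 1 else 0)"
    by blast
  define p where "p = (\<Sum>q\<in>Q. cinner q b *\<^sub>C q)"
  have p: "p \<in> complex_vector.span Q"
    unfolding p_def by (intro span_intros)
  have qp: "cinner q (b - p) = 0" if "q \<in> Q" for q
    using that Q(1) by (simp add: p_def cinner_diff_right cinner_sum_right cinner_scaleC_right orth
        if_distrib[of "\<lambda>x. _ * x"] cong: if_cong)
  show ?case
  proof (cases "b = p")
    case True
    then have "complex_vector.span (insert b B) = complex_vector.span B"
      using p Q(2) complex_vector.span_redundant by metis
    then show ?thesis
      using Q orth by (intro exI[of _ Q]) simp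
  next
    case False
    define x where "x = complex_of_real (inverse (norm (b - p))) *\<^sub>C (b - p)"
    have x: "cinner x x = 1"
      using False by (simp add: cinner_self x_def norm_scaleC norm_inverse)
    have qx: "cinner q x = 0" "cinner x q = 0" if "q \<in> Q" for q
      using qp[OF that] cinner_commute[of x q] by (simp_all add: x_def cinner_scaleC_right)
    have b: "b = p + complex_of_real (norm (b - p)) *\<^sub>C x"
      using False by (simp add: x_def scaleC_scaleC flip: of_real_mult)
    have "complex_vector.span (insert x Q) = complex_vector.span (insert b Q)"
    proof (intro equalityI complex_vector.span_minimal complex_vector.subspace_span insert_subsetI)
      have pQ: "p \<in> complex_vector.span (insert y Q)" for y
        using p complex_vector.span_mono[of Q "insert y Q"] by blast
      show "x \<in> complex_vector.span (insert b Q)"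
        unfolding x_def
        by (intro complex_vector.span_scale complex_vector.span_diff pQ complex_vector.span_base) simp
      show "b \<in> complex_vector.span (insert x Q)"
        by (subst b, intro complex_vector.span_add pQ complex_vector.span_scale complex_vector.span_base) simp
      show "Q \<subseteq> complex_vector.span (insert b Q)" "Q \<subseteq> complex_vector.span (insert x Q)"
        using complex_vector.span_superset by blast+
    qed
    then have "complex_vector.span (insert x Q) = complex_vector.span (insert b B)"
      unfolding complex_vector.span_insert Q(2) by simp
    moreover have "x \<notin> Q"
      using qx(1)[of x] x by auto
    ultimately show ?thesis
      using Q(1) orth x qx by (intro exI[of _ "insert x Q"]) auto
  qed
qed

lemma orth_proj_finite:
  fixes M :: "'h::complex_hilbert set"
  assumes M: "complex_vector.span B = M" "finite B"
  obtains Q where "finite Q" "complex_vector.span Q = M" "\<And>x. orth_proj M x = (\<Sum>q\<in>Q. cinner q x *\<^sub>C q)"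
    "\<And>x. x \<in> M \<Longrightarrow> orth_proj M x = x"
proof -
  obtain Q where Q: "finite Q" "complex_vector.span Q = M"
    and orth: "\<And>x y. x \<in> Q \<Longrightarrow> y \<in> Q \<Longrightarrow> cinner x y = (if x = y then 1 else 0)"
    using finite_orthonormal_span[OF M(2)] unfolding M(1) by blast
  have proj: "orth_proj M x = y" if y: "y \<in> M" "\<And>q. q \<in> Q \<Longrightarrow> cinner q (x - y) = 0" for x y
    unfolding orth_proj_def
  proof (rule the_equality)
    have "cinner z (x - y) = 0" if z: "z \<in> M" for z
    proof -
      obtain r where "z = (\<Sum>e\<in>Q. r e *\<^sub>C e)"
        using z unfolding Q(2)[symmetric] complex_vector.span_finite[OF Q(1)] by blast
      then show ?thesis
        using y(2) by (simp add: cinner_sum_left cinner_scaleC_left)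
    qed
    then show 1: "y \<in> M \<and> (\<forall>z\<in>M. cinner z (x - y) = 0)"
      using y(1) by blast
    fix y' assume 2: "y' \<in> M \<and> (\<forall>z\<in>M. cinner z (x - y') = 0)"
    have "y - y' \<in> M"
      using 1 2 complex_vector.span_diff Q(2) by metis
    then have "cinner (y - y') (x - y') - cinner (y - y') (x - y) = 0"
      using 1 2 by simp
    then have "cinner (y - y') (y - y') = 0"
      by (simp add: cinner_diff_right)
    then show "y' = y"
      by (simp add: cinner_self)
  qed
  show thesis
  proof (rule that[OF Q])
    show "orth_proj M x = (\<Sum>q\<in>Q. cinner q x *\<^sub>C q)" for x
    proof (rule proj)
      show "(\<Sum>q\<in>Q. cinner q x *\<^sub>C q) \<in> M"
        unfolding Q(2)[symmetric]
        by (intro span_intros)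
      show "cinner q (x - (\<Sum>q\<in>Q. cinner q x *\<^sub>C q)) = 0" if "q \<in> Q" for q
        using that Q(1) by (simp add: cinner_diff_right cinner_sum_right cinner_scaleC_right orth
            if_distrib[of "\<lambda>x. _ * x"] cong: if_cong)
    qed
    show "orth_proj M x = x" if "x \<in> M" for x
      by (rule proj) (use that in simp_all)
  qed
qed

lemma clinear_on_sum:
  assumes g: "clinear_on M g" and M: "complex_vector.subspace M" and v: "\<And>i. i \<in> I \<Longrightarrow> v i \<in> M"
  shows "g (\<Sum>i\<in>I. r i *\<^sub>C v i) = (\<Sum>i\<in>I. r i *\<^sub>C g (v i))"
proof -
  have g0: "g 0 = 0"
    using g complex_vector.subspace_0[OF M] complex_vector.scale_zero_left
    unfolding clinear_on_def by metis
  show ?thesis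
    using v
  proof (induction I rule: infinite_finite_induct)
    case (insert i I)
    have "r i *\<^sub>C v i \<in> M" "(\<Sum>i\<in>I. r i *\<^sub>C v i) \<in> M"
      using insert.prems M
      by (auto intro!: complex_vector.subspace_sum complex_vector.subspace_scale)
    then show ?case
      using insert g by (simp add: clinear_on_def)
  qed (simp_all add: g0)
qed

text \<open>The Riesz vector, written in an orthonormal basis of \<open>M\<close>. Through it
  \<open>L \<circ> \<pi>\<close> becomes a finite sum of terms
  \<open>cinner (w k) x *\<^sub>C L (e k)\<close>.\<close>

lemma functional_orth_proj:
  fixes M :: "'h::complex_hilbert set"
  assumes M: "complex_vector.span B = M" "finite B" and g: "clinear_on M (g :: 'h \<Rightarrow> complex)"
  obtains w where "\<And>x. g (orth_proj M x) = cinner w x"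
proof -
  obtain Q where Q: "finite Q" "complex_vector.span Q = M"
    "\<And>x. orth_proj M x = (\<Sum>q\<in>Q. cinner q x *\<^sub>C q)"
    using orth_proj_finite[OF M] by metis
  have "g (orth_proj M x) = cinner (\<Sum>q\<in>Q. cnj (g q) *\<^sub>C q) x" for x
    unfolding Q(3) cinner_sum_left
    by (subst clinear_on_sum[OF g])
      (auto simp: M(1)[symmetric] cinner_scaleC_left scaleC_complex_def mult.commute
        complex_vector.subspace_span Q(2)[unfolded M(1)[symmetric], symmetric] complex_vector.span_base)
  then show thesis
    by (rule that)
qed

subsection \<open>Bases modulo a subspace\<close>

text \<open>The list represents a basis of \<open>X\<close> modulo \<open>U\<close>, expressed
  without the quotient. With \<open>U\<close> the range of \<open>T\<close> it describes complements
  of the range, with \<open>U = {0}\<close> bases of the kernel.\<close>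

definition basis_mod :: "'v::complex_vector set \<Rightarrow> 'v set \<Rightarrow> 'v list \<Rightarrow> bool"
  where "basis_mod X U zs \<longleftrightarrow> set zs \<subseteq> X \<and>
    (\<forall>\<beta>. (\<Sum>k<length zs. \<beta> k *\<^sub>C zs ! k) \<in> U \<longrightarrow> (\<forall>k<length zs. \<beta> k = 0)) \<and>
    (\<forall>v\<in>X. \<exists>\<beta>. v - (\<Sum>k<length zs. \<beta> k *\<^sub>C zs ! k) \<in> U)"

lemma sum_list_update:
  fixes zs :: "'v::complex_vector list"
  assumes "i < length zs"
  shows "(\<Sum>k<length zs. \<gamma> k *\<^sub>C zs[i := v] ! k) = (\<Sum>k<length zs. \<gamma> k *\<^sub>C zs ! k) + \<gamma> i *\<^sub>C (v - zs ! i)"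
proof -
  have "(\<Sum>k<length zs. \<gamma> k *\<^sub>C zs[i := v] ! k)
      = (\<Sum>k<length zs. \<gamma> k *\<^sub>C zs ! k + (if k = i then \<gamma> i *\<^sub>C (v - zs ! i) else 0))"
    using assms by (intro sum.cong) (auto simp: scaleC_algebra)
  then show ?thesis
    using assms by (simp add: sum.distrib)
qed

text \<open>Steinitz exchange modulo \<open>U\<close>: the coordinates of the new list determine
  those of the old one by the triangular formula \<open>key\<close>, which is invertible because of
  \<open>\<beta> i \<noteq> 0\<close>.\<close>

lemma basis_mod_exchange:
  assumes zs: "basis_mod X U zs" and i: "i < length zs" and X: "complex_vector.subspace X"
    and U: "complex_vector.subspace U" "U \<subseteq> X"
    and v: "v - (\<Sum>k<length zs. \<beta> k *\<^sub>C zs ! k) \<in> U" and \<beta>: "\<beta> i \<noteq> 0"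
  shows "basis_mod X U (zs[i := v])"
proof -
  define u where "u = v - (\<Sum>k<length zs. \<beta> k *\<^sub>C zs ! k)"
  have key: "(\<Sum>k<length zs. \<gamma> k *\<^sub>C zs[i := v] ! k)
      = (\<Sum>k<length zs. (\<gamma> k + \<gamma> i * (\<beta> k - (if k = i then 1 else 0))) *\<^sub>C zs ! k) + \<gamma> i *\<^sub>C u" for \<gamma>
  proof -
    have "(\<Sum>k<length zs. (\<gamma> k + \<gamma> i * (\<beta> k - (if k = i then 1 else 0))) *\<^sub>C zs ! k)
      = (\<Sum>k<length zs. \<gamma> k *\<^sub>C zs ! k + \<gamma> i *\<^sub>C \<beta> k *\<^sub>C zs ! k - (if k = i then \<gamma> i *\<^sub>C zs ! i else 0))"
      by (intro sum.cong) (auto simp: scaleC_algebra algebra_simps)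
    also have "\<dots> = (\<Sum>k<length zs. \<gamma> k *\<^sub>C zs ! k)
        + \<gamma> i *\<^sub>C (\<Sum>k<length zs. \<beta> k *\<^sub>C zs ! k) - \<gamma> i *\<^sub>C zs ! i"
      using i by (simp add: sum_subtractf sum.distrib complex_vector.scale_sum_right)
    finally show ?thesis
      by (simp add: sum_list_update[OF i] u_def complex_vector.scale_right_diff_distrib)
  qed
  have u: "u \<in> U"
    using v by (simp add: u_def)
  have zX: "zs ! k \<in> X" if "k < length zs" for k
    using zs that unfolding basis_mod_def by auto
  have "v = u + (\<Sum>k<length zs. \<beta> k *\<^sub>C zs ! k)"
    by (simp add: u_def)
  also have "\<dots> \<in> X"
    using u U(2) zX X
    by (intro complex_vector.subspace_add complex_vector.subspace_sum complex_vector.subspace_scale) auto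
  finally have "set (zs[i := v]) \<subseteq> X"
    using zs set_update_subset_insert[of zs i v] unfolding basis_mod_def by blast
  moreover have "\<forall>k<length zs. \<gamma> k = 0" if s: "(\<Sum>k<length zs. \<gamma> k *\<^sub>C zs[i := v] ! k) \<in> U" for \<gamma>
  proof -
    have s': "(\<Sum>k<length zs. (\<gamma> k + \<gamma> i * (\<beta> k - (if k = i then 1 else 0))) *\<^sub>C zs ! k) \<in> U"
      using complex_vector.subspace_diff[OF U(1) s complex_vector.subspace_scale[OF U(1) u, of "\<gamma> i"]]
      by (simp add: key)
    have ind: "\<forall>k<length zs. \<alpha> k = 0" if "(\<Sum>k<length zs. \<alpha> k *\<^sub>C zs ! k) \<in> U" for \<alpha>
      using zs that unfolding basis_mod_def by blast
    have *: "\<forall>k<length zs. \<gamma> k + \<gamma> i * (\<beta> k - (if k = i then 1 else 0)) = 0"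
      by (rule ind[OF s'])
    then have "\<gamma> i = 0"
      using i \<beta> by (auto simp: algebra_simps dest: spec[of _ i])
    then show ?thesis
      using * by simp
  qed
  moreover have "\<exists>\<gamma>. x - (\<Sum>k<length zs. \<gamma> k *\<^sub>C zs[i := v] ! k) \<in> U" if x: "x \<in> X" for x
  proof -
    obtain \<alpha> where \<alpha>: "x - (\<Sum>k<length zs. \<alpha> k *\<^sub>C zs ! k) \<in> U"
      using zs x unfolding basis_mod_def by blast
    \<comment> \<open>Obtained by solving the coefficient formula in \<open>key\<close> for the
      prescribed \<alpha>; at \<open>k = i\<close> it reads
      \<open>\<gamma> i * \<beta> i = \<alpha> i\<close>.\<close>
    define \<gamma> where "\<gamma> k = (if k = i then \<alpha> i / \<beta> i else \<alpha> k - \<alpha> i / \<beta> i * \<beta> k)" for k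
    have "\<gamma> k + \<gamma> i * (\<beta> k - (if k = i then 1 else 0)) = \<alpha> k" for k
      using \<beta> by (simp add: \<gamma>_def algebra_simps)
    then have "x - (\<Sum>k<length zs. \<gamma> k *\<^sub>C zs[i := v] ! k) = x - (\<Sum>k<length zs. \<alpha> k *\<^sub>C zs ! k) - \<gamma> i *\<^sub>C u"
      by (simp add: key diff_diff_eq)
    also have "\<dots> \<in> U"
      by (intro complex_vector.subspace_diff[OF U(1)] \<alpha> complex_vector.subspace_scale[OF U(1)] u)
    finally show ?thesis by blast
  qed
  ultimately show ?thesis
    by (simp add: basis_mod_def)
qed

text \<open>Gaussian elimination as an induction principle. The list \<open>ys\<close> is produced
  from \<open>xs\<close> entry by entry, and every intermediate list is again a basis modulo
  \<open>U\<close>, so that the operators built from it stay invertible.\<close>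

lemma basis_mod_induct:
  assumes X: "complex_vector.subspace X" and U: "complex_vector.subspace U" "U \<subseteq> X"
    and xs: "basis_mod X U xs" and ys: "basis_mod X U ys" and len: "length xs = length ys"
    and P: "P xs"
    and add: "\<And>zs i j t. basis_mod X U zs \<Longrightarrow> length zs = length ys \<Longrightarrow> P zs \<Longrightarrow> i < length zs \<Longrightarrow>
      j < length zs \<Longrightarrow> i \<noteq> j \<Longrightarrow> basis_mod X U (zs[i := zs ! i + t *\<^sub>C zs ! j]) \<Longrightarrow>
      P (zs[i := zs ! i + t *\<^sub>C zs ! j])"
    and scale: "\<And>zs i t. basis_mod X U zs \<Longrightarrow> length zs = length ys \<Longrightarrow> P zs \<Longrightarrow> i < length zs \<Longrightarrow>
      t \<noteq> 0 \<Longrightarrow> basis_mod X U (zs[i := t *\<^sub>C zs ! i]) \<Longrightarrow> P (zs[i := t *\<^sub>C zs ! i])"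
    and shift: "\<And>zs i u. basis_mod X U zs \<Longrightarrow> length zs = length ys \<Longrightarrow> P zs \<Longrightarrow> i < length zs \<Longrightarrow>
      u \<in> U \<Longrightarrow> basis_mod X U (zs[i := zs ! i + u]) \<Longrightarrow> P (zs[i := zs ! i + u])"
  shows "P ys"
proof -
  define n where "n = length ys"
  have "\<exists>zs. length zs = n \<and> P zs \<and> basis_mod X U zs \<and> (\<forall>k<m. zs ! k = ys ! k)" if "m \<le> n" for m
    using that
  proof (induction m)
    case 0
    then show ?case
      using P xs len by (auto simp: n_def)
  next
    case (Suc m)
    then obtain zs0 where zs0: "length zs0 = n" "P zs0" "basis_mod X U zs0" "\<forall>k<m. zs0 ! k = ys ! k"
      by auto
    have m: "m < n"
      using Suc.prems by simp
    define y where "y = ys ! m"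
    have "y \<in> X"
      using ys m by (auto simp: basis_mod_def n_def y_def)
    then obtain \<beta>0 where \<beta>0: "y - (\<Sum>k<n. \<beta>0 k *\<^sub>C zs0 ! k) \<in> U"
      using zs0 unfolding basis_mod_def by metis
    \<comment> \<open>Otherwise \<open>ys ! m\<close> would depend modulo \<open>U\<close> on the
      preceding entries of \<open>ys\<close>, which are already in place.\<close>
    have "\<exists>j\<ge>m. j < n \<and> \<beta>0 j \<noteq> 0"
    proof (rule ccontr)
      assume "\<not> ?thesis"
      then have z: "\<beta>0 j = 0" if "m \<le> j" "j < n" for j
        using that by blast
      define \<gamma> where "\<gamma> k = (if k = m then 1 else - \<beta>0 k)" for k
      have "y - (\<Sum>k<n. \<beta>0 k *\<^sub>C zs0 ! k) = (\<Sum>k<n. (if k = m then y else 0) - \<beta>0 k *\<^sub>C zs0 ! k)"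
        using m by (simp add: sum_subtractf)
      also have "\<dots> = (\<Sum>k<n. \<gamma> k *\<^sub>C ys ! k)"
      proof (intro sum.cong refl)
        fix k assume "k \<in> {..<n}"
        then show "(if k = m then y else 0) - \<beta>0 k *\<^sub>C zs0 ! k = \<gamma> k *\<^sub>C ys ! k"
          using zs0(4) z[of k] z[of m] m by (cases k m rule: linorder_cases) (simp_all add: \<gamma>_def y_def)
      qed
      finally have "\<forall>k<n. \<gamma> k = 0"
        using \<beta>0 ys by (simp add: basis_mod_def n_def)
      then show False
        using m by (auto simp: \<gamma>_def)
    qed
    then obtain j where j: "m \<le> j" "j < n" "\<beta>0 j \<noteq> 0"
      by blast
    have "\<exists>zs \<beta>. length zs = n \<and> P zs \<and> basis_mod X U zs \<and> (\<forall>k<m. zs ! k = ys ! k) \<and>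
      y - (\<Sum>k<n. \<beta> k *\<^sub>C zs ! k) \<in> U \<and> \<beta> m \<noteq> 0"
    proof (cases "\<beta>0 m = 0")
      case True
      then have jm: "j \<noteq> m"
        using j by auto
      \<comment> \<open>If the coefficient at \<open>m\<close> vanishes, subtracting entry
        \<open>m\<close> from entry \<open>j\<close> moves the nonzero coefficient of
        \<open>j\<close> to place \<open>m\<close> without changing the combination. As
        \<open>j > m\<close>, the finished entries are untouched.\<close>
      define zs where "zs = zs0[j := zs0 ! j + (- 1) *\<^sub>C zs0 ! m]"
      define \<beta> where "\<beta> k = (if k = m then \<beta>0 j else \<beta>0 k)" for k
      have good: "basis_mod X U zs"
        unfolding zs_def
      proof (rule basis_mod_exchange[OF zs0(3) _ X U, where \<beta> = "\<lambda>k. if k = j then 1 else if k = m then - 1 else 0"])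
        have "(\<Sum>k<n. (if k = j then 1 else if k = m then - 1 else 0) *\<^sub>C zs0 ! k)
            = (\<Sum>k<n. (if k = j then zs0 ! j else 0) + (if k = m then - zs0 ! m else 0))"
          using jm by (intro sum.cong) auto
        also have "\<dots> = zs0 ! j + (- 1) *\<^sub>C zs0 ! m"
          using j m by (simp add: sum.distrib)
        finally show "zs0 ! j + (- 1) *\<^sub>C zs0 ! m
            - (\<Sum>k<length zs0. (if k = j then 1 else if k = m then - 1 else 0) *\<^sub>C zs0 ! k) \<in> U"
          using zs0(1) complex_vector.subspace_0[OF U(1)] by simp
      qed (use j zs0 in auto)
      then have "P zs"
        unfolding zs_def using zs0 j jm m by (intro add) (auto simp: n_def)
      moreover note good
      moreover have "(\<Sum>k<n. \<beta> k *\<^sub>C zs ! k) = (\<Sum>k<n. \<beta>0 k *\<^sub>C zs0 ! k)"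
      proof -
        have "(\<Sum>k<n. \<beta> k *\<^sub>C zs ! k) = (\<Sum>k<n. \<beta> k *\<^sub>C zs0 ! k) - \<beta>0 j *\<^sub>C zs0 ! m"
          using sum_list_update[of j zs0 \<beta> "zs0 ! j + (- 1) *\<^sub>C zs0 ! m"] zs0(1) j jm
          by (simp add: zs_def \<beta>_def)
        also have "(\<Sum>k<n. \<beta> k *\<^sub>C zs0 ! k) = (\<Sum>k<n. \<beta>0 k *\<^sub>C zs0 ! k + (if k = m then \<beta>0 j *\<^sub>C zs0 ! m else 0))"
          using True by (intro sum.cong) (auto simp: \<beta>_def)
        also have "\<dots> = (\<Sum>k<n. \<beta>0 k *\<^sub>C zs0 ! k) + \<beta>0 j *\<^sub>C zs0 ! m"
          using m by (simp add: sum.distrib)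
        finally show ?thesis by simp
      qed
      moreover have "\<forall>k<m. zs ! k = ys ! k"
        using zs0(4) j jm by (simp add: zs_def)
      ultimately show ?thesis
        using \<beta>0 j(3) zs0(1) by (intro exI[of _ zs] exI[of _ \<beta>]) (simp add: zs_def \<beta>_def)
    next
      case False
      then show ?thesis
        using zs0 \<beta>0 by blast
    qed
    then obtain zs \<beta> where zs: "length zs = n" "P zs" "basis_mod X U zs" "\<forall>k<m. zs ! k = ys ! k"
      and \<beta>: "y - (\<Sum>k<n. \<beta> k *\<^sub>C zs ! k) \<in> U" "\<beta> m \<noteq> 0"
      by blast
    \<comment> \<open>Entry \<open>m\<close> becomes \<open>y\<close> in stages: it is scaled by
      \<open>\<beta> m\<close>, then the other terms are added one by one, and finally an element of
      \<open>U\<close>. The coefficient \<open>\<beta> m \<noteq> 0\<close> makes every stage a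
      basis.\<close>
    define w where "w I = \<beta> m *\<^sub>C zs ! m + (\<Sum>k\<in>I. \<beta> k *\<^sub>C zs ! k)" for I
    have w_good: "basis_mod X U (zs[m := w I])" if I: "I \<subseteq> {..<n} - {m}" for I
    proof (rule basis_mod_exchange[OF zs(3) _ X U, where \<beta> = "\<lambda>k. if k \<in> insert m I then \<beta> k else 0"])
      have fin: "finite I"
        using I finite_subset by blast
      have "(\<Sum>k<n. (if k \<in> insert m I then \<beta> k else 0) *\<^sub>C zs ! k)
          = (\<Sum>k<n. if k \<in> insert m I then \<beta> k *\<^sub>C zs ! k else 0)"
        by (intro sum.cong) auto
      also have "\<dots> = (\<Sum>k\<in>insert m I. \<beta> k *\<^sub>C zs ! k)"
        using I m by (subst sum.inter_restrict[symmetric]) (auto intro!: sum.cong)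
      also have "\<dots> = w I"
        using I fin by (subst sum.insert) (auto simp: w_def)
      finally show "w I - (\<Sum>k<length zs. (if k \<in> insert m I then \<beta> k else 0) *\<^sub>C zs ! k) \<in> U"
        using zs(1) complex_vector.subspace_0[OF U(1)] by simp
    qed (use m zs \<beta> in auto)
    have "P (zs[m := w I])" if "I \<subseteq> {..<n} - {m}" for I
    proof -
      have "finite I"
        using that finite_subset by blast
      then show ?thesis
        using that
      proof (induction I rule: finite_induct)
        case empty
        show ?case
          using scale[OF zs(3) _ zs(2), of m "\<beta> m"] w_good[of "{}"] zs(1) m \<beta>(2) by (simp add: w_def n_def)
      next
        case (insert k I)
        then have k: "k < n" "k \<noteq> m" and I: "I \<subseteq> {..<n} - {m}"
          by auto
        have step: "(zs[m := w I])[m := zs[m := w I] ! m + \<beta> k *\<^sub>C zs[m := w I] ! k] = zs[m := w (insert k I)]"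
          using insert.hyps k m zs(1) by (simp add: w_def add_ac)
        show ?case
          unfolding step[symmetric]
          using insert.IH[OF I] w_good[OF I] w_good[OF insert.prems] k m zs(1)
          by (intro add, unfold step) (auto simp: n_def)
      qed
    qed
    then have Pw: "P (zs[m := w ({..<n} - {m})])"
      by blast
    have "w ({..<n} - {m}) = (\<Sum>k<n. \<beta> k *\<^sub>C zs ! k)"
      unfolding w_def using m by (subst sum.remove[of "{..<n}" m]) auto
    then have "y - w ({..<n} - {m}) \<in> U"
      using \<beta> by simp
    moreover have good: "basis_mod X U (zs[m := y])"
      using m zs(1) \<beta> by (intro basis_mod_exchange[OF zs(3) _ X U]) auto
    moreover have step: "(zs[m := w ({..<n} - {m})])[m := zs[m := w ({..<n} - {m})] ! m + (y - w ({..<n} - {m}))]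
        = zs[m := y]"
      using m zs(1) by simp
    ultimately have "P (zs[m := y])"
      unfolding step[symmetric] using Pw w_good[of "{..<n} - {m}"] m zs(1)
      by (intro shift, unfold step) (auto simp: n_def)
    moreover note good
    ultimately show ?case
      using zs(1,4) m by (intro exI[of _ "zs[m := y]"]) (auto simp: y_def less_Suc_eq)
  qed
  from this[of n] obtain zs where "length zs = n" "P zs" "\<forall>k<n. zs ! k = ys ! k"
    by auto
  then have "zs = ys"
    by (intro nth_equalityI) (auto simp: n_def)
  then show ?thesis
    using \<open>P zs\<close> by simp
qed

subsection \<open>Exterior powers and tensor products\<close>

lemma coset_eq_iff:
  assumes "complex_vector.subspace U"
  shows "coset U x = coset U y \<longleftrightarrow> x - y \<in> U"
proof
  assume "coset U x = coset U y"
  moreover have "x \<in> coset U x"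
    using complex_vector.subspace_0[OF assms] by (auto simp: coset_def intro!: exI[of _ 0])
  ultimately obtain u where "x = y + u" "u \<in> U"
    by (auto simp: coset_def)
  then show "x - y \<in> U"
    by simp
next
  assume d: "x - y \<in> U"
  have "\<exists>v. x + u = y + v \<and> v \<in> U" "\<exists>v. y + u = x + v \<and> v \<in> U" if "u \<in> U" for u
    using complex_vector.subspace_add[OF assms d that] complex_vector.subspace_diff[OF assms that d]
    by (auto intro: exI[of _ "x - y + u"] exI[of _ "u - (x - y)"])
  then show "coset U x = coset U y"
    by (auto simp: coset_def)
qed

lemma quotient_space_add:
  assumes "complex_vector.subspace U"
  shows "coset U x \<oplus>\<^bsub>quotient_space W U\<^esub> coset U y = coset U (x + y)"
proof -
  have "{a + b |a b. a \<in> coset U x \<and> b \<in> coset U y} = coset U (x + y)"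
  proof (intro equalityI subsetI)
    fix z assume "z \<in> {a + b |a b. a \<in> coset U x \<and> b \<in> coset U y}"
    then obtain u v where uv: "z = (x + u) + (y + v)" "u \<in> U" "v \<in> U"
      by (auto simp: coset_def)
    then have "z = x + y + (u + v)"
      by simp
    then show "z \<in> coset U (x + y)"
      using complex_vector.subspace_add[OF assms uv(2,3)] unfolding coset_def by blast
  next
    fix z assume "z \<in> coset U (x + y)"
    then obtain u where "z = (x + u) + (y + 0)" "u \<in> U"
      by (auto simp: coset_def add_ac)
    then show "z \<in> {a + b |a b. a \<in> coset U x \<and> b \<in> coset U y}"
      using complex_vector.subspace_0[OF assms] unfolding coset_def by blast
  qed
  then show ?thesis
    by (simp add: quotient_space_def)
qed

lemma quotient_space_smult:
  assumes "complex_vector.subspace U"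
  shows "t \<odot>\<^bsub>quotient_space W U\<^esub> coset U x = coset U (t *\<^sub>C x)"
proof -
  have "{t *\<^sub>C a + u |a u. a \<in> coset U x \<and> u \<in> U} = coset U (t *\<^sub>C x)"
  proof (intro equalityI subsetI)
    fix z assume "z \<in> {t *\<^sub>C a + u |a u. a \<in> coset U x \<and> u \<in> U}"
    then obtain u v where uv: "z = t *\<^sub>C (x + v) + u" "u \<in> U" "v \<in> U"
      by (auto simp: coset_def)
    then have "z = t *\<^sub>C x + (t *\<^sub>C v + u)"
      by (simp add: scaleC_add_right)
    then show "z \<in> coset U (t *\<^sub>C x)"
      using complex_vector.subspace_add[OF assms complex_vector.subspace_scale[OF assms uv(3)] uv(2)]
      unfolding coset_def by blast
  next
    fix z assume "z \<in> coset U (t *\<^sub>C x)"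
    then obtain u where "z = t *\<^sub>C (x + 0) + u" "u \<in> U"
      by (auto simp: coset_def)
    then show "z \<in> {t *\<^sub>C a + u |a u. a \<in> coset U x \<and> u \<in> U}"
      using complex_vector.subspace_0[OF assms] unfolding coset_def by blast
  qed
  then show ?thesis
    by (simp add: quotient_space_def)
qed

lemma ext_relations_add:
  "set us \<union> {x, y} \<union> set vs \<subseteq> carrier V \<Longrightarrow> length us + 1 + length vs = n \<Longrightarrow>
    Poly_Mapping.single (us @ [x \<oplus>\<^bsub>V\<^esub> y] @ vs) 1
       - Poly_Mapping.single (us @ [x] @ vs) 1 - Poly_Mapping.single (us @ [y] @ vs) 1 \<in> ext_relations V n"
  unfolding ext_relations_def by blast

lemma ext_relations_smult:
  "set us \<union> {x} \<union> set vs \<subseteq> carrier V \<Longrightarrow> length us + 1 + length vs = n \<Longrightarrow>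
    Poly_Mapping.single (us @ [t \<odot>\<^bsub>V\<^esub> x] @ vs) 1
       - t *\<^sub>C Poly_Mapping.single (us @ [x] @ vs) 1 \<in> ext_relations V n"
  unfolding ext_relations_def by blast

lemma wedge_carrier:
  assumes "set vs \<subseteq> carrier V"
  shows "wedge V vs \<in> carrier (ext_power V (length vs))"
  unfolding wedge_def ext_power_def quotient_space_def using assms by (auto simp: keys_single intro!: imageI)

lemma wedge_smult:
  assumes i: "i < length vs" and vs: "set vs \<subseteq> carrier V"
  shows "wedge V (vs[i := t \<odot>\<^bsub>V\<^esub> vs ! i]) = t \<odot>\<^bsub>ext_power V (length vs)\<^esub> wedge V vs"
proof -
  let ?U = "complex_vector.span (ext_relations V (length vs))"
  have vs_split: "take i vs @ [vs ! i] @ drop (Suc i) vs = vs"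
    using i by (simp add: id_take_nth_drop[symmetric])
  have "set (take i vs) \<union> {vs ! i} \<union> set (drop (Suc i) vs) \<subseteq> carrier V"
    using vs i set_take_subset[of i vs] set_drop_subset[of "Suc i" vs] by auto
  then have "Poly_Mapping.single (take i vs @ [t \<odot>\<^bsub>V\<^esub> vs ! i] @ drop (Suc i) vs) 1
      - t *\<^sub>C Poly_Mapping.single (take i vs @ [vs ! i] @ drop (Suc i) vs) 1 \<in> ext_relations V (length vs)"
    using i by (intro ext_relations_smult) simp_all
  then have "Poly_Mapping.single (vs[i := t \<odot>\<^bsub>V\<^esub> vs ! i]) 1 - t *\<^sub>C Poly_Mapping.single vs 1 \<in> ?U"
    using i by (intro complex_vector.span_base) (simp only: vs_split upd_conv_take_nth_drop, simp)
  then show ?thesis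
    unfolding wedge_def ext_power_def length_list_update
    by (subst quotient_space_smult) (simp_all add: coset_eq_iff complex_vector.subspace_span)
qed

text \<open>By multilinearity the additional term is a multiple of a tuple containing
  \<open>vs ! j\<close> twice.\<close>

lemma wedge_add_multiple:
  assumes ij: "i < length vs" "j < length vs" "i \<noteq> j" and vs: "set vs \<subseteq> carrier V"
    and smult: "t \<odot>\<^bsub>V\<^esub> vs ! j \<in> carrier V"
  shows "wedge V (vs[i := vs ! i \<oplus>\<^bsub>V\<^esub> t \<odot>\<^bsub>V\<^esub> vs ! j]) = wedge V vs"
proof -
  let ?n = "length vs"
  let ?U = "complex_vector.span (ext_relations V ?n)"
  let ?s = "\<lambda>v. Poly_Mapping.single (vs[i := v]) (1 :: complex)"
  have split: "vs[i := v] = take i vs @ [v] @ drop (Suc i) vs" for v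
    using ij by (simp add: upd_conv_take_nth_drop)
  have sub: "set (take i vs) \<union> set (drop (Suc i) vs) \<subseteq> carrier V" "vs ! i \<in> carrier V" "vs ! j \<in> carrier V"
    using vs ij set_take_subset[of i vs] set_drop_subset[of "Suc i" vs] by auto
  have "?s (vs ! i \<oplus>\<^bsub>V\<^esub> t \<odot>\<^bsub>V\<^esub> vs ! j) - ?s (vs ! i) - ?s (t \<odot>\<^bsub>V\<^esub> vs ! j) \<in> ext_relations V ?n"
    unfolding split using ij sub smult by (intro ext_relations_add) simp_all
  then have 1: "?s (vs ! i \<oplus>\<^bsub>V\<^esub> t \<odot>\<^bsub>V\<^esub> vs ! j) - ?s (vs ! i) - ?s (t \<odot>\<^bsub>V\<^esub> vs ! j) \<in> ?U"
    by (rule complex_vector.span_base)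
  have "?s (t \<odot>\<^bsub>V\<^esub> vs ! j) - t *\<^sub>C ?s (vs ! j) \<in> ext_relations V ?n"
    unfolding split using ij sub by (intro ext_relations_smult) simp_all
  then have 2: "?s (t \<odot>\<^bsub>V\<^esub> vs ! j) - t *\<^sub>C ?s (vs ! j) \<in> ?U"
    by (rule complex_vector.span_base)
  have "vs[i := vs ! j] ! i = vs[i := vs ! j] ! j"
    using ij by simp
  then have "\<not> distinct (vs[i := vs ! j])"
    using ij by (metis length_list_update nth_eq_iff_index_eq)
  moreover have "set (vs[i := vs ! j]) \<subseteq> carrier V"
    using vs sub(3) set_update_subset_insert[of vs i] by blast
  ultimately have "?s (vs ! j) \<in> ext_relations V ?n"
    unfolding ext_relations_def by (intro UnI2) auto
  then have 3: "?s (vs ! j) \<in> ?U"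
    by (rule complex_vector.span_base)
  have "?s (vs ! i \<oplus>\<^bsub>V\<^esub> t \<odot>\<^bsub>V\<^esub> vs ! j) - ?s (vs ! i) =
      (?s (vs ! i \<oplus>\<^bsub>V\<^esub> t \<odot>\<^bsub>V\<^esub> vs ! j) - ?s (vs ! i) - ?s (t \<odot>\<^bsub>V\<^esub> vs ! j))
      + ((?s (t \<odot>\<^bsub>V\<^esub> vs ! j) - t *\<^sub>C ?s (vs ! j)) + t *\<^sub>C ?s (vs ! j))"
    by simp
  also have "\<dots> \<in> ?U"
    by (intro complex_vector.span_add complex_vector.span_scale 1 2 3)
  finally show ?thesis
    unfolding wedge_def length_list_update
    by (simp add: coset_eq_iff complex_vector.subspace_span)
qed

lemma pure_tensor_carrier:
  "v \<in> carrier V \<Longrightarrow> w \<in> carrier W \<Longrightarrow> t \<odot>\<^bsub>tensor_space V W\<^esub> pure_tensor V W v w \<in> carrier (tensor_space V W)"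
proof -
  assume vw: "v \<in> carrier V" "w \<in> carrier W"
  have "Poly_Mapping.keys (t *\<^sub>C Poly_Mapping.single (v, w) (1 :: complex)) \<subseteq> carrier V \<times> carrier W"
    using vw by (auto simp: in_keys_iff lookup_scaleC lookup_single when_def split: if_splits)
  then show ?thesis
    unfolding pure_tensor_def tensor_space_def
    by (subst quotient_space_smult) (auto simp: quotient_space_def complex_vector.subspace_span)
qed

lemma pure_tensor_smult_left:
  assumes "v \<in> carrier V" "w \<in> carrier W"
  shows "pure_tensor V W (t \<odot>\<^bsub>V\<^esub> v) w = t \<odot>\<^bsub>tensor_space V W\<^esub> pure_tensor V W v w"
proof -
  have "Poly_Mapping.single (t \<odot>\<^bsub>V\<^esub> v, w) 1 - t *\<^sub>C Poly_Mapping.single (v, w) 1 \<in> tensor_relations V W"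
    unfolding tensor_relations_def using assms by blast
  then show ?thesis
    unfolding pure_tensor_def tensor_space_def
    by (subst quotient_space_smult)
      (simp_all add: coset_eq_iff complex_vector.subspace_span complex_vector.span_base)
qed

lemma pure_tensor_smult_right:
  assumes "v \<in> carrier V" "w \<in> carrier W"
  shows "pure_tensor V W v (t \<odot>\<^bsub>W\<^esub> w) = t \<odot>\<^bsub>tensor_space V W\<^esub> pure_tensor V W v w"
proof -
  have "Poly_Mapping.single (v, t \<odot>\<^bsub>W\<^esub> w) 1 - t *\<^sub>C Poly_Mapping.single (v, w) 1 \<in> tensor_relations V W"
    unfolding tensor_relations_def using assms by blast
  then show ?thesis
    unfolding pure_tensor_def tensor_space_def
    by (subst quotient_space_smult)
      (simp_all add: coset_eq_iff complex_vector.subspace_span complex_vector.span_base)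
qed

lemma pure_tensor_smult_smult:
  "s \<odot>\<^bsub>tensor_space V W\<^esub> (t \<odot>\<^bsub>tensor_space V W\<^esub> pure_tensor V W v w)
    = (s * t) \<odot>\<^bsub>tensor_space V W\<^esub> pure_tensor V W v w"
  unfolding pure_tensor_def tensor_space_def
  by (simp add: quotient_space_smult complex_vector.subspace_span scaleC_scaleC)

subsection \<open>Dual bases\<close>

lemma clinear_on_eq_on_span:
  assumes "clinear_on (complex_vector.span S) g" "clinear_on (complex_vector.span S) h"
    and "\<And>x. x \<in> S \<Longrightarrow> g x = h x" and "x \<in> complex_vector.span S"
  shows "g x = (h x :: complex)"
proof -
  obtain F r where F: "finite F" "F \<subseteq> S" "x = (\<Sum>a\<in>F. r a *\<^sub>C a)"
    using assms(4) unfolding complex_vector.span_explicit by blast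
  have "a \<in> complex_vector.span S" if "a \<in> F" for a
    using that F(2) complex_vector.span_base by blast
  then have "g x = (\<Sum>a\<in>F. r a *\<^sub>C g a)" "h x = (\<Sum>a\<in>F. r a *\<^sub>C h a)"
    unfolding F(3) by (simp_all only: clinear_on_sum[OF assms(1) complex_vector.subspace_span]
        clinear_on_sum[OF assms(2) complex_vector.subspace_span])
  then show ?thesis
    using F(2) assms(3) by (simp add: subset_iff cong: sum.cong)
qed

lemma is_dual_basis_unique:
  assumes es: "ordered_basis K es" and d: "is_dual_basis K es es'" "is_dual_basis K es es''"
  shows "es' = es''"
proof (rule nth_equalityI)
  show "length es' = length es''"
    using d by (simp add: is_dual_basis_def)
  fix i assume i: "i < length es'"
  have K: "K = complex_vector.span (set es)"
    using es by (simp add: ordered_basis_def)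
  have car: "es' ! i \<in> carrier (dual_space K)" "es'' ! i \<in> carrier (dual_space K)"
    using d i by (auto simp: is_dual_basis_def subset_iff)
  have "(es' ! i) e = (es'' ! i) e" if "e \<in> set es" for e
    using that d i by (auto simp: is_dual_basis_def in_set_conv_nth)
  then have "(es' ! i) x = (es'' ! i) x" if "x \<in> K" for x
    using clinear_on_eq_on_span[of "set es" "es' ! i" "es'' ! i" x] car that
    by (simp add: K dual_space_def)
  then show "es' ! i = es'' ! i"
    using car by (intro extensionalityI[of _ K]) (auto simp: dual_space_def)
qed

lemma dual_space_add_smult:
  assumes "g \<in> carrier (dual_space K)" "h \<in> carrier (dual_space K)" "complex_vector.subspace K"
  shows "t \<odot>\<^bsub>dual_space K\<^esub> h \<in> carrier (dual_space K)"
    "g \<oplus>\<^bsub>dual_space K\<^esub> t \<odot>\<^bsub>dual_space K\<^esub> h \<in> carrier (dual_space K)"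
    "x \<in> K \<Longrightarrow> (t \<odot>\<^bsub>dual_space K\<^esub> h) x = t * h x"
    "x \<in> K \<Longrightarrow> (g \<oplus>\<^bsub>dual_space K\<^esub> t \<odot>\<^bsub>dual_space K\<^esub> h) x = g x + t * h x"
  using assms
  by (auto simp: dual_space_def clinear_on_def complex_vector.subspace_add complex_vector.subspace_scale
      scaleC_complex_def algebra_simps)

lemma ordered_basis_imp_basis_mod:
  assumes "ordered_basis K es"
  shows "basis_mod K {0} es"
proof -
  have es: "distinct es" "\<not> complex_vector.dependent (set es)" "complex_vector.span (set es) = K"
    using assms by (auto simp: ordered_basis_def)
  have bij: "bij_betw ((!) es) {..<length es} (set es)"
    by (rule bij_betw_nth[OF es(1)]) auto
  have reindex: "(\<Sum>v\<in>set es. u v *\<^sub>C v) = (\<Sum>k<length es. u (es ! k) *\<^sub>C es ! k)" for u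
    by (rule sum.reindex_bij_betw[OF bij, symmetric])
  show ?thesis
    unfolding basis_mod_def
  proof (intro conjI allI impI ballI)
    show "set es \<subseteq> K"
      using es(3) complex_vector.span_base by blast
    fix \<beta> k
    assume s: "(\<Sum>k<length es. \<beta> k *\<^sub>C es ! k) \<in> {0}" and k: "k < length es"
    define u where "u v = \<beta> (the_inv_into {..<length es} ((!) es) v)" for v
    have u: "u (es ! k) = \<beta> k" if "k < length es" for k
      using that bij by (simp add: u_def bij_betw_def the_inv_into_f_f)
    then have "(\<Sum>v\<in>set es. u v *\<^sub>C v) = 0"
      using s by (simp add: reindex)
    then have "u (es ! k) = 0"
      using es(2) k complex_vector.independentD[OF es(2), of "set es" u] by simp
    then show "\<beta> k = 0"
      using u[OF k] by simp
  next
    fix v assume "v \<in> K"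
    then obtain u where "v = (\<Sum>v\<in>set es. u v *\<^sub>C v)"
      unfolding es(3)[symmetric] complex_vector.span_finite[OF finite_set] by blast
    then show "\<exists>\<beta>. v - (\<Sum>k<length es. \<beta> k *\<^sub>C es ! k) \<in> {0}"
      by (intro exI[of _ "\<lambda>k. u (es ! k)"]) (simp add: reindex)
  qed
qed

text \<open>Injectivity of the map into the cokernel gives independence modulo the range,
  surjectivity gives spanning.\<close>

lemma admissible_imp_basis_mod:
  assumes T: "clinear_on UNIV T" and L: "admissible T L" and es: "ordered_basis (ker_op T) es"
  shows "basis_mod UNIV (range T) (map L es)"
proof -
  let ?K = "ker_op T"
  have Tadd: "T (x + y) = T x + T y" "T (t *\<^sub>C x) = t *\<^sub>C T x" for x y t
    using T by (auto simp: clinear_on_def)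
  have T0: "T 0 = 0"
    using Tadd(2)[of 0 0] by simp
  have K: "complex_vector.subspace ?K"
    by (rule complex_vector.subspaceI) (simp_all add: ker_op_def Tadd T0)
  have R: "complex_vector.subspace (range T)"
    by (rule complex_vector.subspaceI) (auto simp: T0 Tadd[symmetric] intro: rangeI[of T 0, simplified T0])
  have lin: "clinear_on ?K L" and bij: "bij_betw (coker_proj T \<circ> L) ?K (carrier (coker_op T))"
    using L by (auto simp: admissible_def)
  have b: "basis_mod ?K {0} es"
    by (rule ordered_basis_imp_basis_mod[OF es])
  have esK: "es ! k \<in> ?K" if "k < length es" for k
    using b that by (auto simp: basis_mod_def)
  have sum: "(\<Sum>k<length es. \<beta> k *\<^sub>C map L es ! k) = L (\<Sum>k<length es. \<beta> k *\<^sub>C es ! k)" for \<beta>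
    using esK by (subst clinear_on_sum[OF lin K]) auto
  have inK: "(\<Sum>k<length es. \<beta> k *\<^sub>C es ! k) \<in> ?K" for \<beta>
    using esK by (intro subspace_intros[OF K]) auto
  have L0: "L 0 = 0"
    using lin complex_vector.subspace_0[OF K] complex_vector.scale_zero_left
    unfolding clinear_on_def by metis
  show ?thesis
    unfolding basis_mod_def length_map
  proof (intro conjI allI impI ballI)
    fix \<beta> k
    assume s: "(\<Sum>k<length es. \<beta> k *\<^sub>C map L es ! k) \<in> range T" and k: "k < length es"
    have "L (\<Sum>k<length es. \<beta> k *\<^sub>C es ! k) \<in> range T"
      using s unfolding sum .
    then have "(coker_proj T \<circ> L) (\<Sum>k<length es. \<beta> k *\<^sub>C es ! k) = (coker_proj T \<circ> L) 0"
      by (simp add: coker_proj_def coset_eq_iff[OF R] L0)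
    then have "(\<Sum>k<length es. \<beta> k *\<^sub>C es ! k) = 0"
      using bij_betw_imp_inj_on[OF bij] inK complex_vector.subspace_0[OF K] by (blast dest: inj_onD)
    then show "\<beta> k = 0"
      using b k by (auto simp: basis_mod_def)
  next
    fix v :: 'a
    have "coker_proj T v \<in> carrier (coker_op T)"
      by (simp add: coker_op_def quotient_space_def coker_proj_def)
    then obtain x where x: "x \<in> ?K" "coker_proj T (L x) = coker_proj T v"
      unfolding bij_betw_imp_surj_on[OF bij, symmetric] by auto
    obtain \<beta> where "x - (\<Sum>k<length es. \<beta> k *\<^sub>C es ! k) \<in> {0}"
      using b x(1) unfolding basis_mod_def by blast
    then have "L x = (\<Sum>k<length es. \<beta> k *\<^sub>C map L es ! k)"
      unfolding sum by simp
    moreover have "v - L x \<in> range T"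
      using x(2) coset_eq_iff[OF R] unfolding coker_proj_def by metis
    ultimately show "\<exists>\<beta>. v - (\<Sum>k<length es. \<beta> k *\<^sub>C map L es ! k) \<in> range T"
      by auto
  qed simp
qed

lemma basis_mod_independent:
  "basis_mod X U zs \<Longrightarrow> length zs = n \<Longrightarrow> (\<Sum>k<n. \<beta> k *\<^sub>C zs ! k) \<in> U \<Longrightarrow> k < n \<Longrightarrow> \<beta> k = 0"
  unfolding basis_mod_def by blast

lemma basis_mod_spanning:
  "basis_mod X U zs \<Longrightarrow> length zs = n \<Longrightarrow> v \<in> X \<Longrightarrow> \<exists>\<beta>. v - (\<Sum>k<n. \<beta> k *\<^sub>C zs ! k) \<in> U"
  unfolding basis_mod_def by blast

lemma is_dual_basis_expand:
  assumes es: "ordered_basis K es" and d: "is_dual_basis K es es'" and x: "x \<in> K"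
  shows "x = (\<Sum>k<length es. (es' ! k) x *\<^sub>C es ! k)"
proof -
  have K: "complex_vector.subspace K"
    using es complex_vector.subspace_span by (auto simp: ordered_basis_def)
  have b: "basis_mod K {0} es"
    by (rule ordered_basis_imp_basis_mod[OF es])
  then obtain \<beta> where "x - (\<Sum>k<length es. \<beta> k *\<^sub>C es ! k) \<in> {0}"
    using x unfolding basis_mod_def by blast
  then have \<beta>: "x = (\<Sum>k<length es. \<beta> k *\<^sub>C es ! k)"
    by simp
  have "(es' ! j) x = \<beta> j" if j: "j < length es" for j
  proof -
    have "clinear_on K (es' ! j)"
      using d j by (auto simp: is_dual_basis_def dual_space_def subset_iff)
    then have "(es' ! j) x = (\<Sum>k<length es. \<beta> k *\<^sub>C (es' ! j) (es ! k))"
      using b unfolding \<beta> by (intro clinear_on_sum[OF _ K]) (auto simp: basis_mod_def)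
    also have "\<dots> = (\<Sum>k<length es. if k = j then \<beta> k else 0)"
      using d j by (intro sum.cong) (auto simp: is_dual_basis_def scaleC_complex_def)
    finally show ?thesis
      using j by simp
  qed
  then show ?thesis
    using \<beta> by simp
qed

lemma nuclear_case_nat:
  assumes "sqsum a" "sqsum c"
  shows "nuclear (case_nat b a) (case_nat w c) x = cinner w x *\<^sub>C b + nuclear a c x"
  using nuclear_split[of "case_nat b a" "case_nat w c" x 1] assms by simp

subsection \<open>Dependence on the complement of the range\<close>

text \<open>Composed with \<open>R = V^-1\<close>, the operator \<open>Q ls\<close> becomes the
  identity plus a nuclear operator, and adding \<delta> to entry \<open>i\<close> prepends the pair
  \<open>R \<delta>\<close>, \<open>w i\<close>. The rank one factor appears on the side of the old
  list because the determinants in question are reciprocals.\<close>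

lemma fredholm_det_complement_step:
  fixes T A :: "'h::complex_hilbert \<Rightarrow> 'h" and w :: "nat \<Rightarrow> 'h"
  defines "Q \<equiv> \<lambda>ls x. T x + (\<Sum>k<length ls. cinner (w k) x *\<^sub>C ls ! k)"
  assumes A: "A \<in> trace_perturbations T"
    and bij: "bij (Q ls)" "bij (Q (ls[i := ls ! i + \<delta>]))" and i: "i < length ls"
    and y: "Q ls y = \<delta>"
  shows "fredholm_det ((\<lambda>x. T x + A x) \<circ> the_inv (Q ls))
    = (1 + cinner (w i) y) * fredholm_det ((\<lambda>x. T x + A x) \<circ> the_inv (Q (ls[i := ls ! i + \<delta>])))"
proof -
  define V where "V x = T x + A x" for x
  define d where "d = length ls"
  have "trace_class A" and "invertible_op V"
    using A by (auto simp: trace_perturbations_def V_def[abs_def])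
  then obtain R where V: "bounded_clinear V" and R: "bounded_clinear R" "R \<circ> V = id" "V \<circ> R = id"
    by (auto simp: invertible_op_def)
  obtain a0 c0 where ac0: "sqsum a0" "sqsum c0" and A0: "A = nuclear a0 c0"
    using trace_class_imp_nuclear[OF \<open>trace_class A\<close>] by blast
  have VR: "V (R x) = x" "R (V x) = x" for x
    using R(2,3) by (metis comp_apply id_apply)+
  have bijV: "bij V"
    using R(2,3) o_bij by blast
  have linV: "clinear_on UNIV V"
    using V by (simp add: bounded_clinear_def)
  \<comment> \<open>The first \<open>d\<close> pairs represent the finite rank part, the rest
    represents \<open>- R \<circ> A\<close>.\<close>
  define a where "a k = (if k < d then R (ls ! k) else - R (a0 (k - d)))" for k
  define c where "c k = (if k < d then w k else c0 (k - d))" for k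
  have tail: "(\<lambda>k. a (d + k)) = (\<lambda>k. - R (a0 k))" "(\<lambda>k. c (d + k)) = c0"
    by (auto simp: a_def c_def)
  obtain C where C: "\<And>x. norm (R x) \<le> norm x * C"
    using bounded_linear.bounded[OF bounded_clinearD(5)[OF R(1)]] by blast
  have "sqsum (\<lambda>k. - R (a0 k))"
    unfolding sqsum_def
  proof (rule summable_comparison_test')
    show "summable (\<lambda>k. (norm (a0 k))\<^sup>2 * C\<^sup>2)"
      using ac0(1) unfolding sqsum_def by (rule summable_mult2)
    show "norm ((norm (- R (a0 k)))\<^sup>2) \<le> (norm (a0 k))\<^sup>2 * C\<^sup>2" for k
      using power_mono[OF C[of "a0 k"], of 2] by (simp add: power_mult_distrib)
  qed
  then have ac: "sqsum a" "sqsum c"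
    using sqsum_shift[of a d] sqsum_shift[of c d] ac0(2) by (simp_all only: tail)
  have "nuclear (\<lambda>k. - R (a0 k)) c0 x = - R (A x)" for x
  proof -
    have "(\<lambda>k. - R (cinner (c0 k) x *\<^sub>C a0 k)) sums - R (A x)"
      unfolding A0 by (intro sums_minus bounded_linear.sums[OF bounded_clinearD(5)[OF R(1)]] nuclear_sums ac0)
    then show ?thesis
      by (simp add: bounded_clinearD[OF R(1)] nuclear_def sums_iff)
  qed
  then have nuclear: "nuclear a c x = (\<Sum>k<d. cinner (w k) x *\<^sub>C R (ls ! k)) - R (A x)" for x
    unfolding nuclear_split[OF ac, of x d] tail by (simp add: a_def c_def)
  have Vsum: "V (\<Sum>k<d. cinner (w k) x *\<^sub>C R (ls ! k)) = (\<Sum>k<d. cinner (w k) x *\<^sub>C ls ! k)" for x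
    by (simp add: linear_sum[OF bounded_linear.linear[OF bounded_clinearD(5)[OF V]]] bounded_clinearD[OF V] VR)
  have Q: "Q ls x = V (x + nuclear a c x)" for x
    unfolding nuclear bounded_clinearD[OF V] Vsum VR by (simp add: Q_def d_def V_def)
  have ac': "sqsum (case_nat (R \<delta>) a)" "sqsum (case_nat (w i) c)"
    using ac by simp_all
  have Q': "Q (ls[i := ls ! i + \<delta>]) x = V (x + nuclear (case_nat (R \<delta>) a) (case_nat (w i) c) x)" for x
  proof -
    have "Q (ls[i := ls ! i + \<delta>]) x = Q ls x + cinner (w i) x *\<^sub>C \<delta>"
      using sum_list_update[OF i, of "\<lambda>k. cinner (w k) x" "ls ! i + \<delta>"] by (simp add: Q_def)
    then show ?thesis
      unfolding nuclear_case_nat[OF ac] bounded_clinearD[OF V] VR by (simp add: Q bounded_clinearD[OF V])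
  qed
  define D where "D = fredholm_det (\<lambda>x. x + nuclear a c x)"
  define D' where "D' = fredholm_det (\<lambda>x. x + nuclear (case_nat (R \<delta>) a) (case_nat (w i) c) x)"
  have D: "fredholm_det (V \<circ> the_inv (Q ls)) = inverse D"
    unfolding D_def by (rule fredholm_det_inverse(1)[OF ac linV bijV bij(1) Q])
  have D': "fredholm_det (V \<circ> the_inv (Q (ls[i := ls ! i + \<delta>]))) = inverse D'" "D' \<noteq> 0"
    unfolding D'_def by (rule fredholm_det_inverse[OF ac' linV bijV bij(2) Q'])+
  have "y + nuclear a c y = R \<delta>"
    using Q[of y] y VR by metis
  then have "D' = (1 + cinner (w i) y) * D"
    unfolding D_def D'_def by (rule fredholm_det_rank_one[OF ac])
  moreover from this have "D \<noteq> 0" "1 + cinner (w i) y \<noteq> 0"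
    using D'(2) by auto
  ultimately have "inverse D = (1 + cinner (w i) y) * inverse D'"
    by (simp add: inverse_mult_distrib)
  then show ?thesis
    using D D'(1) by (simp add: V_def[abs_def])
qed

section \<open>Independence of the map and of the basis\<close>

theorem proposition2p1:
  fixes T :: "'h::complex_hilbert \<Rightarrow> 'h"
    and A L M :: "'h \<Rightarrow> 'h"
    and f :: "('h \<Rightarrow> 'h) \<Rightarrow> complex"
    and es us :: "'h list"
    and es' us' :: "('h \<Rightarrow> complex) list"
  assumes "fredholm T" and "fredholm_index T = 0"
    and "f \<in> det_functions T" and "A \<in> trace_perturbations T"
    and "admissible T L" and "ordered_basis (ker_op T) es" and "is_dual_basis (ker_op T) es es'"
    and "admissible T M" and "ordered_basis (ker_op T) us" and "is_dual_basis (ker_op T) us us'"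
  shows "phi T f A L es es' \<in> carrier (det_line T) \<and>
    phi T f A L es es' = phi T f A M us us'"
proof -
  define K where "K = ker_op T"
  define W where "W = coker_op T"
  define d where "d = length es"
  note es = assms(6)[folded K_def] and us = assms(9)[folded K_def]
  note es' = assms(7)[folded K_def] and us' = assms(10)[folded K_def]
  have T: "bounded_clinear T"
    using assms(1) by (simp add: fredholm_def)
  have linT: "clinear_on UNIV T"
    using T by (simp add: bounded_clinear_def)
  have K: "complex_vector.subspace K"
    using es complex_vector.subspace_span by (auto simp: ordered_basis_def)
  have U: "complex_vector.subspace (range T)"
  proof (rule complex_vector.subspaceI)
    show "0 \<in> range T"
      by (rule range_eqI[of _ _ 0]) (simp add: bounded_clinearD[OF T])
  qed (auto simp flip: bounded_clinearD(1,2)[OF T])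
  have dim: "complex_vector.dim K = length xs" if "ordered_basis K xs" for xs
    using that has_dim_imp_dim[of K "length xs"] unfolding has_dim_def ordered_basis_def
    by (metis List.finite_set distinct_card)
  \<comment> \<open>Index zero makes both exterior powers top powers of the same degree
    \<open>d\<close>.\<close>
  have d: "length us = d" "complex_vector.dim K = d" "vs_dim W = d"
    using dim[OF es] dim[OF us] assms(2) by (simp_all add: d_def fredholm_index_def K_def W_def)
  have ker_top: "ker_dual_top T = ext_power (dual_space K) d" and coker_top: "coker_top T = ext_power W d"
    by (simp_all add: ker_dual_top_def coker_top_def K_def[symmetric] W_def[symmetric] d)
  have line: "det_line T = tensor_space (ext_power (dual_space K) d) (ext_power W d)"
    by (simp add: det_line_def ker_top coker_top)
  define pt where "pt xs' ls = pure_tensor (ext_power (dual_space K) d) (ext_power W d)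
      (wedge (dual_space K) xs') (wedge W (map (coker_proj T) ls))" for xs' ls
  have projW: "coker_proj T x \<in> carrier W" for x
    by (simp add: W_def coker_op_def quotient_space_def coker_proj_def)
  have proj_smult: "t \<odot>\<^bsub>W\<^esub> coker_proj T x = coker_proj T (t *\<^sub>C x)"
    and proj_add: "coker_proj T x \<oplus>\<^bsub>W\<^esub> coker_proj T y = coker_proj T (x + y)" for t x y
    by (simp_all add: W_def coker_op_def coker_proj_def quotient_space_smult[OF U] quotient_space_add[OF U])
  have wK: "wedge (dual_space K) xs' \<in> carrier (ext_power (dual_space K) d)"
    if "is_dual_basis K xs xs'" "length xs = d" for xs xs'
    using wedge_carrier[of xs' "dual_space K"] that by (simp add: is_dual_basis_def)
  have wW: "wedge W (map (coker_proj T) ls) \<in> carrier (ext_power W d)" if "length ls = d" for ls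
    using wedge_carrier[of "map (coker_proj T) ls" W] that projW by auto
  have wedge_add: "wedge W (map (coker_proj T) (ls[i := ls ! i + t *\<^sub>C ls ! j])) = wedge W (map (coker_proj T) ls)"
    if "i < length ls" "j < length ls" "i \<noteq> j" for ls i j t
    using wedge_add_multiple[of i "map (coker_proj T) ls" j W t] that projW
    by (simp add: map_update proj_smult proj_add image_subset_iff)
  have wedge_scale: "wedge W (map (coker_proj T) (ls[i := t *\<^sub>C ls ! i]))
      = t \<odot>\<^bsub>ext_power W d\<^esub> wedge W (map (coker_proj T) ls)"
    if "i < length ls" "length ls = d" for ls i t
    using wedge_smult[of i "map (coker_proj T) ls" W t] that projW
    by (simp add: map_update proj_smult image_subset_iff)

  \<comment> \<open>The vectors \<open>w k\<close> represent the dual basis composed with the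
    projection. They depend on \<open>es\<close> only, so \<open>T + N \<circ> \<pi>\<close> is
    \<open>Q (map N es)\<close> for every admissible \<open>N\<close>.\<close>
  obtain w where w: "\<And>k x. k < d \<Longrightarrow> (es' ! k) (orth_proj K x) = cinner (w k) x"
  proof -
    have "\<exists>w. \<forall>x. (es' ! k) (orth_proj K x) = cinner w x" if "k < d" for k
    proof -
      have "clinear_on K (es' ! k)"
        using es' that by (auto simp: is_dual_basis_def dual_space_def d_def subset_iff)
      then show ?thesis
        using functional_orth_proj[of "set es" K "es' ! k"] es by (auto simp: ordered_basis_def)
    qed
    then show thesis
      using that by metis
  qed
  obtain S where "finite S" "complex_vector.span S = K" and
    proj: "\<And>x. orth_proj K x = (\<Sum>q\<in>S. cinner q x *\<^sub>C q)" and proj_id: "\<And>x. x \<in> K \<Longrightarrow> orth_proj K x = x"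
    using orth_proj_finite[of "set es" K] es by (auto simp: ordered_basis_def)
  have projK: "orth_proj K x \<in> K" for x
  proof -
    have "(\<Sum>q\<in>S. cinner q x *\<^sub>C q) \<in> complex_vector.span S"
      by (intro span_intros)
    then show ?thesis
      by (simp only: proj \<open>complex_vector.span S = K\<close>)
  qed
  have esK: "es ! k \<in> K" if "k < d" for k
    using es that complex_vector.span_base[of "es ! k" "set es"] by (auto simp: ordered_basis_def d_def)
  have we: "cinner (w k) (es ! j) = (if k = j then 1 else 0)" if "k < d" "j < d" for k j
    using w[OF that(1), of "es ! j"] es' that by (simp add: proj_id[OF esK] is_dual_basis_def d_def)

  define Q where "Q ls x = T x + (\<Sum>k<length ls. cinner (w k) x *\<^sub>C ls ! k)" for ls x
  have bijQ: "bij (Q ls)" if ls: "basis_mod UNIV (range T) ls" "length ls = d" for ls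
  proof -
    have "x = y" if "Q ls x = Q ls y" for x y
    proof -
      have "T (y - x) = (\<Sum>k<d. cinner (w k) (x - y) *\<^sub>C ls ! k)"
        using that ls(2) by (simp add: Q_def bounded_clinearD[OF T] cinner_diff_right
            complex_vector.scale_left_diff_distrib sum_subtractf algebra_simps)
      then have wr: "(\<Sum>k<d. cinner (w k) (x - y) *\<^sub>C ls ! k) \<in> range T"
        by (metis rangeI)
      have w0: "cinner (w k) (x - y) = 0" if "k < d" for k
        using basis_mod_independent[OF ls wr that] .
      then have "T (y - x) = 0"
        using \<open>T (y - x) = _\<close> by simp
      then have "x - y \<in> K"
        by (simp add: K_def ker_op_def bounded_clinearD[OF T])
      then have "x - y = (\<Sum>k<d. (es' ! k) (x - y) *\<^sub>C es ! k)"
        using is_dual_basis_expand[OF es es'] by (simp add: d_def)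
      also have "\<dots> = 0"
        using w w0 proj_id[OF \<open>x - y \<in> K\<close>] by (intro sum.neutral) (metis lessThan_iff complex_vector.scale_zero_left)
      finally show "x = y"
        by simp
    qed
    moreover have "\<exists>x. Q ls x = v" for v
    proof -
      obtain \<beta> where "v - (\<Sum>k<d. \<beta> k *\<^sub>C ls ! k) \<in> range T"
        using basis_mod_spanning[OF ls UNIV_I] by blast
      then obtain n where "v - (\<Sum>k<d. \<beta> k *\<^sub>C ls ! k) = T n"
        by blast
      then have n: "v = T n + (\<Sum>k<d. \<beta> k *\<^sub>C ls ! k)"
        by (simp add: diff_eq_eq)
      \<comment> \<open>An element of the kernel that corrects the coordinates of \<open>n\<close>
        to the prescribed \<beta> without changing \<open>T n\<close>.\<close>
      define e where "e = (\<Sum>k<d. (\<beta> k - cinner (w k) n) *\<^sub>C es ! k)"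
      have "e \<in> K"
        unfolding e_def using esK
        by (intro subspace_intros[OF K]) auto
      then have "T e = 0"
        by (simp add: K_def ker_op_def)
      moreover have "cinner (w k) e = \<beta> k - cinner (w k) n" if "k < d" for k
        using that by (simp add: e_def cinner_sum_right cinner_scaleC_right we
            if_distrib[of "\<lambda>x. _ * x"] cong: if_cong)
      ultimately have "Q ls (n + e) = v"
        using ls(2) by (simp add: Q_def n bounded_clinearD[OF T] cinner_add_right)
      then show ?thesis by blast
    qed
    ultimately show ?thesis
      unfolding bij_def inj_def surj_def by metis
  qed
  define F where "F ls = fredholm_det ((\<lambda>x. T x + A x) \<circ> the_inv (Q ls))" for ls
  have F_step: "F ls = (1 + cinner (w i) y) * F (ls[i := ls ! i + \<delta>])"
    if "basis_mod UNIV (range T) ls" "basis_mod UNIV (range T) (ls[i := ls ! i + \<delta>])"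
      "length ls = d" "i < d" "Q ls y = \<delta>" for ls i y \<delta>
    unfolding F_def Q_def[abs_def]
    using that bijQ[of ls] bijQ[of "ls[i := ls ! i + \<delta>]"]
    by (intro fredholm_det_complement_step[OF assms(4)]) (simp_all add: Q_def[abs_def])
  have Qe: "Q ls (t *\<^sub>C es ! j) = t *\<^sub>C ls ! j" if "j < d" "length ls = d" for ls t j
  proof -
    have "T (es ! j) = 0"
      using esK[OF that(1)] by (simp add: K_def ker_op_def)
    moreover have "(\<Sum>k<d. cinner (w k) (t *\<^sub>C es ! j) *\<^sub>C ls ! k) = (\<Sum>k<d. if k = j then t *\<^sub>C ls ! j else 0)"
      using that by (intro sum.cong) (auto simp: cinner_scaleC_right we)
    ultimately show ?thesis
      using that by (simp add: Q_def bounded_clinearD[OF T])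
  qed

  define val where "val ls = (f A * F ls) \<odot>\<^bsub>det_line T\<^esub> pt es' ls" for ls
  have phi_val: "phi T f A N es es' = val (map N es)" if N: "admissible T N" for N
  proof -
    have lin: "clinear_on K N"
      using N by (simp add: admissible_def K_def)
    have "N (orth_proj K x) = (\<Sum>k<d. cinner (w k) x *\<^sub>C map N es ! k)" for x
    proof -
      have "N (orth_proj K x) = N (\<Sum>k<d. (es' ! k) (orth_proj K x) *\<^sub>C es ! k)"
        using is_dual_basis_expand[OF es es' projK[of x]] by (simp add: d_def)
      also have "\<dots> = (\<Sum>k<d. cinner (w k) x *\<^sub>C N (es ! k))"
        using esK by (subst clinear_on_sum[OF lin K]) (simp_all add: w)
      finally show ?thesis
        by (simp add: d_def)
    qed
    then show ?thesis
      by (simp add: phi_def val_def F_def Q_def[abs_def] pt_def ker_top coker_top K_def[symmetric]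
          W_def[symmetric] d_def o_def)
  qed

  \<comment> \<open>The basis stays fixed while the vectors \<open>L e\<close> are moved to the
    vectors \<open>M e\<close>. The intermediate lists need only be bases modulo the range.\<close>
  have "val (map M es) = val (map L es)"
  proof (rule basis_mod_induct[OF complex_vector.subspace_UNIV U subset_UNIV,
        where xs = "map L es" and ys = "map M es" and P = "\<lambda>ls. val ls = val (map L es)"])
    show "basis_mod UNIV (range T) (map L es)" "basis_mod UNIV (range T) (map M es)"
      using admissible_imp_basis_mod[OF linT] assms(5,6,8) by blast+
  next
    fix ls i j t
    assume ls: "basis_mod UNIV (range T) ls" "length ls = length (map M es)" "val ls = val (map L es)"
      and ij: "i < length ls" "j < length ls" "i \<noteq> j"
      and good: "basis_mod UNIV (range T) (ls[i := ls ! i + t *\<^sub>C ls ! j])"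
    \<comment> \<open>Here \<open>y\<close> is \<open>t\<close> times the \<open>j\<close>-th basis
      vector, on which \<open>w i\<close> vanishes, so the factor is 1.\<close>
    have "F ls = F (ls[i := ls ! i + t *\<^sub>C ls ! j])"
      using F_step[OF ls(1) good _ _ Qe[of j ls t]] ls ij by (simp add: d_def we cinner_scaleC_right)
    then show "val (ls[i := ls ! i + t *\<^sub>C ls ! j]) = val (map L es)"
      using ls(3) ij by (simp add: val_def pt_def wedge_add)
  next
    fix ls i t
    assume ls: "basis_mod UNIV (range T) ls" "length ls = length (map M es)" "val ls = val (map L es)"
      and i: "i < length ls" and t: "t \<noteq> (0 :: complex)"
      and good: "basis_mod UNIV (range T) (ls[i := t *\<^sub>C ls ! i])"
    \<comment> \<open>Scaling is the addition of \<open>(t - 1) *\<^sub>C ls ! i\<close>, with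
      \<open>y\<close> equal to \<open>t - 1\<close> times the \<open>i\<close>-th basis vector. The
      factor \<open>1 + (t - 1) = t\<close> cancels against the scaling of the wedge
      product.\<close>
    have eq: "ls ! i + (t - 1) *\<^sub>C ls ! i = t *\<^sub>C ls ! i"
      by (simp add: complex_vector.scale_left_diff_distrib)
    have "F ls = t * F (ls[i := t *\<^sub>C ls ! i])"
      using F_step[OF ls(1) _ _ _ Qe[of i ls "t - 1"], of i] good ls i
      by (simp add: d_def we cinner_scaleC_right eq)
    moreover have "pt es' (ls[i := t *\<^sub>C ls ! i]) = t \<odot>\<^bsub>det_line T\<^esub> pt es' ls"
      unfolding pt_def line using wedge_scale[OF i] ls(2) wK[OF es'] wW[of ls]
      by (simp add: d_def pure_tensor_smult_right)
    ultimately have "val (ls[i := t *\<^sub>C ls ! i]) = val ls"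
      using t by (simp add: val_def line pt_def pure_tensor_smult_smult mult_ac)
    then show "val (ls[i := t *\<^sub>C ls ! i]) = val (map L es)"
      using ls(3) by simp
  next
    fix ls i u
    assume ls: "basis_mod UNIV (range T) ls" "length ls = length (map M es)" "val ls = val (map L es)"
      and i: "i < length ls" and u: "u \<in> range T" and good: "basis_mod UNIV (range T) (ls[i := ls ! i + u])"
    obtain n where n: "u = T n"
      using u by blast
    \<comment> \<open>Removing the kernel coordinates of \<open>n\<close> gives a solution
      \<open>n - e\<close> on which all \<open>w k\<close> vanish, so the factor is 1; the classes
      in the cokernel do not change either.\<close>
    define e where "e = (\<Sum>k<d. cinner (w k) n *\<^sub>C es ! k)"
    have "e \<in> K"
      unfolding e_def using esK
      by (intro subspace_intros[OF K]) auto
    then have "T e = 0"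
      by (simp add: K_def ker_op_def)
    have we': "cinner (w k) (n - e) = 0" if "k < d" for k
      using that by (simp add: e_def cinner_diff_right cinner_sum_right cinner_scaleC_right we
          if_distrib[of "\<lambda>x. _ * x"] cong: if_cong)
    have "Q ls (n - e) = u"
      using \<open>T e = 0\<close> we' ls(2) by (simp add: Q_def n bounded_clinearD[OF T] d_def)
    then have "F ls = F (ls[i := ls ! i + u])"
      using F_step[OF ls(1) good, of "n - e"] ls i we' by (simp add: d_def)
    moreover have "map (coker_proj T) (ls[i := ls ! i + u]) = map (coker_proj T) ls"
    proof -
      have "coker_proj T (ls ! i + u) = coker_proj T (ls ! i)"
        using u by (simp add: coker_proj_def coset_eq_iff[OF U])
      then show ?thesis
        using i by (simp add: map_update) (metis list_update_id nth_map)
    qed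
    ultimately show "val (ls[i := ls ! i + u]) = val (map L es)"
      using ls(3) by (simp add: val_def pt_def)
  qed simp_all
  then have LM: "phi T f A L es es' = phi T f A M es es'"
    using phi_val assms(5,8) by simp

  have linM: "clinear_on K M"
    using assms(8) by (simp add: admissible_def K_def)
  have Madd: "M (x + t *\<^sub>C y) = M x + t *\<^sub>C M y" "M (t *\<^sub>C y) = t *\<^sub>C M y" if "x \<in> K" "y \<in> K" for x y t
    using linM that complex_vector.subspace_scale[OF K] by (simp_all add: clinear_on_def)
  have dual_car: "xs' ! k \<in> carrier (dual_space K)" "length xs' = length xs" "set xs' \<subseteq> carrier (dual_space K)"
    "\<And>l. l < length xs \<Longrightarrow> (xs' ! k) (xs ! l) = (if k = l then 1 else 0)"
    if "is_dual_basis K xs xs'" "k < length xs" for xs xs' k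
    using that by (auto simp: is_dual_basis_def subset_iff)
  have dual_add: "g (x + t *\<^sub>C y) = g x + t * g y" "g (t *\<^sub>C y) = t * g y"
    if "g \<in> carrier (dual_space K)" "x \<in> K" "y \<in> K" for g x y t
    using that complex_vector.subspace_scale[OF K]
    by (simp_all add: dual_space_def clinear_on_def scaleC_complex_def)
  \<comment> \<open>The determinant factor involves \<open>M\<close> but no basis, so only the
    tensor has to be compared. The dual basis changes along with the basis and is therefore
    quantified inside the induction predicate.\<close>
  have "\<forall>xs'. is_dual_basis K us xs' \<longrightarrow> pt xs' (map M us) = pt es' (map M es)"
  proof (rule basis_mod_induct[OF K complex_vector.subspace_single_0, where xs = es and ys = us
        and P = "\<lambda>xs. \<forall>xs'. is_dual_basis K xs xs' \<longrightarrow> pt xs' (map M xs) = pt es' (map M es)"])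
    show "{0} \<subseteq> K"
      using complex_vector.subspace_0[OF K] by simp
    show "basis_mod K {0} es" "basis_mod K {0} us"
      by (simp_all add: ordered_basis_imp_basis_mod es us)
    show "length es = length us"
      using d by (simp add: d_def)
    show "\<forall>xs'. is_dual_basis K es xs' \<longrightarrow> pt xs' (map M es) = pt es' (map M es)"
      using is_dual_basis_unique[OF es es'] by blast
  next
    fix xs i j t
    assume xs: "basis_mod K {0} xs" "length xs = length us"
      "\<forall>xs'. is_dual_basis K xs xs' \<longrightarrow> pt xs' (map M xs) = pt es' (map M es)"
      and ij: "i < length xs" "j < length xs" "i \<noteq> j"
    have xK: "xs ! k \<in> K" if "k < length xs" for k
      using xs(1) that by (auto simp: basis_mod_def)
    define zs where "zs = xs[i := xs ! i + t *\<^sub>C xs ! j]"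
    show "\<forall>xs'. is_dual_basis K (xs[i := xs ! i + t *\<^sub>C xs ! j]) xs' \<longrightarrow>
        pt xs' (map M (xs[i := xs ! i + t *\<^sub>C xs ! j])) = pt es' (map M es)"
      unfolding zs_def[symmetric]
    proof (intro allI impI)
      fix zs'
      assume zs': "is_dual_basis K zs zs'"
      have len: "length zs = length xs" "length zs' = length xs"
        using zs' by (simp_all add: zs_def is_dual_basis_def)
      have car: "zs' ! k \<in> carrier (dual_space K)" if "k < length xs" for k
        using dual_car(1)[OF zs'] that len by simp
      \<comment> \<open>Adding \<open>t\<close> times vector \<open>j\<close> to vector
        \<open>i\<close> changes the dual basis contragrediently; this recovers the dual basis of
        \<open>xs\<close> from that of \<open>zs\<close> by adding \<open>t\<close> times functional
        \<open>i\<close> to functional \<open>j\<close>.\<close>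
      define xs' where "xs' = zs'[j := zs' ! j \<oplus>\<^bsub>dual_space K\<^esub> t \<odot>\<^bsub>dual_space K\<^esub> zs' ! i]"
      have zx: "(zs' ! k) (xs ! l) = (if k = l then 1 else 0) - (if l = i then t * (if k = j then 1 else 0) else 0)"
        if kl: "k < length xs" "l < length xs" for k l
      proof (cases "l = i")
        case True
        have "(zs' ! k) (zs ! i) = (zs' ! k) (xs ! i) + t * (zs' ! k) (xs ! j)"
          using dual_add(1)[OF car[OF kl(1)] xK[OF ij(1)] xK[OF ij(2)]] ij by (simp add: zs_def)
        moreover have "(zs' ! k) (zs ! i) = (if k = i then 1 else 0)" "(zs' ! k) (zs ! j) = (if k = j then 1 else 0)"
          using dual_car(4)[OF zs'] kl ij len by simp_all
        moreover have "zs ! j = xs ! j"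
          using ij by (simp add: zs_def)
        ultimately show ?thesis
          using True by (auto simp: algebra_simps)
      next
        case False
        then have "zs ! l = xs ! l"
          by (simp add: zs_def)
        then show ?thesis
          using dual_car(4)[OF zs', of k l] kl len False by simp
      qed
      have "is_dual_basis K xs xs'"
        unfolding is_dual_basis_def
      proof (intro conjI allI impI)
        show "length xs' = length xs"
          by (simp add: xs'_def len)
        show "set xs' \<subseteq> carrier (dual_space K)"
          unfolding xs'_def using dual_car(3)[OF zs', of i] ij len
            dual_space_add_smult(2)[OF car[OF ij(2)] car[OF ij(1)] K, of t]
          by (intro order.trans[OF set_update_subset_insert]) auto
        fix k l assume kl: "k < length xs" "l < length xs"
        show "(xs' ! k) (xs ! l) = (if k = l then 1 else 0)"
          using kl ij zx[OF kl] zx[OF ij(1) kl(2)] zx[OF ij(2) kl(2)] len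
            dual_space_add_smult(4)[OF car[OF ij(2)] car[OF ij(1)] K xK[OF kl(2)], of t]
          by (cases "k = j") (auto simp: xs'_def)
      qed
      then have "pt xs' (map M xs) = pt es' (map M es)"
        using xs(3) by blast
      moreover have "wedge (dual_space K) xs' = wedge (dual_space K) zs'"
        unfolding xs'_def using ij len dual_car(3)[OF zs', of i]
          dual_space_add_smult(1)[OF car[OF ij(2)] car[OF ij(1)] K, of t]
        by (intro wedge_add_multiple) auto
      moreover have "map M zs = (map M xs)[i := map M xs ! i + t *\<^sub>C map M xs ! j]"
        using ij by (simp add: zs_def map_update Madd xK)
      ultimately show "pt zs' (map M zs) = pt es' (map M es)"
        using wedge_add[of i "map M xs" j t] ij by (simp add: pt_def)
    qed
  next
    fix xs i t
    assume xs: "basis_mod K {0} xs" "length xs = length us"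
      "\<forall>xs'. is_dual_basis K xs xs' \<longrightarrow> pt xs' (map M xs) = pt es' (map M es)"
      and i: "i < length xs" and t: "t \<noteq> (0 :: complex)"
    have xK: "xs ! k \<in> K" if "k < length xs" for k
      using xs(1) that by (auto simp: basis_mod_def)
    define zs where "zs = xs[i := t *\<^sub>C xs ! i]"
    show "\<forall>xs'. is_dual_basis K (xs[i := t *\<^sub>C xs ! i]) xs' \<longrightarrow>
        pt xs' (map M (xs[i := t *\<^sub>C xs ! i])) = pt es' (map M es)"
      unfolding zs_def[symmetric]
    proof (intro allI impI)
      fix zs'
      assume zs': "is_dual_basis K zs zs'"
      have len: "length zs = length xs" "length zs' = length xs"
        using zs' by (simp_all add: zs_def is_dual_basis_def)
      have car: "zs' ! k \<in> carrier (dual_space K)" if "k < length xs" for k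
        using dual_car(1)[OF zs'] that len by simp
      \<comment> \<open>Scaling a vector by \<open>t\<close> divides its dual functional by
        \<open>t\<close>. The two scalars cancel in the tensor product.\<close>
      define xs' where "xs' = zs'[i := t \<odot>\<^bsub>dual_space K\<^esub> zs' ! i]"
      have zx: "(zs' ! k) (xs ! l) = (if k = l then (if l = i then 1 / t else 1) else 0)"
        if kl: "k < length xs" "l < length xs" for k l
      proof (cases "l = i")
        case True
        have "(zs' ! k) (zs ! i) = t * (zs' ! k) (xs ! i)"
          using dual_add(2)[OF car[OF kl(1)] xK[OF i] xK[OF i]] i by (simp add: zs_def)
        moreover have "(zs' ! k) (zs ! i) = (if k = i then 1 else 0)"
          using dual_car(4)[OF zs'] kl i len by simp
        ultimately show ?thesis
          using True t by (auto simp: field_simps)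
      next
        case False
        then have "zs ! l = xs ! l"
          by (simp add: zs_def)
        then show ?thesis
          using dual_car(4)[OF zs', of k l] kl len False by simp
      qed
      have "is_dual_basis K xs xs'"
        unfolding is_dual_basis_def
      proof (intro conjI allI impI)
        show "length xs' = length xs"
          by (simp add: xs'_def len)
        show "set xs' \<subseteq> carrier (dual_space K)"
          unfolding xs'_def using dual_car(3)[OF zs', of i] i len
            dual_space_add_smult(1)[OF car[OF i] car[OF i] K, of t]
          by (intro order.trans[OF set_update_subset_insert]) auto
        fix k l assume kl: "k < length xs" "l < length xs"
        show "(xs' ! k) (xs ! l) = (if k = l then 1 else 0)"
          using kl i zx[OF kl] zx[OF i kl(2)] len t
            dual_space_add_smult(3)[OF car[OF i] car[OF i] K xK[OF kl(2)], of t]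
          by (cases "k = i") (auto simp: xs'_def)
      qed
      then have "pt xs' (map M xs) = pt es' (map M es)"
        using xs(3) by blast
      moreover have "pt xs' (map M xs) = pt zs' (map M zs)"
      proof -
        have "length xs = d"
          using xs(2) d by simp
        have "wedge (dual_space K) xs' = t \<odot>\<^bsub>ext_power (dual_space K) d\<^esub> wedge (dual_space K) zs'"
          using wedge_smult[of i zs' "dual_space K" t] i len dual_car(3)[OF zs', of i] \<open>length xs = d\<close>
          by (simp add: xs'_def)
        moreover have "map M zs = (map M xs)[i := t *\<^sub>C map M xs ! i]"
          using i by (simp add: zs_def map_update Madd(2)[OF xK xK])
        then have "wedge W (map (coker_proj T) (map M zs)) = t \<odot>\<^bsub>ext_power W d\<^esub> wedge W (map (coker_proj T) (map M xs))"
          using wedge_scale[of i "map M xs" t] i \<open>length xs = d\<close> by simp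
        moreover have "wedge (dual_space K) zs' \<in> carrier (ext_power (dual_space K) d)"
          using wK[OF zs'] len \<open>length xs = d\<close> by simp
        moreover have "wedge W (map (coker_proj T) (map M xs)) \<in> carrier (ext_power W d)"
          using wW[of "map M xs"] \<open>length xs = d\<close> by simp
        ultimately show ?thesis
          by (simp add: pt_def pure_tensor_smult_left pure_tensor_smult_right del: map_map)
      qed
      ultimately show "pt zs' (map M zs) = pt es' (map M es)"
        by simp
    qed
  \<comment> \<open>A shift by an element of \<open>{0}\<close> changes nothing.\<close>
  qed auto
  then have "pt us' (map M us) = pt es' (map M es)"
    using us' by blast
  then have "phi T f A M es es' = phi T f A M us us'"
    by (simp add: phi_def pt_def ker_top coker_top K_def[symmetric] W_def[symmetric] o_def)
  moreover have "phi T f A L es es' \<in> carrier (det_line T)"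
    unfolding phi_val[OF assms(5)] val_def pt_def line
    using wK[OF es'] wW[of "map L es"] by (intro pure_tensor_carrier) (simp_all add: d_def del: map_map)
  ultimately show ?thesis
    using LM by simp
qed

end
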